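(* Let $A$ be a bounded non-positive right dg noetherian dg ring. Then there exists a bijection $\operatorname{Spec}(\mathsf{dgMod}\,A)\cong\operatorname{Spec}(\mathsf{Mod}\,A^0)\times\mathbb{Z}$, where the map from the right-hand side to the left-hand side is given by $(\overline{H},n)\mapsto\overline{D(H)[n]}$. In particular, $\operatorname{Spec}^{\mathbb{Z}}(\mathsf{dgMod}\,A)=\operatorname{Spec}(\mathsf{Mod}\,A^0)$, via the induced bijection.
   Context: Dg rings (not necessarily commutative) and dg modules are cohomologically graded ($d$ has degree $+1$). A dg ring $A$ is non-positive if $A^i=0$ for $i>0$, bounded if $A^n=0$ for $|n|\gg0$, and right dg noetherian if every ascending chain of right dg ideals is stationary. $\mathsf{dgMod}\,A$ is the abelian category of right dg $A$-modules with degree-$0$ $A$-linear chain maps; $\mathsf{Mod}\,A^0$ is the category of right $A^0$-modules. For a right $A^0$-module $M$, $D(M)$ is the dg $A$-module whose underlying complex is $M\xrightarrow{\mathrm{id}}M$ in degrees $-1$ and $0$, with action of $a\in A^i$ on $x\in D(M)^j$: $x\cdot a=xa$ if $i=0$; $x\cdot a=x\,d_A(a)$ (in degree $-1$) if $i=-1$ and $j=0$; $x\cdot a=0$ otherwise. For an abelian category $\mathcal{A}$: an object $H\neq0$ is monoform if for every nonzero subobject $L$ of $H$, the objects $H$ and $H/L$ have no common nonzero subobject (up to isomorphism); two monoform objects are atom-equivalent if they have a common nonzero subobject; $\operatorname{Spec}\mathcal{A}$ is the set of atom-equivalence classes $\overline{H}$ of monoform objects. $\mathbb{Z}$ acts on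 $\operatorname{Spec}(\mathsf{dgMod}\,A)$ by shifts, $n\cdot\overline{X}=\overline{X[n]}$, and $\operatorname{Spec}^{\mathbb{Z}}(\mathsf{dgMod}\,A)$ is the quotient by this action. *)

theory Defs
  imports "HOL-Algebra.Ring" "HOL-Algebra.Group_Action" "HOL-Algebra.Elementary_Groups"
begin

section \<open>Categories and their atom spectra\<close>

record ('o, 'f) category =
  Obj :: "'o set"
  Hom :: "'o \<Rightarrow> 'o \<Rightarrow> 'f set"
  Comp :: "'o \<Rightarrow> 'o \<Rightarrow> 'o \<Rightarrow> 'f \<Rightarrow> 'f \<Rightarrow> 'f"
    \<comment> \<open>\<open>Comp C X Y Z g f\<close> is the composite of \<open>f : X \<rightarrow> Y\<close> and \<open>g : Y \<rightarrow> Z\<close>\<close>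

definition zero_object :: "('o, 'f) category \<Rightarrow> 'o \<Rightarrow> bool" where
  "zero_object C Z \<longleftrightarrow> Z \<in> Obj C \<and>
     (\<forall>X \<in> Obj C. (\<exists>!f. f \<in> Hom C X Z) \<and> (\<exists>!f. f \<in> Hom C Z X))"

definition zero_arrow :: "('o, 'f) category \<Rightarrow> 'o \<Rightarrow> 'o \<Rightarrow> 'f \<Rightarrow> bool" where
  "zero_arrow C X Y f \<longleftrightarrow>
     (\<exists>Z g h. zero_object C Z \<and> g \<in> Hom C X Z \<and> h \<in> Hom C Z Y \<and> f = Comp C X Z Y h g)"

definition mono_arrow :: "('o, 'f) category \<Rightarrow> 'o \<Rightarrow> 'o \<Rightarrow> 'f \<Rightarrow> bool" where
  "mono_arrow C X Y f \<longleftrightarrow> X \<in> Obj C \<and> Y \<in> Obj C \<and> f \<in> Hom C X Y \<and>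
     (\<forall>W \<in> Obj C. \<forall>g \<in> Hom C W X. \<forall>h \<in> Hom C W X.
        Comp C W X Y f g = Comp C W X Y f h \<longrightarrow> g = h)"

definition is_cokernel :: "('o, 'f) category \<Rightarrow> 'o \<Rightarrow> 'o \<Rightarrow> 'f \<Rightarrow> 'o \<Rightarrow> 'f \<Rightarrow> bool" where
  "is_cokernel C X Y f Q q \<longleftrightarrow>
     Q \<in> Obj C \<and> q \<in> Hom C Y Q \<and> zero_arrow C X Q (Comp C X Y Q q f) \<and>
     (\<forall>W \<in> Obj C. \<forall>g \<in> Hom C Y W. zero_arrow C X W (Comp C X Y W g f) \<longrightarrow>
        (\<exists>!h. h \<in> Hom C Q W \<and> g = Comp C Y Q W h q))"

definition common_nonzero_subobject :: "('o, 'f) category \<Rightarrow> 'o \<Rightarrow> 'o \<Rightarrow> bool" where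
  "common_nonzero_subobject C X Y \<longleftrightarrow>
     (\<exists>N \<in> Obj C. \<not> zero_object C N \<and> (\<exists>f. mono_arrow C N X f) \<and> (\<exists>g. mono_arrow C N Y g))"

text \<open>The subobjects of \<open>H\<close> are represented by the monomorphisms \<open>l : L \<rightarrow> H\<close>, and \<open>H/L\<close> is
  the cokernel of \<open>l\<close>.\<close>

definition monoform :: "('o, 'f) category \<Rightarrow> 'o \<Rightarrow> bool" where
  "monoform C H \<longleftrightarrow> H \<in> Obj C \<and> \<not> zero_object C H \<and>
     (\<forall>L l Q q. mono_arrow C L H l \<and> \<not> zero_object C L \<and> is_cokernel C L H l Q q \<longrightarrow>
        \<not> common_nonzero_subobject C H Q)"

definition atom_rel :: "('o, 'f) category \<Rightarrow> ('o \<times> 'o) set" where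
  "atom_rel C = {(X, Y). monoform C X \<and> monoform C Y \<and> common_nonzero_subobject C X Y}"

definition atom :: "('o, 'f) category \<Rightarrow> 'o \<Rightarrow> 'o set" where
  "atom C H = atom_rel C `` {H}"

definition Spec :: "('o, 'f) category \<Rightarrow> 'o set set" where
  "Spec C = {H. monoform C H} // atom_rel C"


section \<open>Right modules\<close>

text \<open>Abelian groups other than the additive group of a ring are \<^locale>\<open>comm_group\<close>s, so that
  their addition is written multiplicatively.  The ring is not assumed to be
  commutative, unlike in HOL-Algebra.Module.\<close>

record ('a, 'm) right_module = "'m monoid" +
  ract :: "'m \<Rightarrow> 'a \<Rightarrow> 'm"

locale right_module = R?: ring R + M?: comm_group M
  for R :: "'a ring" and M :: "('a, 'm) right_module" +
  assumes ract_closed: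
      "\<lbrakk>x \<in> carrier M; a \<in> carrier R\<rbrakk> \<Longrightarrow> ract M x a \<in> carrier M"
    and ract_add_left:
      "\<lbrakk>x \<in> carrier M; y \<in> carrier M; a \<in> carrier R\<rbrakk>
       \<Longrightarrow> ract M (x \<otimes>\<^bsub>M\<^esub> y) a = ract M x a \<otimes>\<^bsub>M\<^esub> ract M y a"
    and ract_add_right:
      "\<lbrakk>x \<in> carrier M; a \<in> carrier R; b \<in> carrier R\<rbrakk>
       \<Longrightarrow> ract M x (a \<oplus>\<^bsub>R\<^esub> b) = ract M x a \<otimes>\<^bsub>M\<^esub> ract M x b"
    and ract_assoc:
      "\<lbrakk>x \<in> carrier M; a \<in> carrier R; b \<in> carrier R\<rbrakk>
       \<Longrightarrow> ract M (ract M x a) b = ract M x (a \<otimes>\<^bsub>R\<^esub> b)"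
    and ract_one:
      "x \<in> carrier M \<Longrightarrow> ract M x \<one>\<^bsub>R\<^esub> = x"

text \<open>Objects of \<open>RMod R\<close> are the right \<open>R\<close>-modules carried by a subset of the type \<open>'m\<close>;
  arrows are \<^const>\<open>extensional\<close>, so that they are determined by their values on the carrier.\<close>

definition RMod :: "'a ring \<Rightarrow> (('a, 'm) right_module, 'm \<Rightarrow> 'm) category" where
  "RMod R = \<lparr>
     Obj = {M. right_module R M},
     Hom = (\<lambda>M N. {f \<in> extensional (carrier M) \<inter> hom M N.
              \<forall>x \<in> carrier M. \<forall>a \<in> carrier R. f (ract M x a) = ract N (f x) a}),
     Comp = (\<lambda>L M N g f. compose (carrier L) g f)\<rparr>"


section \<open>Dg rings and dg modules\<close>

text \<open>Graded objects are families indexed by the degree: \<open>grp C i\<close> is the abelian group \<open>C\<^sup>i\<close>.\<close>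

record 'm cochain_complex =
  grp :: "int \<Rightarrow> 'm monoid"
  diff :: "int \<Rightarrow> 'm \<Rightarrow> 'm"

locale cochain_complex =
  fixes C :: "('m, 'z) cochain_complex_scheme"
  assumes grp_comm_group: "comm_group (grp C i)"
    and diff_hom: "diff C i \<in> hom (grp C i) (grp C (i + 1))"
    and diff_diff: "x \<in> carrier (grp C i) \<Longrightarrow> diff C (i + 1) (diff C i x) = \<one>\<^bsub>grp C (i + 1 + 1)\<^esub>"

text \<open>The element \<open>(-1)\<^sup>i x\<close> of an abelian group.\<close>

definition signed :: "('m, 'z) monoid_scheme \<Rightarrow> int \<Rightarrow> 'm \<Rightarrow> 'm" where
  "signed G i x = (if even i then x else inv\<^bsub>G\<^esub> x)"

text \<open>\<open>mul A i j\<close> is the multiplication \<open>A\<^sup>i \<times> A\<^sup>j \<rightarrow> A\<^bsup>i+j\<^esup>\<close>.\<close>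

record 'a dg_ring = "'a cochain_complex" +
  mul :: "int \<Rightarrow> int \<Rightarrow> 'a \<Rightarrow> 'a \<Rightarrow> 'a"
  unity :: 'a

locale dg_ring = cochain_complex A for A :: "'a dg_ring" +
  assumes unity_closed: "unity A \<in> carrier (grp A 0)"
    and mul_closed:
      "\<lbrakk>a \<in> carrier (grp A i); b \<in> carrier (grp A j)\<rbrakk> \<Longrightarrow> mul A i j a b \<in> carrier (grp A (i + j))"
    and mul_add_left:
      "\<lbrakk>a \<in> carrier (grp A i); a' \<in> carrier (grp A i); b \<in> carrier (grp A j)\<rbrakk>
       \<Longrightarrow> mul A i j (a \<otimes>\<^bsub>grp A i\<^esub> a') b = mul A i j a b \<otimes>\<^bsub>grp A (i + j)\<^esub> mul A i j a' b"
    and mul_add_right: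
      "\<lbrakk>a \<in> carrier (grp A i); b \<in> carrier (grp A j); b' \<in> carrier (grp A j)\<rbrakk>
       \<Longrightarrow> mul A i j a (b \<otimes>\<^bsub>grp A j\<^esub> b') = mul A i j a b \<otimes>\<^bsub>grp A (i + j)\<^esub> mul A i j a b'"
    and mul_assoc:
      "\<lbrakk>a \<in> carrier (grp A i); b \<in> carrier (grp A j); c \<in> carrier (grp A k)\<rbrakk>
       \<Longrightarrow> mul A (i + j) k (mul A i j a b) c = mul A i (j + k) a (mul A j k b c)"
    and mul_unity_left: "a \<in> carrier (grp A i) \<Longrightarrow> mul A 0 i (unity A) a = a"
    and mul_unity_right: "a \<in> carrier (grp A i) \<Longrightarrow> mul A i 0 a (unity A) = a"
    and mul_leibniz:
      "\<lbrakk>a \<in> carrier (grp A i); b \<in> carrier (grp A j)\<rbrakk>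
       \<Longrightarrow> diff A (i + j) (mul A i j a b) =
           mul A (i + 1) j (diff A i a) b
             \<otimes>\<^bsub>grp A (i + j + 1)\<^esub> signed (grp A (i + j + 1)) i (mul A i (j + 1) a (diff A j b))"

definition degree0_ring :: "'a dg_ring \<Rightarrow> 'a ring" where
  "degree0_ring A = \<lparr>carrier = carrier (grp A 0), mult = mul A 0 0, one = unity A,
     zero = \<one>\<^bsub>grp A 0\<^esub>, add = (\<lambda>x y. x \<otimes>\<^bsub>grp A 0\<^esub> y)\<rparr>"

definition bounded_dg :: "'a dg_ring \<Rightarrow> bool" where
  "bounded_dg A \<longleftrightarrow> (\<exists>N. \<forall>n. \<bar>n\<bar> > N \<longrightarrow> carrier (grp A n) = {\<one>\<^bsub>grp A n\<^esub>})"

definition non_positive_dg :: "'a dg_ring \<Rightarrow> bool" where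
  "non_positive_dg A \<longleftrightarrow> (\<forall>i>0. carrier (grp A i) = {\<one>\<^bsub>grp A i\<^esub>})"

text \<open>A graded subgroup is given by its homogeneous parts \<open>J i \<subseteq> A\<^sup>i\<close>.\<close>

definition right_dg_ideal :: "'a dg_ring \<Rightarrow> (int \<Rightarrow> 'a set) \<Rightarrow> bool" where
  "right_dg_ideal A J \<longleftrightarrow>
     (\<forall>i. subgroup (J i) (grp A i)) \<and>
     (\<forall>i. \<forall>x \<in> J i. diff A i x \<in> J (i + 1)) \<and>
     (\<forall>i j. \<forall>x \<in> J i. \<forall>a \<in> carrier (grp A j). mul A i j x a \<in> J (i + j))"

definition right_dg_noetherian :: "'a dg_ring \<Rightarrow> bool" where
  "right_dg_noetherian A \<longleftrightarrow>
     (\<forall>J :: nat \<Rightarrow> int \<Rightarrow> 'a set.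
        (\<forall>n. right_dg_ideal A (J n)) \<and> (\<forall>n i. J n i \<subseteq> J (Suc n) i) \<longrightarrow>
        (\<exists>N. \<forall>n\<ge>N. J n = J N))"

text \<open>\<open>act M i j\<close> is the right action \<open>M\<^sup>i \<times> A\<^sup>j \<rightarrow> M\<^bsup>i+j\<^esup>\<close>.\<close>

record ('a, 'm) dg_module = "'m cochain_complex" +
  act :: "int \<Rightarrow> int \<Rightarrow> 'm \<Rightarrow> 'a \<Rightarrow> 'm"

locale dg_module = A?: dg_ring A + M?: cochain_complex M
  for A :: "'a dg_ring" and M :: "('a, 'm) dg_module" +
  assumes act_closed:
      "\<lbrakk>x \<in> carrier (grp M i); a \<in> carrier (grp A j)\<rbrakk> \<Longrightarrow> act M i j x a \<in> carrier (grp M (i + j))"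
    and act_add_left:
      "\<lbrakk>x \<in> carrier (grp M i); y \<in> carrier (grp M i); a \<in> carrier (grp A j)\<rbrakk>
       \<Longrightarrow> act M i j (x \<otimes>\<^bsub>grp M i\<^esub> y) a = act M i j x a \<otimes>\<^bsub>grp M (i + j)\<^esub> act M i j y a"
    and act_add_right:
      "\<lbrakk>x \<in> carrier (grp M i); a \<in> carrier (grp A j); b \<in> carrier (grp A j)\<rbrakk>
       \<Longrightarrow> act M i j x (a \<otimes>\<^bsub>grp A j\<^esub> b) = act M i j x a \<otimes>\<^bsub>grp M (i + j)\<^esub> act M i j x b"
    and act_assoc:
      "\<lbrakk>x \<in> carrier (grp M i); a \<in> carrier (grp A j); b \<in> carrier (grp A k)\<rbrakk>
       \<Longrightarrow> act M (i + j) k (act M i j x a) b = act M i (j + k) x (mul A j k a b)"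
    and act_unity: "x \<in> carrier (grp M i) \<Longrightarrow> act M i 0 x (unity A) = x"
    and act_leibniz:
      "\<lbrakk>x \<in> carrier (grp M i); a \<in> carrier (grp A j)\<rbrakk>
       \<Longrightarrow> diff M (i + j) (act M i j x a) =
           act M (i + 1) j (diff M i x) a
             \<otimes>\<^bsub>grp M (i + j + 1)\<^esub> signed (grp M (i + j + 1)) i (act M i (j + 1) x (diff A j a))"

definition dgMod :: "'a dg_ring \<Rightarrow> (('a, 'm) dg_module, int \<Rightarrow> 'm \<Rightarrow> 'm) category" where
  "dgMod A = \<lparr>
     Obj = {M. dg_module A M},
     Hom = (\<lambda>M N. {f.
       (\<forall>i. f i \<in> extensional (carrier (grp M i)) \<inter> hom (grp M i) (grp N i)) \<and>
       (\<forall>i. \<forall>x \<in> carrier (grp M i). f (i + 1) (diff M i x) = diff N i (f i x)) \<and>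
       (\<forall>i j. \<forall>x \<in> carrier (grp M i). \<forall>a \<in> carrier (grp A j).
          f (i + j) (act M i j x a) = act N i j (f i x) a)}),
     Comp = (\<lambda>L M N g f. \<lambda>i. compose (carrier (grp L i)) (g i) (f i))\<rparr>"

text \<open>The shift \<open>X[n]\<close> has \<open>X[n]\<^sup>i = X\<^bsup>n+i\<^esup>\<close> and differential \<open>(-1)\<^sup>n d\<close>; for right modules
  the action carries no sign.\<close>

definition shift :: "int \<Rightarrow> ('a, 'm) dg_module \<Rightarrow> ('a, 'm) dg_module" where
  "shift n X = \<lparr>
     grp = (\<lambda>i. grp X (n + i)),
     diff = (\<lambda>i x. signed (grp X (n + i + 1)) n (diff X (n + i) x)),
     act = (\<lambda>i j. act X (n + i) j)\<rparr>"

text \<open>In the degrees other than \<open>-1\<close> and \<open>0\<close>, \<open>D(M)\<close> is the zero subgroup of \<open>M\<close>.\<close>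

definition D :: "'a dg_ring \<Rightarrow> ('a, 'm) right_module \<Rightarrow> ('a, 'm) dg_module" where
  "D A M = \<lparr>
     grp = (\<lambda>i. \<lparr>carrier = (if i = -1 \<or> i = 0 then carrier M else {\<one>\<^bsub>M\<^esub>}),
                 mult = (\<lambda>x y. x \<otimes>\<^bsub>M\<^esub> y), one = \<one>\<^bsub>M\<^esub>\<rparr>),
     diff = (\<lambda>i x. if i = -1 then x else \<one>\<^bsub>M\<^esub>),
     act = (\<lambda>j i x a. if i = 0 then ract M x a
                      else if i = -1 \<and> j = 0 then ract M x (diff A (-1) a)
                      else \<one>\<^bsub>M\<^esub>)\<rparr>"

text \<open>The action of \<open>\<int>\<close> on atoms: \<open>n\<close> sends the class of \<open>X\<close> to the class of \<open>X[n]\<close>.  The union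
  runs over all representatives, whose shifts all have the same class.\<close>

definition shift_atom ::
    "'a dg_ring \<Rightarrow> int \<Rightarrow> ('a, 'm) dg_module set \<Rightarrow> ('a, 'm) dg_module set" where
  "shift_atom A n \<alpha> = (\<Union>X \<in> \<alpha>. atom (dgMod A) (shift n X))"

definition SpecZ :: "'a dg_ring \<Rightarrow> ('a, 'm) dg_module set set set" where
  "SpecZ A = orbits integer_group (Spec (dgMod A)) (shift_atom A)"

end

theory Submission
  imports Defs
begin

text \<open>
  An embedding into \<open>D(H)[n]\<close> is controlled by its part in the top degree \<open>-n\<close>, and taking this part
  is an exact functor to \<open>Mod A\<^sup>0\<close> that recovers \<open>H\<close>; hence \<open>D(H)[n]\<close> is monoform as soon as \<open>H\<close> is,
  and its atom determines \<open>n\<close> and the atom of \<open>H\<close>.  Conversely, in a nonzero dg module \<open>X\<close> some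
  nonzero element of some degree \<open>m\<close> is annihilated by all \<open>A\<^sup>j\<close> with \<open>j < 0\<close>, because \<open>A\<close> is bounded.
  Let \<open>N \<subseteq> X\<^sup>m\<close> consist of all such elements.  If \<open>d\<close> is injective on \<open>N\<close>, then \<open>N + d(N)\<close> is
  isomorphic to \<open>D(N)[-m-1]\<close>; otherwise the cycles in \<open>N\<close> form a dg submodule that is concentrated
  in degree \<open>m\<close> and embeds into \<open>D(ker d)[-m]\<close>.  Exactness of \<open>D\<close> makes the module so obtained
  monoform whenever \<open>X\<close> is.
\<close>


section \<open>Concrete abelian categories\<close>

text \<open>Monomorphisms, cokernels and zero objects are given by universal properties, whereas the
  argument works with elements; \<open>concrete_abelian\<close> translates once for both categories.
  All objects live on subsets of the fixed type \<open>'m\<close>, so quotients have to be built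
  there as well. The key identity is the Leibniz rule for an element y of degree m killed by every
  A^j with j < 0: if a has degree -1, then 0 = d(y a) = (dy) a + (-1)^m y d(a). Up to sign this is
  the rule by which A^{-1} acts on the degree 0 part of D, which explains why N + d(N) looks like
  D(N). If dy = 0, it says y d(a) = 0, the condition under which the top degree of D stands alone as
  a dg module. N becomes the copy in degree -1 and the cycles the copy in degree 0, hence the shifts
  by -m-1 and -m. The top degree controls subobjects of D(H)[n] because the differential into it is
  the identity up to sign. Since A^1 = 0, d vanishes on A^0, so that d : A^{-1} -> A^0 is
  A^0-bilinear; this is what makes the action on D(M) associative.\<close>

locale concrete_abelian =
  fixes C :: "('o, 'f) category"
    and carr :: "'o \<Rightarrow> 'i \<Rightarrow> 'm set"
    and nil :: "'o \<Rightarrow> 'i \<Rightarrow> 'm"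
    and app :: "'f \<Rightarrow> 'i \<Rightarrow> 'm \<Rightarrow> 'm"
  assumes nil_carr: "X \<in> Obj C \<Longrightarrow> nil X i \<in> carr X i"
    and app_carr:
      "\<lbrakk>X \<in> Obj C; Y \<in> Obj C; f \<in> Hom C X Y; x \<in> carr X i\<rbrakk> \<Longrightarrow> app f i x \<in> carr Y i"
    and app_nil: "\<lbrakk>X \<in> Obj C; Y \<in> Obj C; f \<in> Hom C X Y\<rbrakk> \<Longrightarrow> app f i (nil X i) = nil Y i"
    and trivial_kernel_inj:
      "\<lbrakk>X \<in> Obj C; Y \<in> Obj C; f \<in> Hom C X Y;
        \<And>x. \<lbrakk>x \<in> carr X i; app f i x = nil Y i\<rbrakk> \<Longrightarrow> x = nil X i\<rbrakk>
       \<Longrightarrow> inj_on (app f i) (carr X i)"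
    and arrow_ext:
      "\<lbrakk>X \<in> Obj C; Y \<in> Obj C; f \<in> Hom C X Y; g \<in> Hom C X Y;
        \<And>i x. x \<in> carr X i \<Longrightarrow> app f i x = app g i x\<rbrakk> \<Longrightarrow> f = g"
    and Comp_Hom:
      "\<lbrakk>X \<in> Obj C; Y \<in> Obj C; Z \<in> Obj C; f \<in> Hom C X Y; g \<in> Hom C Y Z\<rbrakk>
       \<Longrightarrow> Comp C X Y Z g f \<in> Hom C X Z"
    and app_Comp:
      "\<lbrakk>X \<in> Obj C; Y \<in> Obj C; Z \<in> Obj C; f \<in> Hom C X Y; g \<in> Hom C Y Z; x \<in> carr X i\<rbrakk>
       \<Longrightarrow> app (Comp C X Y Z g f) i x = app g i (app f i x)"
    and identity_exists:
      "X \<in> Obj C \<Longrightarrow> \<exists>e \<in> Hom C X X. \<forall>i. \<forall>x \<in> carr X i. app e i x = x"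
    and nil_arrow_exists:
      "\<lbrakk>X \<in> Obj C; Y \<in> Obj C\<rbrakk> \<Longrightarrow> \<exists>z \<in> Hom C X Y. \<forall>i. \<forall>x \<in> carr X i. app z i x = nil Y i"
    and kernel_exists:
      "\<lbrakk>X \<in> Obj C; Y \<in> Obj C; f \<in> Hom C X Y\<rbrakk> \<Longrightarrow>
       \<exists>K \<in> Obj C. \<exists>k \<in> Hom C K X. \<forall>i. inj_on (app k i) (carr K i) \<and>
         app k i ` carr K i = {x \<in> carr X i. app f i x = nil Y i}"
    and cokernel_exists:
      "\<lbrakk>X \<in> Obj C; Y \<in> Obj C; f \<in> Hom C X Y\<rbrakk> \<Longrightarrow>
       \<exists>Q \<in> Obj C. \<exists>q \<in> Hom C Y Q. \<forall>i. app q i ` carr Y i = carr Q i \<and>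
         {y \<in> carr Y i. app q i y = nil Q i} = app f i ` carr X i"
    and lift_exists:
      "\<lbrakk>X \<in> Obj C; Y \<in> Obj C; W \<in> Obj C; f \<in> Hom C X Y; g \<in> Hom C W Y;
        \<And>i. inj_on (app f i) (carr X i); \<And>i. app g i ` carr W i \<subseteq> app f i ` carr X i\<rbrakk> \<Longrightarrow>
       \<exists>h \<in> Hom C W X. \<forall>i. \<forall>w \<in> carr W i. app f i (app h i w) = app g i w"
    and factor_exists:
      "\<lbrakk>Y \<in> Obj C; Q \<in> Obj C; W \<in> Obj C; q \<in> Hom C Y Q; g \<in> Hom C Y W;
        \<And>i. app q i ` carr Y i = carr Q i;
        \<And>i y. \<lbrakk>y \<in> carr Y i; app q i y = nil Q i\<rbrakk> \<Longrightarrow> app g i y = nil W i\<rbrakk> \<Longrightarrow>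
       \<exists>h \<in> Hom C Q W. \<forall>i. \<forall>y \<in> carr Y i. app h i (app q i y) = app g i y"
begin

definition trivial :: "'o \<Rightarrow> bool" where
  "trivial X \<longleftrightarrow> (\<forall>i. carr X i = {nil X i})"

lemma trivialI: "\<lbrakk>X \<in> Obj C; \<And>i x. x \<in> carr X i \<Longrightarrow> x = nil X i\<rbrakk> \<Longrightarrow> trivial X"
  unfolding trivial_def using nil_carr by blast

lemma trivialD: "\<lbrakk>trivial X; x \<in> carr X i\<rbrakk> \<Longrightarrow> x = nil X i"
  unfolding trivial_def by blast

text \<open>The identity and the nil arrow are both endomorphisms of Z. Uniqueness of arrows into a
  zero object identifies them, so every element is nil.\<close>

lemma zero_object_iff: "zero_object C Z \<longleftrightarrow> Z \<in> Obj C \<and> trivial Z"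
proof
  assume Z: "zero_object C Z"
  then have O: "Z \<in> Obj C" by (simp add: zero_object_def)
  obtain e z where e: "e \<in> Hom C Z Z" "\<forall>i. \<forall>x \<in> carr Z i. app e i x = x"
    and z: "z \<in> Hom C Z Z" "\<forall>i. \<forall>x \<in> carr Z i. app z i x = nil Z i"
    using identity_exists[OF O] nil_arrow_exists[OF O O] by blast
  have "e = z" using Z O e(1) z(1) unfolding zero_object_def by blast
  then show "Z \<in> Obj C \<and> trivial Z" using O e(2) z(2) by (metis trivialI)
next
  assume a: "Z \<in> Obj C \<and> trivial Z"
  have "\<exists>!f. f \<in> Hom C X Z" "\<exists>!f. f \<in> Hom C Z X" if X: "X \<in> Obj C" for X
  proof -
    show "\<exists>!f. f \<in> Hom C X Z"
    proof (rule ex_ex1I)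
      show "\<exists>f. f \<in> Hom C X Z" using nil_arrow_exists X a by blast
      show "f = g" if "f \<in> Hom C X Z" "g \<in> Hom C X Z" for f g
        using arrow_ext[of X Z f g] X a that app_carr[of X Z] trivialD[of Z] by metis
    qed
    show "\<exists>!f. f \<in> Hom C Z X"
    proof (rule ex_ex1I)
      show "\<exists>f. f \<in> Hom C Z X" using nil_arrow_exists X a by blast
      show "f = g" if "f \<in> Hom C Z X" "g \<in> Hom C Z X" for f g
        using arrow_ext[of Z X f g] X a that app_nil[of Z X] trivialD[of Z] by metis
    qed
  qed
  then show "zero_object C Z" using a by (simp add: zero_object_def)
qed

text \<open>The cokernel of an identity is trivial; some object X is required to start from, since a
  category may be empty.\<close>

lemma zero_object_exists:
  assumes "X \<in> Obj C"
  shows "\<exists>Z \<in> Obj C. trivial Z"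
proof -
  obtain e where e: "e \<in> Hom C X X" "\<forall>i. \<forall>x \<in> carr X i. app e i x = x"
    using identity_exists[OF assms] by blast
  obtain Q q where Q: "Q \<in> Obj C" "q \<in> Hom C X Q"
    "\<forall>i. app q i ` carr X i = carr Q i \<and> {y \<in> carr X i. app q i y = nil Q i} = app e i ` carr X i"
    using cokernel_exists[OF assms assms e(1)] by blast
  have "trivial Q"
  proof (rule trivialI[OF Q(1)])
    fix i x assume "x \<in> carr Q i"
    then obtain y where y: "y \<in> carr X i" "x = app q i y" using Q(3) by blast
    then have "y \<in> app e i ` carr X i" using e(2) by (metis image_eqI)
    then show "x = nil Q i" using Q(3) y by blast
  qed
  then show ?thesis using Q(1) by blast
qed

lemma zero_arrow_iff:
  assumes X: "X \<in> Obj C" and Y: "Y \<in> Obj C"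
  shows "zero_arrow C X Y f \<longleftrightarrow> f \<in> Hom C X Y \<and> (\<forall>i. \<forall>x \<in> carr X i. app f i x = nil Y i)"
proof
  assume "zero_arrow C X Y f"
  then obtain Z g h where Z: "Z \<in> Obj C" "trivial Z" "g \<in> Hom C X Z" "h \<in> Hom C Z Y"
    "f = Comp C X Z Y h g"
    unfolding zero_arrow_def zero_object_iff by blast
  have "app f i x = nil Y i" if "x \<in> carr X i" for i x
  proof -
    have "app g i x = nil Z i" using Z X that by (metis app_carr trivialD)
    then show ?thesis using Z X Y that by (simp add: app_Comp app_nil)
  qed
  then show "f \<in> Hom C X Y \<and> (\<forall>i. \<forall>x \<in> carr X i. app f i x = nil Y i)"
    using Z X Y Comp_Hom by simp
next
  assume f: "f \<in> Hom C X Y \<and> (\<forall>i. \<forall>x \<in> carr X i. app f i x = nil Y i)"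
  obtain Z where Z: "Z \<in> Obj C" "trivial Z" using zero_object_exists[OF X] by blast
  obtain g h where g: "g \<in> Hom C X Z" and h: "h \<in> Hom C Z Y"
    using nil_arrow_exists X Y Z(1) by blast
  have "f = Comp C X Z Y h g"
  proof (rule arrow_ext[OF X Y])
    show "f \<in> Hom C X Y" using f by simp
    show "Comp C X Z Y h g \<in> Hom C X Y" using Comp_Hom X Y Z g h by simp
    fix i x assume x: "x \<in> carr X i"
    have "app g i x = nil Z i" using Z X g x by (metis app_carr trivialD)
    then show "app f i x = app (Comp C X Z Y h g) i x"
      using f x X Y Z g h by (simp add: app_Comp app_nil)
  qed
  then show "zero_arrow C X Y f"
    unfolding zero_arrow_def zero_object_iff using Z g h by (intro exI[of _ Z] exI[of _ g] exI[of _ h]) simp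
qed

text \<open>A monomorphism is tested against its concrete kernel: the inclusion \<open>k\<close> and
  the nil arrow \<open>z\<close> have the same composite with \<open>f\<close>, hence coincide, so
  the kernel is trivial. \<open>trivial_kernel_inj\<close> then gives injectivity.\<close>

lemma mono_arrow_iff:
  "mono_arrow C X Y f \<longleftrightarrow>
     X \<in> Obj C \<and> Y \<in> Obj C \<and> f \<in> Hom C X Y \<and> (\<forall>i. inj_on (app f i) (carr X i))"
proof
  assume m: "mono_arrow C X Y f"
  then have o: "X \<in> Obj C" "Y \<in> Obj C" "f \<in> Hom C X Y" by (auto simp: mono_arrow_def)
  obtain K k where K: "K \<in> Obj C" "k \<in> Hom C K X"
    "\<forall>i. inj_on (app k i) (carr K i) \<and> app k i ` carr K i = {x \<in> carr X i. app f i x = nil Y i}"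
    using kernel_exists[OF o] by blast
  obtain z where z: "z \<in> Hom C K X" "\<forall>i. \<forall>x \<in> carr K i. app z i x = nil X i"
    using nil_arrow_exists K o by blast
  have "Comp C K X Y f k = Comp C K X Y f z"
  proof (rule arrow_ext[OF K(1) o(2)])
    fix i x assume x: "x \<in> carr K i"
    then have "app f i (app k i x) = nil Y i" using K(3) by blast
    then show "app (Comp C K X Y f k) i x = app (Comp C K X Y f z) i x"
      using x K(1,2) o z by (simp add: app_Comp app_nil)
  qed (use Comp_Hom K o z in auto)
  then have kz: "k = z" using m K(1,2) z(1) unfolding mono_arrow_def by blast
  have "inj_on (app f i) (carr X i)" for i
  proof (rule trivial_kernel_inj[OF o])
    fix x assume "x \<in> carr X i" "app f i x = nil Y i"
    then have "x \<in> app k i ` carr K i" using K(3) by blast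
    then show "x = nil X i" using z(2) kz by auto
  qed
  then show "X \<in> Obj C \<and> Y \<in> Obj C \<and> f \<in> Hom C X Y \<and> (\<forall>i. inj_on (app f i) (carr X i))"
    using o by blast
next
  assume f: "X \<in> Obj C \<and> Y \<in> Obj C \<and> f \<in> Hom C X Y \<and> (\<forall>i. inj_on (app f i) (carr X i))"
  have "g = h" if W: "W \<in> Obj C" "g \<in> Hom C W X" "h \<in> Hom C W X"
    and eq: "Comp C W X Y f g = Comp C W X Y f h" for W g h
  proof (rule arrow_ext[of W X])
    fix i x assume x: "x \<in> carr W i"
    have "app f i (app g i x) = app f i (app h i x)"
      using app_Comp[of W X Y _ f x i] W f x eq by metis
    then show "app g i x = app h i x"
      using f W x app_carr by (metis inj_on_contraD)
  qed (use W f in auto)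
  then show "mono_arrow C X Y f" using f by (auto simp: mono_arrow_def)
qed

text \<open>The elementwise form of exactness of X -> Y -> Q -> 0. It can be checked degree by
  degree, which the universal property of a cokernel cannot.\<close>

definition exact_at :: "'o \<Rightarrow> 'o \<Rightarrow> 'f \<Rightarrow> 'o \<Rightarrow> 'f \<Rightarrow> bool" where
  "exact_at X Y f Q q \<longleftrightarrow> Q \<in> Obj C \<and> q \<in> Hom C Y Q \<and>
     (\<forall>i. app q i ` carr Y i = carr Q i \<and> {y \<in> carr Y i. app q i y = nil Q i} = app f i ` carr X i)"

lemma exact_at_nil:
  "\<lbrakk>exact_at X Y f Q q; y \<in> carr Y i\<rbrakk> \<Longrightarrow> app q i y = nil Q i \<longleftrightarrow> y \<in> app f i ` carr X i"
  unfolding exact_at_def by blast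

text \<open>From the universal property to elements, two test objects suffice: the concrete cokernel
  \<open>q0\<close> of \<open>f\<close>, which factors through \<open>q\<close> and so bounds the
  kernel of \<open>q\<close>, and the concrete cokernel \<open>p\<close> of \<open>q\<close>, which
  detects surjectivity.\<close>

lemma is_cokernel_iff:
  assumes X: "X \<in> Obj C" and Y: "Y \<in> Obj C" and f: "f \<in> Hom C X Y"
  shows "is_cokernel C X Y f Q q \<longleftrightarrow> exact_at X Y f Q q"
proof
  assume c: "is_cokernel C X Y f Q q"
  then have Q: "Q \<in> Obj C" "q \<in> Hom C Y Q" by (auto simp: is_cokernel_def)
  have qf: "app q i (app f i x) = nil Q i" if "x \<in> carr X i" for i x
    using c Q X Y f that unfolding is_cokernel_def zero_arrow_iff[OF X Q(1)]
    by (metis app_Comp)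
  have univ: "\<exists>!h. h \<in> Hom C Q W \<and> g = Comp C Y Q W h q"
    if "W \<in> Obj C" "g \<in> Hom C Y W" "\<And>i x. x \<in> carr X i \<Longrightarrow> app g i (app f i x) = nil W i" for W g
  proof -
    have "zero_arrow C X W (Comp C X Y W g f)"
      using zero_arrow_iff[OF X that(1)] Comp_Hom[OF X Y that(1) f that(2)]
        app_Comp[OF X Y that(1) f that(2)] that(3) by simp
    then show ?thesis using c that(1,2) unfolding is_cokernel_def by blast
  qed
  obtain Q0 q0 where Q0: "Q0 \<in> Obj C" "q0 \<in> Hom C Y Q0"
    "\<forall>i. app q0 i ` carr Y i = carr Q0 i \<and> {y \<in> carr Y i. app q0 i y = nil Q0 i} = app f i ` carr X i"
    using cokernel_exists[OF X Y f] by blast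
  have "\<exists>!h. h \<in> Hom C Q Q0 \<and> q0 = Comp C Y Q Q0 h q"
    by (rule univ[OF Q0(1,2)]) (use Q0(3) in blast)
  then obtain h where h: "h \<in> Hom C Q Q0" "q0 = Comp C Y Q Q0 h q" by blast
  have ker: "{y \<in> carr Y i. app q i y = nil Q i} = app f i ` carr X i" for i
  proof (intro equalityI subsetI)
    fix y assume "y \<in> {y \<in> carr Y i. app q i y = nil Q i}"
    then have y: "y \<in> carr Y i" "app q i y = nil Q i" by auto
    then have "app q0 i y = nil Q0 i"
      using h Q Q0(1) Y by (simp add: app_Comp app_nil)
    then show "y \<in> app f i ` carr X i" using Q0(3) y by blast
  next
    fix y assume "y \<in> app f i ` carr X i"
    then show "y \<in> {y \<in> carr Y i. app q i y = nil Q i}"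
      using qf app_carr[OF X Y f] by auto
  qed
  \<comment> \<open>Both \<open>p\<close> and the nil arrow \<open>z\<close> factor the nil arrow
    \<open>z'\<close> through \<open>q\<close>. Uniqueness of the factorization makes
    \<open>p\<close> nil, so its kernel, the image of \<open>q\<close>, is all of Q.\<close>
  obtain P p where P: "P \<in> Obj C" "p \<in> Hom C Q P"
    "\<forall>i. app p i ` carr Q i = carr P i \<and> {y \<in> carr Q i. app p i y = nil P i} = app q i ` carr Y i"
    using cokernel_exists[OF Y Q] by blast
  obtain z where z: "z \<in> Hom C Q P" "\<forall>i. \<forall>x \<in> carr Q i. app z i x = nil P i"
    using nil_arrow_exists[OF Q(1) P(1)] by blast
  obtain z' where z': "z' \<in> Hom C Y P" "\<forall>i. \<forall>x \<in> carr Y i. app z' i x = nil P i"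
    using nil_arrow_exists[OF Y P(1)] by blast
  have "\<exists>!h. h \<in> Hom C Q P \<and> z' = Comp C Y Q P h q"
    by (rule univ[OF P(1) z'(1)]) (use z'(2) app_carr[OF X Y f] in blast)
  moreover have "z' = Comp C Y Q P p q"
  proof (rule arrow_ext[OF Y P(1) z'(1) Comp_Hom[OF Y Q(1) P(1) Q(2) P(2)]])
    fix i x assume x: "x \<in> carr Y i"
    have "app p i (app q i x) = nil P i" using P(3) x by blast
    then show "app z' i x = app (Comp C Y Q P p q) i x"
      using app_Comp[OF Y Q(1) P(1) Q(2) P(2) x] z'(2) x by simp
  qed
  moreover have "z' = Comp C Y Q P z q"
  proof (rule arrow_ext[OF Y P(1) z'(1) Comp_Hom[OF Y Q(1) P(1) Q(2) z(1)]])
    fix i x assume x: "x \<in> carr Y i"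
    show "app z' i x = app (Comp C Y Q P z q) i x"
      using app_Comp[OF Y Q(1) P(1) Q(2) z(1) x] z'(2) z(2) x app_carr[OF Y Q x] by simp
  qed
  ultimately have "p = z" using P(2) z(1) by blast
  then have "app q i ` carr Y i = carr Q i" for i using P(3) z(2) by blast
  then show "exact_at X Y f Q q" using Q ker by (simp add: exact_at_def)
next
  assume e: "exact_at X Y f Q q"
  then have Q: "Q \<in> Obj C" "q \<in> Hom C Y Q" and sur: "\<And>i. app q i ` carr Y i = carr Q i"
    by (auto simp: exact_at_def)
  have "zero_arrow C X Q (Comp C X Y Q q f)"
    unfolding zero_arrow_iff[OF X Q(1)]
    using Comp_Hom[OF X Y Q(1) f Q(2)] app_Comp[OF X Y Q(1) f Q(2)] exact_at_nil[OF e]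
      app_carr[OF X Y f] by simp
  moreover have "\<exists>!h. h \<in> Hom C Q W \<and> g = Comp C Y Q W h q"
    if W: "W \<in> Obj C" and g: "g \<in> Hom C Y W" and za: "zero_arrow C X W (Comp C X Y W g f)" for W g
  proof (rule ex_ex1I)
    have gf: "app g i (app f i x) = nil W i" if "x \<in> carr X i" for i x
      using za that app_Comp[OF X Y W f g that] unfolding zero_arrow_iff[OF X W] by simp
    have "\<exists>h \<in> Hom C Q W. \<forall>i. \<forall>y \<in> carr Y i. app h i (app q i y) = app g i y"
      by (rule factor_exists[OF Y Q(1) W Q(2) g sur]) (use exact_at_nil[OF e] gf in blast)
    then obtain h where h: "h \<in> Hom C Q W" "\<forall>i. \<forall>y \<in> carr Y i. app h i (app q i y) = app g i y"
      by blast
    have "g = Comp C Y Q W h q"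
      by (rule arrow_ext[OF Y W g Comp_Hom[OF Y Q(1) W Q(2) h(1)]])
        (simp add: h(2) app_Comp[OF Y Q(1) W Q(2) h(1)])
    then show "\<exists>h. h \<in> Hom C Q W \<and> g = Comp C Y Q W h q" using h by blast
    show "h = h'" if "h \<in> Hom C Q W \<and> g = Comp C Y Q W h q" "h' \<in> Hom C Q W \<and> g = Comp C Y Q W h' q"
      for h h'
    proof (rule arrow_ext[OF Q(1) W])
      fix i x assume "x \<in> carr Q i"
      then obtain y where "y \<in> carr Y i" "x = app q i y" using sur by blast
      then show "app h i x = app h' i x" using that app_Comp[OF Y Q(1) W Q(2)] by metis
    qed (use that in auto)
  qed
  ultimately show "is_cokernel C X Y f Q q" using Q unfolding is_cokernel_def by blast
qed

section \<open>Subobjects, monoform objects and atoms in elementwise form\<close>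

definition embeds :: "'o \<Rightarrow> 'o \<Rightarrow> bool" where
  "embeds X Y \<longleftrightarrow> X \<in> Obj C \<and> Y \<in> Obj C \<and> (\<exists>f. f \<in> Hom C X Y \<and> (\<forall>i. inj_on (app f i) (carr X i)))"

lemma embedsI:
  "\<lbrakk>X \<in> Obj C; Y \<in> Obj C; f \<in> Hom C X Y; \<And>i. inj_on (app f i) (carr X i)\<rbrakk> \<Longrightarrow> embeds X Y"
  unfolding embeds_def by blast

lemma embeds_refl: "X \<in> Obj C \<Longrightarrow> embeds X X"
  using identity_exists[of X] unfolding embeds_def inj_on_def by metis

lemma embeds_trans:
  assumes "embeds X Y" "embeds Y Z"
  shows "embeds X Z"
proof -
  obtain f g where f: "X \<in> Obj C" "Y \<in> Obj C" "f \<in> Hom C X Y" "\<And>i. inj_on (app f i) (carr X i)"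
    and g: "Z \<in> Obj C" "g \<in> Hom C Y Z" "\<And>i. inj_on (app g i) (carr Y i)"
    using assms unfolding embeds_def by blast
  show ?thesis
  proof (rule embedsI[OF f(1) g(1) Comp_Hom[OF f(1,2) g(1) f(3) g(2)]])
    fix i
    show "inj_on (app (Comp C X Y Z g f) i) (carr X i)"
      using app_Comp[OF f(1,2) g(1) f(3) g(2)] f(4) g(3) app_carr[OF f(1-3)]
      unfolding inj_on_def by metis
  qed
qed

lemma embeds_trivial:
  assumes "embeds X Y" "trivial Y"
  shows "trivial X"
proof -
  obtain f where f: "X \<in> Obj C" "Y \<in> Obj C" "f \<in> Hom C X Y" "\<And>i. inj_on (app f i) (carr X i)"
    using assms unfolding embeds_def by blast
  show ?thesis
  proof (rule trivialI[OF f(1)])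
    fix i x assume "x \<in> carr X i"
    then show "x = nil X i"
      using f assms(2) app_carr[OF f(1-3)] nil_carr[OF f(1)] by (metis inj_onD trivialD)
  qed
qed

lemma common_nonzero_subobject_iff:
  "common_nonzero_subobject C X Y \<longleftrightarrow> (\<exists>N. \<not> trivial N \<and> embeds N X \<and> embeds N Y)"
  unfolding common_nonzero_subobject_def embeds_def zero_object_iff mono_arrow_iff by blast

lemma monoform_iff:
  "monoform C H \<longleftrightarrow> H \<in> Obj C \<and> \<not> trivial H \<and>
     (\<forall>L l Q q N. L \<in> Obj C \<and> l \<in> Hom C L H \<and> (\<forall>i. inj_on (app l i) (carr L i)) \<and> \<not> trivial L \<and>
        exact_at L H l Q q \<and> embeds N H \<and> embeds N Q \<longrightarrow> trivial N)"
  unfolding monoform_def common_nonzero_subobject_iff mono_arrow_iff zero_object_iff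
  using is_cokernel_iff by blast

lemma monoform_Obj: "monoform C H \<Longrightarrow> H \<in> Obj C"
  and monoform_nontrivial: "monoform C H \<Longrightarrow> \<not> trivial H"
  unfolding monoform_iff by auto

text \<open>Monoform objects are uniform. If N and N' met trivially in H, then N' would embed into
  H/N as well as into H, against the definition of monoform.\<close>

lemma monoform_meet:
  assumes H: "monoform C H" and N: "embeds N H" "\<not> trivial N" and N': "embeds N' H" "\<not> trivial N'"
  shows "common_nonzero_subobject C N N'"
proof -
  obtain g where g: "N \<in> Obj C" "H \<in> Obj C" "g \<in> Hom C N H" "\<And>i. inj_on (app g i) (carr N i)"
    using N(1) unfolding embeds_def by blast
  obtain g' where g': "N' \<in> Obj C" "g' \<in> Hom C N' H" "\<And>i. inj_on (app g' i) (carr N' i)"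
    using N'(1) unfolding embeds_def by blast
  obtain Q q where Q: "exact_at N H g Q q"
    using cokernel_exists[OF g(1-3)] unfolding exact_at_def by blast
  then have Q1: "Q \<in> Obj C" "q \<in> Hom C H Q" by (auto simp: exact_at_def)
  let ?p = "Comp C N' H Q q g'"
  have p: "?p \<in> Hom C N' Q" "\<And>i x. x \<in> carr N' i \<Longrightarrow> app ?p i x = app q i (app g' i x)"
    using Comp_Hom[OF g'(1) g(2) Q1(1) g'(2) Q1(2)] app_Comp[OF g'(1) g(2) Q1(1) g'(2) Q1(2)] by auto
  \<comment> \<open>K, the kernel of N' -> H -> H/N, plays the role of the intersection of N and N'.
    Its map to H lands in the image of N and therefore lifts to an embedding K -> N.\<close>
  obtain K k where K: "K \<in> Obj C" "k \<in> Hom C K N'"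
    "\<forall>i. inj_on (app k i) (carr K i) \<and> app k i ` carr K i = {x \<in> carr N' i. app ?p i x = nil Q i}"
    using kernel_exists[OF g'(1) Q1(1) p(1)] by blast
  have KN': "embeds K N'" using embedsI K g' by blast
  let ?c = "Comp C K N' H g' k"
  have c: "?c \<in> Hom C K H" "\<And>i x. x \<in> carr K i \<Longrightarrow> app ?c i x = app g' i (app k i x)"
    using Comp_Hom[OF K(1) g'(1) g(2) K(2) g'(2)] app_Comp[OF K(1) g'(1) g(2) K(2) g'(2)] by auto
  have "\<exists>h \<in> Hom C K N. \<forall>i. \<forall>w \<in> carr K i. app g i (app h i w) = app ?c i w"
  proof (rule lift_exists[OF g(1,2) K(1) g(3) c(1) g(4)])
    fix i show "app ?c i ` carr K i \<subseteq> app g i ` carr N i"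
    proof
      fix y assume "y \<in> app ?c i ` carr K i"
      then obtain x where x: "x \<in> carr K i" "y = app g' i (app k i x)" using c(2) by auto
      then have "app k i x \<in> {x \<in> carr N' i. app ?p i x = nil Q i}" using K(3) by blast
      then have "app k i x \<in> carr N' i" "app q i y = nil Q i" using p(2) x(2) by auto
      then show "y \<in> app g i ` carr N i"
        using exact_at_nil[OF Q] app_carr[OF g'(1) g(2) g'(2)] x by blast
    qed
  qed
  then obtain h where h: "h \<in> Hom C K N" "\<forall>i. \<forall>w \<in> carr K i. app g i (app h i w) = app ?c i w" by blast
  have "inj_on (app h i) (carr K i)" for i
  proof (rule inj_onI)
    fix x y assume xy: "x \<in> carr K i" "y \<in> carr K i" "app h i x = app h i y"
    then have "app g' i (app k i x) = app g' i (app k i y)" using h(2) c(2) by metis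
    then have "app k i x = app k i y"
      using g'(3) app_carr[OF K(1) g'(1) K(2)] xy by (meson inj_onD)
    then show "x = y" using K(3) xy by (meson inj_onD)
  qed
  then have KN: "embeds K N" using embedsI K g h by blast
  have "\<not> trivial K"
  proof
    assume t: "trivial K"
    have "inj_on (app ?p i) (carr N' i)" for i
    proof (rule trivial_kernel_inj[OF g'(1) Q1(1) p(1)])
      fix x assume "x \<in> carr N' i" "app ?p i x = nil Q i"
      then obtain y where y: "y \<in> carr K i" "x = app k i y" using K(3) by blast
      then have "y = nil K i" using t trivialD by blast
      then show "x = nil N' i" using y app_nil[OF K(1) g'(1) K(2)] by simp
    qed
    then have "embeds N' Q" using embedsI g' Q1 p by blast
    then show False using H N'(1,2) N(2) g Q unfolding monoform_iff by blast
  qed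
  then show ?thesis using KN KN' common_nonzero_subobject_iff by blast
qed

text \<open>Y/L embeds into X/L, so a common subobject of Y and Y/L is also one of X and X/L, where
  L is still nonzero.\<close>

lemma monoform_embeds:
  assumes X: "monoform C X" and Y: "embeds Y X" "\<not> trivial Y"
  shows "monoform C Y"
  unfolding monoform_iff
proof (intro conjI allI impI)
  obtain f where f: "Y \<in> Obj C" "X \<in> Obj C" "f \<in> Hom C Y X" "\<And>i. inj_on (app f i) (carr Y i)"
    using Y(1) unfolding embeds_def by blast
  show "Y \<in> Obj C" "\<not> trivial Y" using f(1) Y(2) .
  fix L l Q q N
  assume a: "L \<in> Obj C \<and> l \<in> Hom C L Y \<and> (\<forall>i. inj_on (app l i) (carr L i)) \<and> \<not> trivial L \<and>
    exact_at L Y l Q q \<and> embeds N Y \<and> embeds N Q"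
  then have L: "L \<in> Obj C" "l \<in> Hom C L Y" and ex: "exact_at L Y l Q q"
    and Q: "Q \<in> Obj C" "q \<in> Hom C Y Q" "\<And>i. app q i ` carr Y i = carr Q i"
    by (auto simp: exact_at_def)
  let ?m = "Comp C L Y X f l"
  have m: "?m \<in> Hom C L X" "\<And>i x. x \<in> carr L i \<Longrightarrow> app ?m i x = app f i (app l i x)"
    using Comp_Hom[OF L(1) f(1,2) L(2) f(3)] app_Comp[OF L(1) f(1,2) L(2) f(3)] by auto
  have mi: "inj_on (app ?m i) (carr L i)" for i
    using a f(4) m(2) app_carr[OF L(1) f(1) L(2)] unfolding inj_on_def by metis
  obtain P p where P: "exact_at L X ?m P p"
    using cokernel_exists[OF L(1) f(2) m(1)] unfolding exact_at_def by blast
  then have P1: "P \<in> Obj C" "p \<in> Hom C X P" by (auto simp: exact_at_def)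
  let ?g = "Comp C Y X P p f"
  have g: "?g \<in> Hom C Y P" "\<And>i x. x \<in> carr Y i \<Longrightarrow> app ?g i x = app p i (app f i x)"
    using Comp_Hom[OF f(1,2) P1(1) f(3) P1(2)] app_Comp[OF f(1,2) P1(1) f(3) P1(2)] by auto
  \<comment> \<open>One direction of this equivalence makes the induced arrow Y/L -> X/L well
    defined, the other makes it injective.\<close>
  have ker: "app ?g i y = nil P i \<longleftrightarrow> app q i y = nil Q i" if y: "y \<in> carr Y i" for i y
  proof -
    have "app ?g i y = nil P i \<longleftrightarrow> app f i y \<in> app ?m i ` carr L i"
      using exact_at_nil[OF P] g(2)[OF y] app_carr[OF f(1-3) y] by metis
    also have "\<dots> \<longleftrightarrow> y \<in> app l i ` carr L i"
    proof
      assume "app f i y \<in> app ?m i ` carr L i"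
      then obtain x where "x \<in> carr L i" "app f i y = app f i (app l i x)" using m(2) by auto
      then show "y \<in> app l i ` carr L i"
        using f(4) y app_carr[OF L(1) f(1) L(2)] by (metis image_eqI inj_onD)
    next
      assume "y \<in> app l i ` carr L i"
      then show "app f i y \<in> app ?m i ` carr L i" using m(2) by force
    qed
    finally show ?thesis using exact_at_nil[OF ex y] by simp
  qed
  have "\<exists>h \<in> Hom C Q P. \<forall>i. \<forall>y \<in> carr Y i. app h i (app q i y) = app ?g i y"
    by (rule factor_exists[OF f(1) Q(1) P1(1) Q(2) g(1) Q(3)]) (use ker in blast)
  then obtain h where h: "h \<in> Hom C Q P" "\<forall>i. \<forall>y \<in> carr Y i. app h i (app q i y) = app ?g i y" by blast
  have "inj_on (app h i) (carr Q i)" for i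
  proof (rule trivial_kernel_inj[OF Q(1) P1(1) h(1)])
    fix x assume x: "x \<in> carr Q i" "app h i x = nil P i"
    then obtain y where "y \<in> carr Y i" "x = app q i y" using Q(3) by blast
    then show "x = nil Q i" using x h(2) ker by metis
  qed
  then have "embeds Q P" using embedsI Q P1 h by blast
  then have "embeds N P" "embeds N X" using a embeds_trans[OF _ Y(1)] embeds_trans by blast+
  then show "trivial N" using X a L m(1) mi P unfolding monoform_iff by blast
qed

text \<open>Transitivity is the point: the common subobjects of X, Y and of Y, Z both sit in the
  monoform object Y and meet there by \<open>monoform_meet\<close>.\<close>

lemma equiv_atom_rel: "equiv {H. monoform C H} (atom_rel C)"
proof (rule equivI)
  show "atom_rel C \<subseteq> {H. monoform C H} \<times> {H. monoform C H}" by (auto simp: atom_rel_def)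
  show "refl_on {H. monoform C H} (atom_rel C)"
  proof (rule refl_onI)
    fix H assume "H \<in> {H. monoform C H}"
    then show "(H, H) \<in> atom_rel C"
      using embeds_refl[of H] monoform_Obj[of H] monoform_nontrivial[of H]
      by (auto simp: atom_rel_def common_nonzero_subobject_iff)
  qed
  show "sym (atom_rel C)"
    unfolding sym_def atom_rel_def common_nonzero_subobject_iff by blast
  show "trans (atom_rel C)"
  proof (rule transI)
    fix X Y Z assume "(X, Y) \<in> atom_rel C" "(Y, Z) \<in> atom_rel C"
    then obtain N N' where m: "monoform C X" "monoform C Y" "monoform C Z"
      and N: "\<not> trivial N" "embeds N X" "embeds N Y" and N': "\<not> trivial N'" "embeds N' Y" "embeds N' Z"
      unfolding atom_rel_def common_nonzero_subobject_iff by auto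
    obtain K where "\<not> trivial K" "embeds K N" "embeds K N'"
      using monoform_meet[OF m(2) N(3,1) N'(2,1)] common_nonzero_subobject_iff by blast
    moreover from this have "embeds K X" "embeds K Z"
      using embeds_trans[OF _ N(2)] embeds_trans[OF _ N'(3)] by simp_all
    ultimately show "(X, Z) \<in> atom_rel C"
      using m by (auto simp: atom_rel_def common_nonzero_subobject_iff)
  qed
qed

lemma atom_eq_iff:
  "\<lbrakk>monoform C X; monoform C Y\<rbrakk> \<Longrightarrow> atom C X = atom C Y \<longleftrightarrow> common_nonzero_subobject C X Y"
  unfolding atom_def using equiv_class_eq_iff[OF equiv_atom_rel, of X Y]
  by (auto simp: atom_rel_def)

lemma atom_eqI:
  assumes "monoform C X" "monoform C Y" "\<not> trivial N" "embeds N X" "embeds N Y"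
  shows "atom C X = atom C Y"
  using assms atom_eq_iff common_nonzero_subobject_iff by blast

lemma mem_atom_iff: "Y \<in> atom C X \<longleftrightarrow> monoform C X \<and> monoform C Y \<and> common_nonzero_subobject C X Y"
  by (auto simp: atom_def atom_rel_def)

lemma self_mem_atom: "monoform C X \<Longrightarrow> X \<in> atom C X"
  using equiv_class_self[OF equiv_atom_rel] by (simp add: atom_def)

lemma Spec_eq: "Spec C = atom C ` {H. monoform C H}"
  by (auto simp: Spec_def atom_def quotient_def)

end


section \<open>Quotients of commutative groups on coset representatives\<close>

text \<open>For a subgroup P of a commutative group, the condition under \<open>SOME\<close> depends
  only on the coset of x. Elements of one coset therefore get literally the same representative, and
  equality of representatives becomes membership of the difference in P.\<close>

definition coset_rep :: "('m, 'z) monoid_scheme \<Rightarrow> 'm set \<Rightarrow> 'm \<Rightarrow> 'm" where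
  "coset_rep G P x = (SOME y. y \<in> carrier G \<and> y \<otimes>\<^bsub>G\<^esub> inv\<^bsub>G\<^esub> x \<in> P)"

text \<open>The library quotient \<^const>\<open>FactGroup\<close> lives on the type of cosets; a quotient object
  of the same category has to live on the original type.\<close>

definition rep_quotient :: "('m, 'z) monoid_scheme \<Rightarrow> 'm set \<Rightarrow> 'm monoid" where
  "rep_quotient G P = \<lparr>carrier = coset_rep G P ` carrier G,
     mult = (\<lambda>x y. coset_rep G P (x \<otimes>\<^bsub>G\<^esub> y)), one = coset_rep G P \<one>\<^bsub>G\<^esub>\<rparr>"

lemma (in comm_group)
  assumes P: "subgroup P G" and x: "x \<in> carrier G"
  shows coset_rep_closed: "coset_rep G P x \<in> carrier G"
    and coset_rep_rel: "coset_rep G P x \<otimes> inv x \<in> P"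
proof -
  have "x \<in> carrier G \<and> x \<otimes> inv x \<in> P" using P x by (simp add: subgroup.one_closed)
  then have "coset_rep G P x \<in> carrier G \<and> coset_rep G P x \<otimes> inv x \<in> P"
    unfolding coset_rep_def by (rule someI)
  then show "coset_rep G P x \<in> carrier G" "coset_rep G P x \<otimes> inv x \<in> P" by auto
qed

lemma (in comm_group) diff_mem_trans:
  assumes P: "subgroup P G" and c: "x \<in> carrier G" "y \<in> carrier G" "z \<in> carrier G"
    and "x \<otimes> inv y \<in> P" "y \<otimes> inv z \<in> P"
  shows "x \<otimes> inv z \<in> P"
proof -
  have "(x \<otimes> inv y) \<otimes> (y \<otimes> inv z) \<in> P" using assms by (simp add: subgroup.m_closed)
  moreover have "(x \<otimes> inv y) \<otimes> (y \<otimes> inv z) = x \<otimes> inv z"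
    using c by (simp add: m_assoc flip: m_assoc[of "inv y"])
  ultimately show ?thesis by simp
qed

lemma (in comm_group) diff_mem_sym:
  assumes P: "subgroup P G" and c: "x \<in> carrier G" "y \<in> carrier G" and "x \<otimes> inv y \<in> P"
  shows "y \<otimes> inv x \<in> P"
proof -
  have "inv (x \<otimes> inv y) \<in> P" using assms by (simp add: subgroup.m_inv_closed)
  then show ?thesis using c by (simp add: inv_mult m_comm)
qed

lemma (in comm_group) coset_rep_eq_iff:
  assumes P: "subgroup P G" and x: "x \<in> carrier G" and y: "y \<in> carrier G"
  shows "coset_rep G P x = coset_rep G P y \<longleftrightarrow> x \<otimes> inv y \<in> P"
proof
  assume "coset_rep G P x = coset_rep G P y"
  then show "x \<otimes> inv y \<in> P"
    using coset_rep_rel[OF P x] coset_rep_rel[OF P y] coset_rep_closed[OF P y]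
      diff_mem_trans[OF P] diff_mem_sym[OF P] x y by metis
next
  assume "x \<otimes> inv y \<in> P"
  then have "z \<in> carrier G \<and> z \<otimes> inv x \<in> P \<longleftrightarrow> z \<in> carrier G \<and> z \<otimes> inv y \<in> P" for z
    using diff_mem_trans[OF P] diff_mem_sym[OF P] x y by metis
  then show "coset_rep G P x = coset_rep G P y" by (simp add: coset_rep_def)
qed

lemma (in comm_group) coset_rep_mult:
  assumes P: "subgroup P G" and x: "x \<in> carrier G" and y: "y \<in> carrier G"
  shows "coset_rep G P (coset_rep G P x \<otimes> coset_rep G P y) = coset_rep G P (x \<otimes> y)"
proof -
  let ?r = "coset_rep G P"
  have c: "?r x \<in> carrier G" "?r y \<in> carrier G" using coset_rep_closed P x y by auto
  have "(?r x \<otimes> inv x) \<otimes> (?r y \<otimes> inv y) \<in> P"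
    using coset_rep_rel[OF P] x y P by (simp add: subgroup.m_closed)
  moreover have "(?r x \<otimes> inv x) \<otimes> (?r y \<otimes> inv y) = (?r x \<otimes> ?r y) \<otimes> inv (x \<otimes> y)"
    using c x y by (simp add: inv_mult m_ac)
  ultimately show ?thesis using coset_rep_eq_iff[OF P] c x y by simp
qed

lemma (in comm_group) coset_rep_one_iff:
  assumes P: "subgroup P G" and x: "x \<in> carrier G"
  shows "coset_rep G P x = coset_rep G P \<one> \<longleftrightarrow> x \<in> P"
  using coset_rep_eq_iff[OF P x one_closed] x by simp

text \<open>The induced map on quotients is well defined: \<open>h\<close> sends the difference
  between x and its representative into Q. It is applied to differentials and to the action of a
  fixed ring element.\<close>

lemma coset_rep_hom:
  assumes G: "comm_group G" and H: "comm_group H" and P: "subgroup P G" and Q: "subgroup Q H"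
    and h: "h \<in> hom G H" "h ` P \<subseteq> Q" and x: "x \<in> carrier G"
  shows "coset_rep H Q (h (coset_rep G P x)) = coset_rep H Q (h x)"
proof -
  interpret G: comm_group G by fact
  interpret H: comm_group H by fact
  interpret h: group_hom G H h
    using h(1) by (simp add: group_hom_def group_hom_axioms_def G.group_axioms H.group_axioms)
  have c: "coset_rep G P x \<in> carrier G" using G.coset_rep_closed[OF P x] .
  have "h (coset_rep G P x \<otimes>\<^bsub>G\<^esub> inv\<^bsub>G\<^esub> x) \<in> Q" using G.coset_rep_rel[OF P x] h(2) by blast
  then show ?thesis using H.coset_rep_eq_iff[OF Q] c x by simp
qed

text \<open>Used for quotients, with \<open>p\<close> the choice of representatives, and with
  \<open>p\<close> the identity to move the group structure to a record of another type.\<close>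

lemma comm_group_surj_image:
  assumes G: "comm_group G" and c: "carrier H = p ` carrier G"
    and m: "\<And>x y. \<lbrakk>x \<in> carrier G; y \<in> carrier G\<rbrakk> \<Longrightarrow> p x \<otimes>\<^bsub>H\<^esub> p y = p (x \<otimes>\<^bsub>G\<^esub> y)"
    and o: "\<one>\<^bsub>H\<^esub> = p \<one>\<^bsub>G\<^esub>"
  shows "comm_group H"
proof -
  interpret G: comm_group G by fact
  show ?thesis
  proof (rule comm_groupI)
    fix x assume "x \<in> carrier H"
    then obtain g where g: "g \<in> carrier G" "x = p g" using c by auto
    have "p (inv\<^bsub>G\<^esub> g) \<otimes>\<^bsub>H\<^esub> x = \<one>\<^bsub>H\<^esub>" using g m o by simp
    then show "\<exists>y\<in>carrier H. y \<otimes>\<^bsub>H\<^esub> x = \<one>\<^bsub>H\<^esub>" using c g by blast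
  qed (use c m o in \<open>auto simp: G.m_ac\<close>)
qed

lemma comm_group_homD:
  assumes "comm_group G" "comm_group H" "h \<in> hom G H"
  shows "group_hom G H h"
  using assms by (simp add: group_hom_def group_hom_axioms_def comm_group.axioms)

lemma (in comm_group) comm_group_subgroup:
  assumes P: "subgroup P G"
  shows "comm_group (G\<lparr>carrier := P\<rparr>)"
proof -
  interpret H: group "G\<lparr>carrier := P\<rparr>" using subgroup.subgroup_is_group[OF P is_group] .
  show ?thesis
    by unfold_locales (use subgroup.mem_carrier[OF P] m_comm in simp)
qed


text \<open>\<open>h\<close> evaluates \<open>g\<close> at a chosen preimage; two preimages differ
  by an element of the kernel of \<open>q\<close>. Only the function is produced here, and its
  compatibility with the operations follows in each category from the surjectivity of
  \<open>q\<close>.\<close>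

lemma group_hom_factor:
  assumes "group_hom N Q q" "group_hom N W g"
    and ker: "\<And>y. \<lbrakk>y \<in> carrier N; q y = \<one>\<^bsub>Q\<^esub>\<rbrakk> \<Longrightarrow> g y = \<one>\<^bsub>W\<^esub>"
  shows "\<exists>h. \<forall>y \<in> carrier N. h (q y) = g y"
proof -
  interpret q: group_hom N Q q by fact
  interpret g: group_hom N W g by fact
  have "g (inv_into (carrier N) q (q y)) = g y" if y: "y \<in> carrier N" for y
  proof -
    let ?z = "inv_into (carrier N) q (q y)"
    have z: "?z \<in> carrier N" "q ?z = q y" using y by (auto intro: inv_into_into f_inv_into_f)
    then have "g (?z \<otimes>\<^bsub>N\<^esub> inv\<^bsub>N\<^esub> y) = \<one>\<^bsub>W\<^esub>" by (intro ker) (use y in auto)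
    then have "\<one>\<^bsub>W\<^esub> = g ?z \<otimes>\<^bsub>W\<^esub> inv\<^bsub>W\<^esub> g y" using z y by simp
    then show ?thesis using g.H.inv_solve_right[of "\<one>\<^bsub>W\<^esub>" "g ?z" "g y"] z y by simp
  qed
  then show ?thesis by (intro exI[of _ "\<lambda>x. g (inv_into (carrier N) q x)"]) simp
qed


section \<open>The category of right modules\<close>

lemma right_module_comm_group: "right_module R M \<Longrightarrow> comm_group M"
  by (simp add: right_module_def)

text \<open>Meant for quotients: every element of N is some \<open>p x\<close>, so each module axiom
  is the image under \<open>p\<close> of the axiom for M.\<close>

lemma right_module_surj_image:
  assumes M: "right_module R M" and c: "carrier N = p ` carrier M"
    and m: "\<And>x y. \<lbrakk>x \<in> carrier M; y \<in> carrier M\<rbrakk> \<Longrightarrow> p x \<otimes>\<^bsub>N\<^esub> p y = p (x \<otimes>\<^bsub>M\<^esub> y)"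
    and o: "\<one>\<^bsub>N\<^esub> = p \<one>\<^bsub>M\<^esub>"
    and r: "\<And>x a. \<lbrakk>x \<in> carrier M; a \<in> carrier R\<rbrakk> \<Longrightarrow> ract N (p x) a = p (ract M x a)"
  shows "right_module R N"
proof -
  interpret M: right_module R M by fact
  interpret N: comm_group N by (rule comm_group_surj_image[OF M.comm_group_axioms c m o])
  show ?thesis
    by unfold_locales
      (auto simp: c m r M.ract_closed M.ract_add_left M.ract_add_right M.ract_assoc M.ract_one)
qed

text \<open>Meant for submodules: an equation in N is checked after applying the injective map
  \<open>f\<close>. Closure under the action cannot be obtained in this way and stays a
  hypothesis.\<close>

lemma right_module_inj_preimage:
  assumes M: "right_module R M" and N: "comm_group N" and f: "f \<in> hom N M" "inj_on f (carrier N)"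
    and cl: "\<And>x a. \<lbrakk>x \<in> carrier N; a \<in> carrier R\<rbrakk> \<Longrightarrow> ract N x a \<in> carrier N"
    and r: "\<And>x a. \<lbrakk>x \<in> carrier N; a \<in> carrier R\<rbrakk> \<Longrightarrow> f (ract N x a) = ract M (f x) a"
  shows "right_module R N"
proof -
  interpret M: right_module R M by fact
  interpret N: comm_group N by fact
  have fc: "f x \<in> carrier M" if "x \<in> carrier N" for x using f(1) that by (auto simp: hom_def)
  have fm: "f (x \<otimes>\<^bsub>N\<^esub> y) = f x \<otimes>\<^bsub>M\<^esub> f y" if "x \<in> carrier N" "y \<in> carrier N" for x y
    using f(1) that by (auto simp: hom_def)
  show ?thesis
  proof unfold_locales
    fix x y a assume "x \<in> carrier N" "y \<in> carrier N" "a \<in> carrier R"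
    then show "ract N (x \<otimes>\<^bsub>N\<^esub> y) a = ract N x a \<otimes>\<^bsub>N\<^esub> ract N y a"
      by - (rule inj_onD[OF f(2)]; simp add: cl r fm fc M.ract_add_left)
  next
    fix x a b assume "x \<in> carrier N" "a \<in> carrier R" "b \<in> carrier R"
    then show "ract N x (a \<oplus>\<^bsub>R\<^esub> b) = ract N x a \<otimes>\<^bsub>N\<^esub> ract N x b"
      "ract N (ract N x a) b = ract N x (a \<otimes>\<^bsub>R\<^esub> b)"
      by - (rule inj_onD[OF f(2)]; simp add: cl r fm fc M.ract_add_right M.ract_assoc)+
  next
    fix x assume "x \<in> carrier N"
    then show "ract N x \<one>\<^bsub>R\<^esub> = x"
      by - (rule inj_onD[OF f(2)]; simp add: cl r fc M.ract_one)
  qed (use cl in auto)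
qed

lemma RMod_simps [simp]:
  "Obj (RMod R) = {M. right_module R M}"
  "Comp (RMod R) L M N g f = compose (carrier L) g f"
  by (simp_all add: RMod_def)

lemma RMod_Hom_iff:
  "f \<in> Hom (RMod R) M N \<longleftrightarrow> f \<in> extensional (carrier M) \<and> f \<in> hom M N \<and>
     (\<forall>x \<in> carrier M. \<forall>a \<in> carrier R. f (ract M x a) = ract N (f x) a)"
  by (auto simp: RMod_def)

lemma RMod_HomI:
  assumes "right_module R M"
    and "\<And>x. x \<in> carrier M \<Longrightarrow> f x \<in> carrier N"
    and "\<And>x y. \<lbrakk>x \<in> carrier M; y \<in> carrier M\<rbrakk> \<Longrightarrow> f (x \<otimes>\<^bsub>M\<^esub> y) = f x \<otimes>\<^bsub>N\<^esub> f y"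
    and "\<And>x a. \<lbrakk>x \<in> carrier M; a \<in> carrier R\<rbrakk> \<Longrightarrow> f (ract M x a) = ract N (f x) a"
  shows "restrict f (carrier M) \<in> Hom (RMod R) M N"
proof -
  interpret M: right_module R M by fact
  show ?thesis using assms(2-) by (auto simp: RMod_Hom_iff hom_def M.ract_closed)
qed

lemma RMod_HomD:
  assumes "f \<in> Hom (RMod R) M N"
  shows "x \<in> carrier M \<Longrightarrow> f x \<in> carrier N"
    and "\<lbrakk>x \<in> carrier M; y \<in> carrier M\<rbrakk> \<Longrightarrow> f (x \<otimes>\<^bsub>M\<^esub> y) = f x \<otimes>\<^bsub>N\<^esub> f y"
    and "\<lbrakk>x \<in> carrier M; a \<in> carrier R\<rbrakk> \<Longrightarrow> f (ract M x a) = ract N (f x) a"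
    and "f \<in> extensional (carrier M)" and "f \<in> hom M N"
  using assms by (auto simp: RMod_Hom_iff hom_def)

lemma RMod_kernel:
  assumes M: "right_module R M" and N: "right_module R N" and f: "f \<in> Hom (RMod R) M N"
  shows "\<exists>K. right_module R K \<and> (\<exists>k \<in> Hom (RMod R) K M. inj_on k (carrier K) \<and>
     k ` carrier K = {x \<in> carrier M. f x = \<one>\<^bsub>N\<^esub>})"
proof -
  interpret M: right_module R M by fact
  interpret N: right_module R N by fact
  interpret f: group_hom M N f
    by (rule comm_group_homD) (use M.comm_group_axioms N.comm_group_axioms RMod_HomD(5)[OF f] in auto)
  let ?P = "{x \<in> carrier M. f x = \<one>\<^bsub>N\<^esub>}"
  have P: "subgroup ?P M" using f.subgroup_kernel by (simp add: kernel_def)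
  have ract_nil: "ract N \<one>\<^bsub>N\<^esub> a = \<one>\<^bsub>N\<^esub>" if "a \<in> carrier R" for a
    using N.ract_add_left[of "\<one>\<^bsub>N\<^esub>" "\<one>\<^bsub>N\<^esub>" a] N.ract_closed[of "\<one>\<^bsub>N\<^esub>" a] that by simp
  let ?K = "M\<lparr>carrier := ?P\<rparr>"
  have K: "right_module R ?K"
    by (rule right_module_inj_preimage[OF M M.comm_group_subgroup[OF P], where f = "\<lambda>x. x"])
      (auto simp: hom_def M.ract_closed RMod_HomD(3)[OF f] ract_nil)
  have "restrict (\<lambda>x. x) (carrier ?K) \<in> Hom (RMod R) ?K M"
    by (rule RMod_HomI[OF K]) auto
  moreover have "inj_on (restrict (\<lambda>x. x) (carrier ?K)) (carrier ?K)"
    "restrict (\<lambda>x. x) (carrier ?K) ` carrier ?K = ?P"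
    by (auto simp: inj_on_def)
  ultimately show ?thesis using K by blast
qed

text \<open>The image of \<open>f\<close> is stable under the action (\<open>Pa\<close>), so the
  action descends: by \<open>r\<close> it makes no difference whether a representative is chosen
  before acting or only afterwards.\<close>

lemma RMod_cokernel:
  assumes M: "right_module R M" and N: "right_module R N" and f: "f \<in> Hom (RMod R) M N"
  shows "\<exists>Q. right_module R Q \<and> (\<exists>q \<in> Hom (RMod R) N Q. q ` carrier N = carrier Q \<and>
     {y \<in> carrier N. q y = \<one>\<^bsub>Q\<^esub>} = f ` carrier M)"
proof -
  interpret M: right_module R M by fact
  interpret N: right_module R N by fact
  interpret f: group_hom M N f
    by (rule comm_group_homD) (use M.comm_group_axioms N.comm_group_axioms RMod_HomD(5)[OF f] in auto)
  let ?P = "f ` carrier M"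
  have P: "subgroup ?P N" by (rule f.img_is_subgroup)
  let ?r = "coset_rep N ?P"
  have Pa: "(\<lambda>x. ract N x a) ` ?P \<subseteq> ?P" if a: "a \<in> carrier R" for a
  proof (rule image_subsetI)
    fix x assume "x \<in> ?P"
    then obtain y where y: "y \<in> carrier M" "x = f y" by blast
    then have "ract N x a = f (ract M y a)" using RMod_HomD(3)[OF f] a by simp
    then show "ract N x a \<in> ?P" using M.ract_closed y(1) a by simp
  qed
  have r: "?r (ract N (?r x) a) = ?r (ract N x a)" if x: "x \<in> carrier N" and a: "a \<in> carrier R" for x a
    by (rule coset_rep_hom[OF N.comm_group_axioms N.comm_group_axioms P P _ Pa[OF a] x])
      (auto simp: hom_def N.ract_closed N.ract_add_left a)
  let ?Q = "\<lparr>carrier = carrier (rep_quotient N ?P), mult = mult (rep_quotient N ?P),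
    one = one (rep_quotient N ?P), ract = (\<lambda>x a. ?r (ract N x a))\<rparr>"
  have Q: "right_module R ?Q"
    by (rule right_module_surj_image[OF N, where p = ?r])
      (simp_all add: rep_quotient_def r N.coset_rep_mult[OF P])
  have "restrict ?r (carrier N) \<in> Hom (RMod R) N ?Q"
    by (rule RMod_HomI[OF N]) (simp_all add: rep_quotient_def r N.coset_rep_mult[OF P])
  moreover have "restrict ?r (carrier N) ` carrier N = carrier ?Q"
    by (simp add: rep_quotient_def)
  moreover have "{y \<in> carrier N. restrict ?r (carrier N) y = \<one>\<^bsub>?Q\<^esub>} = ?P"
    using N.coset_rep_one_iff[OF P] P subgroup.subset by (fastforce simp: rep_quotient_def)
  ultimately show ?thesis using Q by blast
qed

text \<open>\<open>h\<close> picks preimages under \<open>f\<close>; it is a homomorphism because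
  both sides of each equation agree after the injective map \<open>f\<close>.\<close>

lemma RMod_lift:
  assumes M: "right_module R M" and W: "right_module R W"
    and f: "f \<in> Hom (RMod R) M N" "inj_on f (carrier M)" and g: "g \<in> Hom (RMod R) W N"
    and sub: "g ` carrier W \<subseteq> f ` carrier M"
  shows "\<exists>h \<in> Hom (RMod R) W M. \<forall>w \<in> carrier W. f (h w) = g w"
proof -
  interpret M: right_module R M by fact
  interpret W: right_module R W by fact
  have "\<forall>w \<in> carrier W. \<exists>x \<in> carrier M. f x = g w" using sub by (metis imageE image_subset_iff)
  then obtain h where h: "\<And>w. w \<in> carrier W \<Longrightarrow> h w \<in> carrier M"
    "\<And>w. w \<in> carrier W \<Longrightarrow> f (h w) = g w" by metis
  have "restrict h (carrier W) \<in> Hom (RMod R) W M"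
  proof (rule RMod_HomI[OF W])
    fix x y assume "x \<in> carrier W" "y \<in> carrier W"
    then show "h (x \<otimes>\<^bsub>W\<^esub> y) = h x \<otimes>\<^bsub>M\<^esub> h y"
      by - (rule inj_onD[OF f(2)]; simp add: h RMod_HomD(2)[OF f(1)] RMod_HomD(2)[OF g])
  next
    fix x a assume "x \<in> carrier W" "a \<in> carrier R"
    then show "h (ract W x a) = ract M (h x) a"
      by -
        (rule inj_onD[OF f(2)]; simp add: h RMod_HomD(3)[OF f(1)] RMod_HomD(3)[OF g] M.ract_closed W.ract_closed)
  qed (rule h)
  then show ?thesis by (rule bexI[rotated]) (simp add: h)
qed

lemma RMod_factor:
  assumes N: "right_module R N" and Q: "right_module R Q" and W: "right_module R W"
    and q: "q \<in> Hom (RMod R) N Q" "q ` carrier N = carrier Q" and g: "g \<in> Hom (RMod R) N W"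
    and ker: "\<And>y. \<lbrakk>y \<in> carrier N; q y = \<one>\<^bsub>Q\<^esub>\<rbrakk> \<Longrightarrow> g y = \<one>\<^bsub>W\<^esub>"
  shows "\<exists>h \<in> Hom (RMod R) Q W. \<forall>y \<in> carrier N. h (q y) = g y"
proof -
  interpret N: right_module R N by fact
  interpret Q: right_module R Q by fact
  interpret W: right_module R W by fact
  interpret q: group_hom N Q q
    by (rule comm_group_homD) (use N.comm_group_axioms Q.comm_group_axioms RMod_HomD(5)[OF q(1)] in auto)
  interpret g: group_hom N W g
    by (rule comm_group_homD) (use N.comm_group_axioms W.comm_group_axioms RMod_HomD(5)[OF g] in auto)
  obtain h where h: "\<And>y. y \<in> carrier N \<Longrightarrow> h (q y) = g y"
    using group_hom_factor[OF q.group_hom_axioms g.group_hom_axioms ker] by blast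
  have "restrict h (carrier Q) \<in> Hom (RMod R) Q W"
  proof (rule RMod_HomI[OF Q]; unfold q(2)[symmetric])
    fix x assume "x \<in> q ` carrier N" then show "h x \<in> carrier W" using h by auto
  next
    fix x y assume "x \<in> q ` carrier N" "y \<in> q ` carrier N"
    then obtain x' y' where xy: "x' \<in> carrier N" "y' \<in> carrier N" "x = q x'" "y = q y'" by blast
    then have "h (x \<otimes>\<^bsub>Q\<^esub> y) = h (q (x' \<otimes>\<^bsub>N\<^esub> y'))" by simp
    also have "\<dots> = g x' \<otimes>\<^bsub>W\<^esub> g y'" using xy by (subst h) simp_all
    finally show "h (x \<otimes>\<^bsub>Q\<^esub> y) = h x \<otimes>\<^bsub>W\<^esub> h y" using xy h by simp
  next
    fix x a assume "x \<in> q ` carrier N" and a: "a \<in> carrier R"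
    then obtain x' where x: "x' \<in> carrier N" "x = q x'" by blast
    then have "h (ract Q x a) = h (q (ract N x' a))" using RMod_HomD(3)[OF q(1)] a by simp
    also have "\<dots> = ract W (g x') a"
      using x a RMod_HomD(3)[OF g] by (subst h) (simp_all add: N.ract_closed)
    finally show "h (ract Q x a) = ract W (h x) a" using x h by simp
  qed
  moreover have "restrict h (carrier Q) (q y) = g y" if "y \<in> carrier N" for y using h that by simp
  ultimately show ?thesis by blast
qed

text \<open>Elements of a module carry no degree, so the index type is \<open>unit\<close>; for dg
  modules it is \<open>int\<close>.\<close>

lemma concrete_abelian_RMod:
  fixes R :: "'a ring"
  shows "concrete_abelian (RMod R) (\<lambda>(M :: ('a, 'b) right_module) (_::unit). carrier M) (\<lambda>M _. \<one>\<^bsub>M\<^esub>) (\<lambda>f _. f)"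
proof
  fix X :: "('a, 'b) right_module" assume "X \<in> Obj (RMod R)"
  then have X: "right_module R X" by simp
  then interpret X: right_module R X .
  show "\<one>\<^bsub>X\<^esub> \<in> carrier X" by simp
  have "restrict (\<lambda>x. x) (carrier X) \<in> Hom (RMod R) X X" by (rule RMod_HomI[OF X]) auto
  then show "\<exists>e\<in>Hom (RMod R) X X. \<forall>i::unit. \<forall>x\<in>carrier X. e x = x" by (rule bexI[rotated]) simp
next
  fix X Y :: "('a, 'b) right_module" assume "X \<in> Obj (RMod R)" "Y \<in> Obj (RMod R)"
  then have X: "right_module R X" and Y: "right_module R Y" by simp_all
  interpret X: right_module R X by fact
  interpret Y: right_module R Y by fact
  have "ract Y \<one>\<^bsub>Y\<^esub> a = \<one>\<^bsub>Y\<^esub>" if "a \<in> carrier R" for a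
    using Y.ract_add_left[of "\<one>\<^bsub>Y\<^esub>" "\<one>\<^bsub>Y\<^esub>" a] Y.ract_closed[of "\<one>\<^bsub>Y\<^esub>" a] that by simp
  then have "restrict (\<lambda>x. \<one>\<^bsub>Y\<^esub>) (carrier X) \<in> Hom (RMod R) X Y" by (intro RMod_HomI[OF X]) auto
  then show "\<exists>z\<in>Hom (RMod R) X Y. \<forall>i::unit. \<forall>x\<in>carrier X. z x = \<one>\<^bsub>Y\<^esub>" by (rule bexI[rotated]) simp
  fix f assume f: "f \<in> Hom (RMod R) X Y"
  interpret f: group_hom X Y f
    by (rule comm_group_homD) (use X.comm_group_axioms Y.comm_group_axioms RMod_HomD(5)[OF f] in auto)
  show "f x \<in> carrier Y" if "x \<in> carrier X" for x using that by simp
  show "f \<one>\<^bsub>X\<^esub> = \<one>\<^bsub>Y\<^esub>" by simp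
  show "inj_on f (carrier X)" if "\<And>x. \<lbrakk>x \<in> carrier X; f x = \<one>\<^bsub>Y\<^esub>\<rbrakk> \<Longrightarrow> x = \<one>\<^bsub>X\<^esub>"
    using that f.inj_on_one_iff by blast
  show "f = g" if "g \<in> Hom (RMod R) X Y" "\<And>(i::unit) x. x \<in> carrier X \<Longrightarrow> f x = g x" for g
    by (rule extensionalityI[OF RMod_HomD(4)[OF f] RMod_HomD(4)[OF that(1)]]) (rule that(2))
  show "\<exists>K\<in>Obj (RMod R). \<exists>k\<in>Hom (RMod R) K X. \<forall>i::unit. inj_on k (carrier K) \<and>
      k ` carrier K = {x \<in> carrier X. f x = \<one>\<^bsub>Y\<^esub>}"
    using RMod_kernel[OF X Y f] by simp
  show "\<exists>Q\<in>Obj (RMod R). \<exists>q\<in>Hom (RMod R) Y Q. \<forall>i::unit. q ` carrier Y = carrier Q \<and>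
      {y \<in> carrier Y. q y = \<one>\<^bsub>Q\<^esub>} = f ` carrier X"
    using RMod_cokernel[OF X Y f] by simp
next
  fix X Y Z :: "('a, 'b) right_module" and f g
  assume "X \<in> Obj (RMod R)" "Y \<in> Obj (RMod R)" "Z \<in> Obj (RMod R)"
    and f: "f \<in> Hom (RMod R) X Y" and g: "g \<in> Hom (RMod R) Y Z"
  then have X: "right_module R X" by simp
  have "restrict (\<lambda>x. g (f x)) (carrier X) \<in> Hom (RMod R) X Z"
    by (rule RMod_HomI[OF X]) (simp_all add: RMod_HomD(1-3)[OF f] RMod_HomD(1-3)[OF g])
  then show "Comp (RMod R) X Y Z g f \<in> Hom (RMod R) X Z" by (simp add: compose_def)
  show "Comp (RMod R) X Y Z g f x = g (f x)" if "x \<in> carrier X" for x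
    using that by (simp add: compose_eq)
next
  fix X Y W :: "('a, 'b) right_module" and f g
  assume "X \<in> Obj (RMod R)" "Y \<in> Obj (RMod R)" "W \<in> Obj (RMod R)"
    and "f \<in> Hom (RMod R) X Y" "g \<in> Hom (RMod R) W Y"
    and "\<And>i::unit. inj_on f (carrier X)" "\<And>i::unit. g ` carrier W \<subseteq> f ` carrier X"
  then show "\<exists>h\<in>Hom (RMod R) W X. \<forall>i::unit. \<forall>w\<in>carrier W. f (h w) = g w"
    using RMod_lift[of R X W f Y g] by simp
next
  fix Y Q W :: "('a, 'b) right_module" and q g
  assume "Y \<in> Obj (RMod R)" "Q \<in> Obj (RMod R)" "W \<in> Obj (RMod R)"
    and "q \<in> Hom (RMod R) Y Q" "g \<in> Hom (RMod R) Y W"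
    and "\<And>i::unit. q ` carrier Y = carrier Q"
    and "\<And>(i::unit) y. \<lbrakk>y \<in> carrier Y; q y = \<one>\<^bsub>Q\<^esub>\<rbrakk> \<Longrightarrow> g y = \<one>\<^bsub>W\<^esub>"
  then show "\<exists>h\<in>Hom (RMod R) Q W. \<forall>i::unit. \<forall>y\<in>carrier Y. h (q y) = g y"
    using RMod_factor[of R Y Q W q g] by simp
qed


section \<open>The category of dg modules\<close>

lemma (in group) signed_closed: "x \<in> carrier G \<Longrightarrow> signed G i x \<in> carrier G"
  by (simp add: signed_def)

lemma (in group) signed_one: "signed G i \<one> = \<one>"
  by (simp add: signed_def)

lemma (in group_hom) hom_signed: "x \<in> carrier G \<Longrightarrow> h (signed G i x) = signed H i (h x)"
  by (simp add: signed_def)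

lemma
  assumes "dg_module A X"
  shows dg_module_group: "comm_group (grp X i)"
    and dg_module_diff_hom: "diff X i \<in> hom (grp X i) (grp X (i + 1))"
    and dg_module_diff_diff:
      "x \<in> carrier (grp X i) \<Longrightarrow> diff X (i + 1) (diff X i x) = \<one>\<^bsub>grp X (i + 1 + 1)\<^esub>"
    and dg_module_dg_ring: "dg_ring A"
    and dg_module_act_hom:
      "a \<in> carrier (grp A j) \<Longrightarrow> (\<lambda>x. act X i j x a) \<in> hom (grp X i) (grp X (i + j))"
proof -
  interpret X: dg_module A X by fact
  show "comm_group (grp X i)" by (rule X.M.grp_comm_group)
  show "diff X i \<in> hom (grp X i) (grp X (i + 1))" by (rule X.M.diff_hom)
  show "diff X (i + 1) (diff X i x) = \<one>\<^bsub>grp X (i + 1 + 1)\<^esub>" if "x \<in> carrier (grp X i)"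
    by (rule X.M.diff_diff[OF that])
  show "dg_ring A" by unfold_locales
  show "(\<lambda>x. act X i j x a) \<in> hom (grp X i) (grp X (i + j))" if "a \<in> carrier (grp A j)"
    using that by (auto simp: hom_def X.act_closed X.act_add_left)
qed

lemma dg_module_diff_closed:
  "\<lbrakk>dg_module A X; x \<in> carrier (grp X i)\<rbrakk> \<Longrightarrow> diff X i x \<in> carrier (grp X (i + 1))"
  using dg_module_diff_hom[of A X i] by (auto simp: hom_def)

lemma dg_module_diff_mult:
  "\<lbrakk>dg_module A X; x \<in> carrier (grp X i); y \<in> carrier (grp X i)\<rbrakk>
   \<Longrightarrow> diff X i (x \<otimes>\<^bsub>grp X i\<^esub> y) = diff X i x \<otimes>\<^bsub>grp X (i + 1)\<^esub> diff X i y"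
  using dg_module_diff_hom[of A X i] by (auto simp: hom_def)

lemma dg_module_diff_group_hom:
  "dg_module A X \<Longrightarrow> group_hom (grp X i) (grp X (i + 1)) (diff X i)"
  by (intro comm_group_homD dg_module_diff_hom dg_module_group)

lemma dg_module_act_group_hom:
  "\<lbrakk>dg_module A X; a \<in> carrier (grp A j)\<rbrakk>
   \<Longrightarrow> group_hom (grp X i) (grp X (i + j)) (\<lambda>x. act X i j x a)"
  by (intro comm_group_homD dg_module_act_hom dg_module_group)

text \<open>The graded version of the transfer to quotients. The sign in the Leibniz rule survives
  because each \<open>p i\<close> is a group homomorphism and hence commutes with
  \<open>signed\<close>.\<close>

lemma dg_module_surj_image:
  assumes X: "dg_module A X" and c: "\<And>i. carrier (grp Y i) = p i ` carrier (grp X i)"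
    and m: "\<And>i x y. \<lbrakk>x \<in> carrier (grp X i); y \<in> carrier (grp X i)\<rbrakk>
      \<Longrightarrow> p i x \<otimes>\<^bsub>grp Y i\<^esub> p i y = p i (x \<otimes>\<^bsub>grp X i\<^esub> y)"
    and o: "\<And>i. \<one>\<^bsub>grp Y i\<^esub> = p i \<one>\<^bsub>grp X i\<^esub>"
    and d: "\<And>i x. x \<in> carrier (grp X i) \<Longrightarrow> diff Y i (p i x) = p (i + 1) (diff X i x)"
    and a: "\<And>i j x a. \<lbrakk>x \<in> carrier (grp X i); a \<in> carrier (grp A j)\<rbrakk>
      \<Longrightarrow> act Y i j (p i x) a = p (i + j) (act X i j x a)"
  shows "dg_module A Y"
proof -
  interpret X: dg_module A X by fact
  have Y: "comm_group (grp Y i)" for i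
    by (rule comm_group_surj_image[OF dg_module_group[OF X] c m o])
  have p: "group_hom (grp X i) (grp Y i) (p i)" for i
    by (rule comm_group_homD[OF dg_module_group[OF X] Y]) (auto simp: hom_def c m)
  note dc = dg_module_diff_closed[OF X]
  have ac: "act X i j x a \<in> carrier (grp X k)"
    if "x \<in> carrier (grp X i)" "a \<in> carrier (grp A j)" "k = i + j" for i j k x a
    using X.act_closed that by simp
  show ?thesis
  proof (intro dg_module.intro cochain_complex.intro dg_module_axioms.intro)
    fix i x assume "x \<in> carrier (grp Y i)"
    then obtain z where z: "z \<in> carrier (grp X i)" "x = p i z" using c by auto
    show "diff Y (i + 1) (diff Y i x) = \<one>\<^bsub>grp Y (i + 1 + 1)\<^esub>"
      using z by (simp add: d dc dg_module_diff_diff[OF X] o)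
    show "act Y i 0 x (unity A) = x" using z a[OF z(1) X.unity_closed] by (simp add: X.act_unity)
    fix j b assume b: "b \<in> carrier (grp A j)"
    show "act Y i j x b \<in> carrier (grp Y (i + j))" using z b by (simp add: a c X.act_closed)
    show "diff Y (i + j) (act Y i j x b) =
        act Y (i + 1) j (diff Y i x) b \<otimes>\<^bsub>grp Y (i + j + 1)\<^esub>
        signed (grp Y (i + j + 1)) i (act Y i (j + 1) x (diff A j b))"
    proof -
      have db: "diff A j b \<in> carrier (grp A (j + 1))"
        using X.A.diff_hom b by (auto simp: hom_def)
      have 1: "act X (i + 1) j (diff X i z) b \<in> carrier (grp X (i + j + 1))"
        by (rule ac) (simp_all add: dc z b)
      have 2: "act X i (j + 1) z (diff A j b) \<in> carrier (grp X (i + j + 1))"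
        by (rule ac) (simp_all add: z db)
      have 3: "act Y (i + 1) j (diff Y i x) b = p (i + j + 1) (act X (i + 1) j (diff X i z) b)"
        using a[OF dc[OF z(1)] b] z by (simp add: d ac_simps)
      have 4: "act Y i (j + 1) x (diff A j b) = p (i + j + 1) (act X i (j + 1) z (diff A j b))"
        using a[OF z(1) db] z by (simp add: ac_simps)
      have "diff Y (i + j) (act Y i j x b) = p (i + j + 1) (diff X (i + j) (act X i j z b))"
        using z b by (simp add: a d X.act_closed)
      then show ?thesis
        unfolding X.act_leibniz[OF z(1) b] 3 4 group_hom.hom_signed[OF p 2, symmetric]
        using m 1 2 group.signed_closed[OF comm_group.axioms(2)[OF dg_module_group[OF X]] 2] by simp
    qed
    show "act Y i j x (b \<otimes>\<^bsub>grp A j\<^esub> b') = act Y i j x b \<otimes>\<^bsub>grp Y (i + j)\<^esub> act Y i j x b'"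
      if b': "b' \<in> carrier (grp A j)" for b'
    proof -
      have "b \<otimes>\<^bsub>grp A j\<^esub> b' \<in> carrier (grp A j)"
        using X.A.grp_comm_group[of j] b b' by (simp add: comm_group_def comm_monoid_def monoid.m_closed)
      then show ?thesis using z b b' by (simp add: a m X.act_closed X.act_add_right)
    qed
    show "act Y (i + j) k (act Y i j x b) c = act Y i (j + k) x (mul A j k b c)"
      if "c \<in> carrier (grp A k)" for k c
    proof -
      have "mul A j k b c \<in> carrier (grp A (j + k))" using X.A.mul_closed b that by blast
      then show ?thesis using z b that by (simp add: a X.act_closed X.act_assoc add.assoc)
    qed
    show "act Y i j (x \<otimes>\<^bsub>grp Y i\<^esub> y) b = act Y i j x b \<otimes>\<^bsub>grp Y (i + j)\<^esub> act Y i j y b"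
      if y: "y \<in> carrier (grp Y i)" for y
    proof -
      obtain w where w: "w \<in> carrier (grp X i)" "y = p i w" using y c by auto
      have "z \<otimes>\<^bsub>grp X i\<^esub> w \<in> carrier (grp X i)"
        using dg_module_group[OF X, of i] z w by (simp add: comm_group_def comm_monoid_def monoid.m_closed)
      then show ?thesis using z w b by (simp add: a m X.act_closed X.act_add_left)
    qed
  next
    fix i show "diff Y i \<in> hom (grp Y i) (grp Y (i + 1))"
    proof (rule homI)
      fix x assume "x \<in> carrier (grp Y i)"
      then obtain z where z: "z \<in> carrier (grp X i)" "x = p i z" using c by auto
      then show "diff Y i x \<in> carrier (grp Y (i + 1))" by (simp add: d c dc)
      fix y assume "y \<in> carrier (grp Y i)"
      then obtain w where w: "w \<in> carrier (grp X i)" "y = p i w" using c by auto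
      have "z \<otimes>\<^bsub>grp X i\<^esub> w \<in> carrier (grp X i)"
        using dg_module_group[OF X, of i] z w by (simp add: comm_group_def comm_monoid_def monoid.m_closed)
      then show "diff Y i (x \<otimes>\<^bsub>grp Y i\<^esub> y) = diff Y i x \<otimes>\<^bsub>grp Y (i + 1)\<^esub> diff Y i y"
        using z w by (simp add: m d dc dg_module_diff_mult[OF X])
    qed
  qed (rule dg_module_dg_ring[OF X] Y)+
qed

text \<open>The graded version of the transfer to subobjects: equations are compared after
  \<open>f\<close> in the degree where they live (\<open>eqI\<close>).\<close>

lemma dg_module_inj_preimage:
  assumes X: "dg_module A X" and Y: "\<And>i. comm_group (grp Y i)"
    and f: "\<And>i. f i \<in> hom (grp Y i) (grp X i)" and inj: "\<And>i. inj_on (f i) (carrier (grp Y i))"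
    and dc: "\<And>i x. x \<in> carrier (grp Y i) \<Longrightarrow> diff Y i x \<in> carrier (grp Y (i + 1))"
    and d: "\<And>i x. x \<in> carrier (grp Y i) \<Longrightarrow> f (i + 1) (diff Y i x) = diff X i (f i x)"
    and ac: "\<And>i j x a. \<lbrakk>x \<in> carrier (grp Y i); a \<in> carrier (grp A j)\<rbrakk>
      \<Longrightarrow> act Y i j x a \<in> carrier (grp Y (i + j))"
    and a: "\<And>i j x a. \<lbrakk>x \<in> carrier (grp Y i); a \<in> carrier (grp A j)\<rbrakk>
      \<Longrightarrow> f (i + j) (act Y i j x a) = act X i j (f i x) a"
  shows "dg_module A Y"
proof -
  interpret X: dg_module A X by fact
  have g: "group_hom (grp Y i) (grp X i) (f i)" for i
    by (rule comm_group_homD[OF Y dg_module_group[OF X] f])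
  have fc: "f i x \<in> carrier (grp X i)" if "x \<in> carrier (grp Y i)" for i x
    using f that by (auto simp: hom_def)
  have fm: "f i (x \<otimes>\<^bsub>grp Y i\<^esub> y) = f i x \<otimes>\<^bsub>grp X i\<^esub> f i y"
    if "x \<in> carrier (grp Y i)" "y \<in> carrier (grp Y i)" for i x y
    using f that by (auto simp: hom_def)
  have yc: "x \<otimes>\<^bsub>grp Y i\<^esub> y \<in> carrier (grp Y i)"
    if "x \<in> carrier (grp Y i)" "y \<in> carrier (grp Y i)" for i x y
    using Y[of i] that by (simp add: comm_group_def comm_monoid_def monoid.m_closed)
  have bc: "x \<otimes>\<^bsub>grp A i\<^esub> y \<in> carrier (grp A i)"
    if "x \<in> carrier (grp A i)" "y \<in> carrier (grp A i)" for i x y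
    using X.A.grp_comm_group[of i] that by (simp add: comm_group_def comm_monoid_def monoid.m_closed)
  have eqI: "x = y" if "f i x = f i y" "x \<in> carrier (grp Y i)" "y \<in> carrier (grp Y i)" for i x y
    using inj that by (meson inj_onD)
  show ?thesis
  proof (intro dg_module.intro cochain_complex.intro dg_module_axioms.intro)
    fix i show "diff Y i \<in> hom (grp Y i) (grp Y (i + 1))"
    proof (rule homI)
      fix x y assume "x \<in> carrier (grp Y i)" "y \<in> carrier (grp Y i)"
      then show "diff Y i (x \<otimes>\<^bsub>grp Y i\<^esub> y) = diff Y i x \<otimes>\<^bsub>grp Y (i + 1)\<^esub> diff Y i y"
        by - (rule eqI[of "i + 1"]; simp add: fm d dc yc fc dg_module_diff_mult[OF X])
    qed (rule dc)
  next
    fix i x assume x: "x \<in> carrier (grp Y i)"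
    show "diff Y (i + 1) (diff Y i x) = \<one>\<^bsub>grp Y (i + 1 + 1)\<^esub>"
    proof (rule eqI)
      show "f (i + 1 + 1) (diff Y (i + 1) (diff Y i x)) = f (i + 1 + 1) \<one>\<^bsub>grp Y (i + 1 + 1)\<^esub>"
        using x d[OF dc[OF x]] by (simp add: d fc dg_module_diff_diff[OF X] group_hom.hom_one[OF g] del: add.assoc)
    qed (use dc[OF dc[OF x]] Y in \<open>auto simp: comm_group_def comm_monoid_def monoid.one_closed\<close>)
    show "act Y i 0 x (unity A) = x"
      using a[OF x X.unity_closed] ac[OF x X.unity_closed] x
      by (intro eqI[of i]) (simp_all add: X.act_unity fc)
    fix j b assume b: "b \<in> carrier (grp A j)"
    have db: "diff A j b \<in> carrier (grp A (j + 1))"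
      using X.A.diff_hom b by (auto simp: hom_def)
    show "diff Y (i + j) (act Y i j x b) =
        act Y (i + 1) j (diff Y i x) b \<otimes>\<^bsub>grp Y (i + j + 1)\<^esub>
        signed (grp Y (i + j + 1)) i (act Y i (j + 1) x (diff A j b))"
    proof (rule eqI)
      have 1: "act Y (i + 1) j (diff Y i x) b \<in> carrier (grp Y (i + j + 1))"
        "f (i + j + 1) (act Y (i + 1) j (diff Y i x) b) = act X (i + 1) j (diff X i (f i x)) b"
        using ac[OF dc[OF x] b] a[OF dc[OF x] b] by (simp_all add: ac_simps d[OF x, simplified ac_simps])
      have 2: "act Y i (j + 1) x (diff A j b) \<in> carrier (grp Y (i + j + 1))"
        "f (i + j + 1) (act Y i (j + 1) x (diff A j b)) = act X i (j + 1) (f i x) (diff A j b)"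
        using ac[OF x db] a[OF x db] by (simp_all add: ac_simps)
      have 3: "signed (grp Y (i + j + 1)) i (act Y i (j + 1) x (diff A j b)) \<in> carrier (grp Y (i + j + 1))"
        by (rule group.signed_closed[OF comm_group.axioms(2)[OF Y] 2(1)])
      show "f (i + j + 1) (diff Y (i + j) (act Y i j x b)) =
          f (i + j + 1) (act Y (i + 1) j (diff Y i x) b \<otimes>\<^bsub>grp Y (i + j + 1)\<^esub>
            signed (grp Y (i + j + 1)) i (act Y i (j + 1) x (diff A j b)))"
        using X.act_leibniz[OF fc[OF x] b] x b
        by (simp add: d ac a fm 1 2 3 group_hom.hom_signed[OF g])
      show "diff Y (i + j) (act Y i j x b) \<in> carrier (grp Y (i + j + 1))" by (simp add: dc ac x b)
      show "act Y (i + 1) j (diff Y i x) b \<otimes>\<^bsub>grp Y (i + j + 1)\<^esub>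
          signed (grp Y (i + j + 1)) i (act Y i (j + 1) x (diff A j b)) \<in> carrier (grp Y (i + j + 1))"
        by (rule yc[OF 1(1) 3])
    qed
    show "act Y i j x (b \<otimes>\<^bsub>grp A j\<^esub> b') = act Y i j x b \<otimes>\<^bsub>grp Y (i + j)\<^esub> act Y i j x b'"
      if b': "b' \<in> carrier (grp A j)" for b'
      using x b b' by - (rule eqI[of "i + j"]; simp add: bc ac a fm yc fc X.act_add_right)
    show "act Y (i + j) k (act Y i j x b) c = act Y i (j + k) x (mul A j k b c)"
      if c: "c \<in> carrier (grp A k)" for k c
    proof (rule eqI)
      have mc: "mul A j k b c \<in> carrier (grp A (j + k))" using X.A.mul_closed b c by blast
      show "f (i + j + k) (act Y (i + j) k (act Y i j x b) c) = f (i + j + k) (act Y i (j + k) x (mul A j k b c))"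
        using a[OF ac[OF x b] c] a[OF x mc] X.act_assoc[OF fc[OF x] b c] a[OF x b] by (simp add: add.assoc)
      show "act Y (i + j) k (act Y i j x b) c \<in> carrier (grp Y (i + j + k))" by (rule ac[OF ac[OF x b] c])
      show "act Y i (j + k) x (mul A j k b c) \<in> carrier (grp Y (i + j + k))"
        using ac[OF x mc] by (simp add: add.assoc)
    qed
    show "act Y i j (x \<otimes>\<^bsub>grp Y i\<^esub> y) b = act Y i j x b \<otimes>\<^bsub>grp Y (i + j)\<^esub> act Y i j y b"
      if "y \<in> carrier (grp Y i)" for y
      using x b that by - (rule eqI[of "i + j"]; simp add: ac a fm yc fc X.act_add_left)
  qed (fact dg_module_dg_ring[OF X] Y ac)+
qed

lemma dgMod_simps [simp]:
  "Obj (dgMod A) = {M. dg_module A M}"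
  "Comp (dgMod A) L M N g f = (\<lambda>i. compose (carrier (grp L i)) (g i) (f i))"
  by (simp_all add: dgMod_def)

lemma dgMod_HomI:
  assumes X: "dg_module A X"
    and "\<And>i x. x \<in> carrier (grp X i) \<Longrightarrow> f i x \<in> carrier (grp Y i)"
    and "\<And>i x y. \<lbrakk>x \<in> carrier (grp X i); y \<in> carrier (grp X i)\<rbrakk>
      \<Longrightarrow> f i (x \<otimes>\<^bsub>grp X i\<^esub> y) = f i x \<otimes>\<^bsub>grp Y i\<^esub> f i y"
    and "\<And>i x. x \<in> carrier (grp X i) \<Longrightarrow> f (i + 1) (diff X i x) = diff Y i (f i x)"
    and "\<And>i j x a. \<lbrakk>x \<in> carrier (grp X i); a \<in> carrier (grp A j)\<rbrakk>
      \<Longrightarrow> f (i + j) (act X i j x a) = act Y i j (f i x) a"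
  shows "(\<lambda>i. restrict (f i) (carrier (grp X i))) \<in> Hom (dgMod A) X Y"
proof -
  interpret X: dg_module A X by fact
  have "x \<otimes>\<^bsub>grp X i\<^esub> y \<in> carrier (grp X i)"
    if "x \<in> carrier (grp X i)" "y \<in> carrier (grp X i)" for i x y
    using dg_module_group[OF X, of i] that by (simp add: comm_group_def comm_monoid_def monoid.m_closed)
  then show ?thesis
    using assms(2-) by (simp add: dgMod_def hom_def dg_module_diff_closed[OF X] X.act_closed)
qed

lemma dgMod_HomD:
  assumes "f \<in> Hom (dgMod A) X Y"
  shows "x \<in> carrier (grp X i) \<Longrightarrow> f i x \<in> carrier (grp Y i)"
    and "\<lbrakk>x \<in> carrier (grp X i); y \<in> carrier (grp X i)\<rbrakk>
      \<Longrightarrow> f i (x \<otimes>\<^bsub>grp X i\<^esub> y) = f i x \<otimes>\<^bsub>grp Y i\<^esub> f i y"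
    and "x \<in> carrier (grp X i) \<Longrightarrow> f (i + 1) (diff X i x) = diff Y i (f i x)"
    and "\<lbrakk>x \<in> carrier (grp X i); a \<in> carrier (grp A j)\<rbrakk>
      \<Longrightarrow> f (i + j) (act X i j x a) = act Y i j (f i x) a"
    and "f i \<in> extensional (carrier (grp X i))" and "f i \<in> hom (grp X i) (grp Y i)"
  using assms by (auto simp: dgMod_def hom_def)

lemma dgMod_Hom_group_hom:
  assumes "dg_module A X" "dg_module A Y" "f \<in> Hom (dgMod A) X Y"
  shows "group_hom (grp X i) (grp Y i) (f i)"
  by (intro comm_group_homD dg_module_group[OF assms(1)] dg_module_group[OF assms(2)] dgMod_HomD(6)[OF assms(3)])

lemma dgMod_kernel:
  assumes X: "dg_module A X" and Y: "dg_module A Y" and f: "f \<in> Hom (dgMod A) X Y"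
  shows "\<exists>K. dg_module A K \<and> (\<exists>k \<in> Hom (dgMod A) K X. \<forall>i. inj_on (k i) (carrier (grp K i)) \<and>
     k i ` carrier (grp K i) = {x \<in> carrier (grp X i). f i x = \<one>\<^bsub>grp Y i\<^esub>})"
proof -
  interpret X: dg_module A X by fact
  let ?P = "\<lambda>i. {x \<in> carrier (grp X i). f i x = \<one>\<^bsub>grp Y i\<^esub>}"
  have P: "subgroup (?P i) (grp X i)" for i
    using group_hom.subgroup_kernel[OF dgMod_Hom_group_hom[OF X Y f]] by (simp add: kernel_def)
  let ?K = "X\<lparr>grp := \<lambda>i. (grp X i)\<lparr>carrier := ?P i\<rparr>\<rparr>"
  have "diff Y i \<one>\<^bsub>grp Y i\<^esub> = \<one>\<^bsub>grp Y (i + 1)\<^esub>" for i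
    by (rule group_hom.hom_one[OF dg_module_diff_group_hom[OF Y]])
  then have d: "x \<in> ?P i \<Longrightarrow> diff X i x \<in> ?P (i + 1)" for i x
    using dgMod_HomD(3)[OF f] dg_module_diff_closed[OF X] by auto
  have "act Y i j \<one>\<^bsub>grp Y i\<^esub> a = \<one>\<^bsub>grp Y (i + j)\<^esub>" if "a \<in> carrier (grp A j)" for i j a
    using group_hom.hom_one[OF dg_module_act_group_hom[OF Y that]] by simp
  then have a: "\<lbrakk>x \<in> ?P i; a \<in> carrier (grp A j)\<rbrakk> \<Longrightarrow> act X i j x a \<in> ?P (i + j)" for i j x a
    using dgMod_HomD(4)[OF f] X.act_closed by auto
  have K: "dg_module A ?K"
    by (rule dg_module_inj_preimage[OF X, where f = "\<lambda>i x. x"])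
      (use d a comm_group.comm_group_subgroup[OF dg_module_group[OF X] P] in \<open>auto simp: hom_def\<close>)
  let ?k = "\<lambda>i. restrict (\<lambda>x. x) (carrier (grp ?K i))"
  have "?k \<in> Hom (dgMod A) ?K X"
    by (rule dgMod_HomI[OF K]) auto
  moreover have "\<forall>i. inj_on (?k i) (carrier (grp ?K i)) \<and> ?k i ` carrier (grp ?K i) = ?P i"
    by (auto simp: inj_on_def)
  ultimately show ?thesis using K by (intro exI[of _ ?K] conjI bexI[of _ ?k])
qed

text \<open>The image of \<open>f\<close> is stable under the differential and the action because
  \<open>f\<close> commutes with both. The facts \<open>rd\<close>, \<open>ra\<close> and
  \<open>rm\<close> record independence of representatives in the form that serves both the quotient
  module and the projection onto it.\<close>

lemma dgMod_cokernel:
  assumes X: "dg_module A X" and Y: "dg_module A Y" and f: "f \<in> Hom (dgMod A) X Y"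
  shows "\<exists>Q. dg_module A Q \<and> (\<exists>q \<in> Hom (dgMod A) Y Q. \<forall>i. q i ` carrier (grp Y i) = carrier (grp Q i) \<and>
     {y \<in> carrier (grp Y i). q i y = \<one>\<^bsub>grp Q i\<^esub>} = f i ` carrier (grp X i))"
proof -
  interpret X: dg_module A X by fact
  interpret Y: dg_module A Y by fact
  let ?P = "\<lambda>i. f i ` carrier (grp X i)"
  note G = dg_module_group[OF Y]
  have P: "subgroup (?P i) (grp Y i)" for i
    by (rule group_hom.img_is_subgroup[OF dgMod_Hom_group_hom[OF X Y f]])
  define r where "r i = coset_rep (grp Y i) (?P i)" for i
  have rd: "r (i + 1) (diff Y i (r i x)) = r (i + 1) (diff Y i x)" if "x \<in> carrier (grp Y i)" for i x
  proof -
    have "diff Y i ` ?P i \<subseteq> ?P (i + 1)"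
      using dgMod_HomD(3)[OF f, symmetric] dg_module_diff_closed[OF X] by auto
    then show ?thesis
      unfolding r_def by (rule coset_rep_hom[OF G G P P dg_module_diff_hom[OF Y] _ that])
  qed
  have ra: "r (i + j) (act Y i j (r i x) a) = r (i + j) (act Y i j x a)"
    if "x \<in> carrier (grp Y i)" "a \<in> carrier (grp A j)" for i j x a
  proof -
    have "(\<lambda>x. act Y i j x a) ` ?P i \<subseteq> ?P (i + j)"
      using dgMod_HomD(4)[OF f, symmetric] X.act_closed that(2) by auto
    then show ?thesis
      unfolding r_def by (rule coset_rep_hom[OF G G P P dg_module_act_hom[OF Y that(2)] _ that(1)])
  qed
  have rm: "r i (r i x \<otimes>\<^bsub>grp Y i\<^esub> r i y) = r i (x \<otimes>\<^bsub>grp Y i\<^esub> y)"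
    if "x \<in> carrier (grp Y i)" "y \<in> carrier (grp Y i)" for i x y
    unfolding r_def by (rule comm_group.coset_rep_mult[OF G P that])
  let ?Q = "\<lparr>grp = (\<lambda>i. rep_quotient (grp Y i) (?P i)), diff = (\<lambda>i x. r (i + 1) (diff Y i x)),
    act = (\<lambda>i j x a. r (i + j) (act Y i j x a))\<rparr>"
  have Q: "dg_module A ?Q"
    by (rule dg_module_surj_image[OF Y, where p = r])
      (simp_all add: rep_quotient_def rd ra rm flip: r_def)
  let ?q = "\<lambda>i. restrict (r i) (carrier (grp Y i))"
  have "?q \<in> Hom (dgMod A) Y ?Q"
    by (rule dgMod_HomI[OF Y]) (simp_all add: rep_quotient_def rd ra rm flip: r_def)
  moreover have "\<forall>i. ?q i ` carrier (grp Y i) = carrier (grp ?Q i) \<and>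
    {y \<in> carrier (grp Y i). ?q i y = \<one>\<^bsub>grp ?Q i\<^esub>} = ?P i"
    using comm_group.coset_rep_one_iff[OF G P] subgroup.subset[OF P]
    by (fastforce simp: rep_quotient_def r_def)
  ultimately show ?thesis using Q by (intro exI[of _ ?Q] conjI bexI[of _ ?q])
qed

lemma dgMod_lift:
  assumes X: "dg_module A X" and W: "dg_module A W"
    and f: "f \<in> Hom (dgMod A) X Y" "\<And>i. inj_on (f i) (carrier (grp X i))"
    and g: "g \<in> Hom (dgMod A) W Y"
    and sub: "\<And>i. g i ` carrier (grp W i) \<subseteq> f i ` carrier (grp X i)"
  shows "\<exists>h \<in> Hom (dgMod A) W X. \<forall>i. \<forall>w \<in> carrier (grp W i). f i (h i w) = g i w"
proof -
  interpret X: dg_module A X by fact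
  interpret W: dg_module A W by fact
  have "\<forall>i. \<forall>w \<in> carrier (grp W i). \<exists>x \<in> carrier (grp X i). f i x = g i w"
    using sub by (metis imageE image_subset_iff)
  then obtain h where h: "\<And>i w. w \<in> carrier (grp W i) \<Longrightarrow> h i w \<in> carrier (grp X i)"
    "\<And>i w. w \<in> carrier (grp W i) \<Longrightarrow> f i (h i w) = g i w" by metis
  have c: "x \<otimes>\<^bsub>grp Z i\<^esub> y \<in> carrier (grp Z i)" if "dg_module A Z"
    "x \<in> carrier (grp Z i)" "y \<in> carrier (grp Z i)" for Z :: "('a, 'b) dg_module" and i x y
    using dg_module_group[OF that(1), of i] that by (simp add: comm_group_def comm_monoid_def monoid.m_closed)
  have "(\<lambda>i. restrict (h i) (carrier (grp W i))) \<in> Hom (dgMod A) W X"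
  proof (rule dgMod_HomI[OF W])
    fix i x y assume "x \<in> carrier (grp W i)" "y \<in> carrier (grp W i)"
    then show "h i (x \<otimes>\<^bsub>grp W i\<^esub> y) = h i x \<otimes>\<^bsub>grp X i\<^esub> h i y"
      by - (rule inj_onD[OF f(2)[of i]]; simp add: h c[OF W] c[OF X] dgMod_HomD(2)[OF f(1)] dgMod_HomD(2)[OF g])
  next
    fix i x assume "x \<in> carrier (grp W i)"
    then show "h (i + 1) (diff W i x) = diff X i (h i x)"
      by - (rule inj_onD[OF f(2)[of "i + 1"]]; simp add: h dg_module_diff_closed[OF W] dg_module_diff_closed[OF X]
        dgMod_HomD(3)[OF f(1)] dgMod_HomD(3)[OF g])
  next
    fix i j x a assume "x \<in> carrier (grp W i)" "a \<in> carrier (grp A j)"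
    then show "h (i + j) (act W i j x a) = act X i j (h i x) a"
      by - (rule inj_onD[OF f(2)[of "i + j"]]; simp add: h W.act_closed X.act_closed
        dgMod_HomD(4)[OF f(1)] dgMod_HomD(4)[OF g])
  qed (rule h)
  then show ?thesis by (rule bexI[rotated]) (simp add: h)
qed

lemma dgMod_factor:
  assumes Y: "dg_module A Y" and Q: "dg_module A Q" and W: "dg_module A W"
    and q: "q \<in> Hom (dgMod A) Y Q" "\<And>i. q i ` carrier (grp Y i) = carrier (grp Q i)"
    and g: "g \<in> Hom (dgMod A) Y W"
    and ker: "\<And>i y. \<lbrakk>y \<in> carrier (grp Y i); q i y = \<one>\<^bsub>grp Q i\<^esub>\<rbrakk> \<Longrightarrow> g i y = \<one>\<^bsub>grp W i\<^esub>"
  shows "\<exists>h \<in> Hom (dgMod A) Q W. \<forall>i. \<forall>y \<in> carrier (grp Y i). h i (q i y) = g i y"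
proof -
  interpret Y: dg_module A Y by fact
  have "\<forall>i. \<exists>h. \<forall>y \<in> carrier (grp Y i). h (q i y) = g i y"
    using group_hom_factor[OF dgMod_Hom_group_hom[OF Y Q q(1)] dgMod_Hom_group_hom[OF Y W g] ker] by blast
  then obtain h where h: "\<And>i y. y \<in> carrier (grp Y i) \<Longrightarrow> h i (q i y) = g i y" by metis
  have c: "x \<otimes>\<^bsub>grp Y i\<^esub> y \<in> carrier (grp Y i)" if
    "x \<in> carrier (grp Y i)" "y \<in> carrier (grp Y i)" for i x y
    using dg_module_group[OF Y, of i] that by (simp add: comm_group_def comm_monoid_def monoid.m_closed)
  have "(\<lambda>i. restrict (h i) (carrier (grp Q i))) \<in> Hom (dgMod A) Q W"
  proof (rule dgMod_HomI[OF Q]; unfold q(2)[symmetric])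
    fix i x assume "x \<in> q i ` carrier (grp Y i)"
    then obtain z where z: "z \<in> carrier (grp Y i)" "x = q i z" by blast
    then show "h i x \<in> carrier (grp W i)" using h dgMod_HomD(1)[OF g] by simp
    show "h (i + 1) (diff Q i x) = diff W i (h i x)"
      using z h[OF dg_module_diff_closed[OF Y z(1)]] h dgMod_HomD(3)[OF g] dgMod_HomD(3)[OF q(1)] by simp
    show "h (i + j) (act Q i j x a) = act W i j (h i x) a" if "a \<in> carrier (grp A j)" for j a
      using z h[OF Y.act_closed[OF z(1) that]] h dgMod_HomD(4)[OF g _ that] dgMod_HomD(4)[OF q(1) _ that]
      by simp
    fix y assume "y \<in> q i ` carrier (grp Y i)"
    then obtain w where w: "w \<in> carrier (grp Y i)" "y = q i w" by blast
    show "h i (x \<otimes>\<^bsub>grp Q i\<^esub> y) = h i x \<otimes>\<^bsub>grp W i\<^esub> h i y"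
      using z w h[OF c[OF z(1) w(1)]] h dgMod_HomD(2)[OF g] dgMod_HomD(2)[OF q(1)] by simp
  qed
  then show ?thesis by (rule bexI[rotated]) (simp add: h dgMod_HomD(1)[OF q(1)])
qed

lemma concrete_abelian_dgMod:
  fixes A :: "'a dg_ring"
  shows "concrete_abelian (dgMod A) (\<lambda>(M :: ('a, 'b) dg_module) i. carrier (grp M i))
    (\<lambda>M i. \<one>\<^bsub>grp M i\<^esub>) (\<lambda>f. f)"
proof
  fix X :: "('a, 'b) dg_module" assume "X \<in> Obj (dgMod A)"
  then have X: "dg_module A X" by simp
  show "\<one>\<^bsub>grp X i\<^esub> \<in> carrier (grp X i)" for i
    using dg_module_group[OF X, of i] by (simp add: comm_group_def comm_monoid_def monoid.one_closed)
  have "(\<lambda>i. restrict (\<lambda>x. x) (carrier (grp X i))) \<in> Hom (dgMod A) X X" by (rule dgMod_HomI[OF X]) auto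
  then show "\<exists>e\<in>Hom (dgMod A) X X. \<forall>i. \<forall>x\<in>carrier (grp X i). e i x = x" by (rule bexI[rotated]) simp
next
  fix X Y :: "('a, 'b) dg_module" assume "X \<in> Obj (dgMod A)" "Y \<in> Obj (dgMod A)"
  then have X: "dg_module A X" and Y: "dg_module A Y" by simp_all
  have o: "\<one>\<^bsub>grp Y i\<^esub> \<in> carrier (grp Y i)" "\<one>\<^bsub>grp Y i\<^esub> \<otimes>\<^bsub>grp Y i\<^esub> \<one>\<^bsub>grp Y i\<^esub> = \<one>\<^bsub>grp Y i\<^esub>" for i
    using dg_module_group[OF Y, of i]
    by (simp_all add: comm_group_def comm_monoid_def monoid.one_closed monoid.l_one)
  have "(\<lambda>i. restrict (\<lambda>x. \<one>\<^bsub>grp Y i\<^esub>) (carrier (grp X i))) \<in> Hom (dgMod A) X Y"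
    by (rule dgMod_HomI[OF X]) (simp_all add: o group_hom.hom_one[OF dg_module_diff_group_hom[OF Y]]
      group_hom.hom_one[OF dg_module_act_group_hom[OF Y]])
  then show "\<exists>z\<in>Hom (dgMod A) X Y. \<forall>i. \<forall>x\<in>carrier (grp X i). z i x = \<one>\<^bsub>grp Y i\<^esub>"
    by (rule bexI[rotated]) simp
  fix f assume f: "f \<in> Hom (dgMod A) X Y"
  note fh = dgMod_Hom_group_hom[OF X Y f]
  show "f i x \<in> carrier (grp Y i)" if "x \<in> carrier (grp X i)" for i x
    using dgMod_HomD(1)[OF f that] .
  show "f i \<one>\<^bsub>grp X i\<^esub> = \<one>\<^bsub>grp Y i\<^esub>" for i using group_hom.hom_one[OF fh] .
  show "inj_on (f i) (carrier (grp X i))"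
    if "\<And>x. \<lbrakk>x \<in> carrier (grp X i); f i x = \<one>\<^bsub>grp Y i\<^esub>\<rbrakk> \<Longrightarrow> x = \<one>\<^bsub>grp X i\<^esub>" for i
    using that group_hom.inj_on_one_iff[OF fh] by blast
  show "f = g" if "g \<in> Hom (dgMod A) X Y" "\<And>i x. x \<in> carrier (grp X i) \<Longrightarrow> f i x = g i x" for g
    by (rule ext, rule extensionalityI[OF dgMod_HomD(5)[OF f] dgMod_HomD(5)[OF that(1)]]) (rule that(2))
  show "\<exists>K\<in>Obj (dgMod A). \<exists>k\<in>Hom (dgMod A) K X. \<forall>i. inj_on (k i) (carrier (grp K i)) \<and>
      k i ` carrier (grp K i) = {x \<in> carrier (grp X i). f i x = \<one>\<^bsub>grp Y i\<^esub>}"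
    using dgMod_kernel[OF X Y f] by simp
  show "\<exists>Q\<in>Obj (dgMod A). \<exists>q\<in>Hom (dgMod A) Y Q. \<forall>i. q i ` carrier (grp Y i) = carrier (grp Q i) \<and>
      {y \<in> carrier (grp Y i). q i y = \<one>\<^bsub>grp Q i\<^esub>} = f i ` carrier (grp X i)"
    using dgMod_cokernel[OF X Y f] by simp
next
  fix X Y Z :: "('a, 'b) dg_module" and f g
  assume "X \<in> Obj (dgMod A)" "Y \<in> Obj (dgMod A)" "Z \<in> Obj (dgMod A)"
    and f: "f \<in> Hom (dgMod A) X Y" and g: "g \<in> Hom (dgMod A) Y Z"
  then have X: "dg_module A X" by simp
  have "(\<lambda>i. restrict (\<lambda>x. g i (f i x)) (carrier (grp X i))) \<in> Hom (dgMod A) X Z"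
    by (rule dgMod_HomI[OF X]) (simp_all add: dgMod_HomD(1-4)[OF f] dgMod_HomD(1-4)[OF g])
  then show "Comp (dgMod A) X Y Z g f \<in> Hom (dgMod A) X Z" by (simp add: compose_def)
  show "Comp (dgMod A) X Y Z g f i x = g i (f i x)" if "x \<in> carrier (grp X i)" for i x
    using that by (simp add: compose_eq)
next
  fix X Y W :: "('a, 'b) dg_module" and f g
  assume "X \<in> Obj (dgMod A)" "Y \<in> Obj (dgMod A)" "W \<in> Obj (dgMod A)"
    and "f \<in> Hom (dgMod A) X Y" "g \<in> Hom (dgMod A) W Y"
    and "\<And>i. inj_on (f i) (carrier (grp X i))"
    and "\<And>i. g i ` carrier (grp W i) \<subseteq> f i ` carrier (grp X i)"
  then show "\<exists>h\<in>Hom (dgMod A) W X. \<forall>i. \<forall>w\<in>carrier (grp W i). f i (h i w) = g i w"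
    using dgMod_lift[of A X W f Y g] by simp
next
  fix Y Q W :: "('a, 'b) dg_module" and q g
  assume "Y \<in> Obj (dgMod A)" "Q \<in> Obj (dgMod A)" "W \<in> Obj (dgMod A)"
    and "q \<in> Hom (dgMod A) Y Q" "g \<in> Hom (dgMod A) Y W"
    and "\<And>i. q i ` carrier (grp Y i) = carrier (grp Q i)"
    and "\<And>i y. \<lbrakk>y \<in> carrier (grp Y i); q i y = \<one>\<^bsub>grp Q i\<^esub>\<rbrakk> \<Longrightarrow> g i y = \<one>\<^bsub>grp W i\<^esub>"
  then show "\<exists>h\<in>Hom (dgMod A) Q W. \<forall>i. \<forall>y\<in>carrier (grp Y i). h i (q i y) = g i y"
    using dgMod_factor[of A Y Q W q g] by simp
qed


interpretation RMod: concrete_abelian "RMod R" "\<lambda>M (_::unit). carrier M" "\<lambda>M _. \<one>\<^bsub>M\<^esub>" "\<lambda>f _. f"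
  for R :: "'a ring"
  by (rule concrete_abelian_RMod)

interpretation dgMod: concrete_abelian "dgMod A" "\<lambda>M i. carrier (grp M i)" "\<lambda>M i. \<one>\<^bsub>grp M i\<^esub>" "\<lambda>f. f"
  for A :: "'a dg_ring"
  by (rule concrete_abelian_dgMod)

lemma RMod_trivial_iff: "RMod.trivial M \<longleftrightarrow> carrier M = {\<one>\<^bsub>M\<^esub>}"
  by (simp add: RMod.trivial_def)

section \<open>Shifts\<close>

lemma (in comm_group) signed_mult:
  "\<lbrakk>x \<in> carrier G; y \<in> carrier G\<rbrakk> \<Longrightarrow> signed G i (x \<otimes> y) = signed G i x \<otimes> signed G i y"
  by (simp add: signed_def inv_mult)

lemma (in group) signed_signed: "x \<in> carrier G \<Longrightarrow> signed G i (signed G j x) = signed G (i + j) x"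
  by (simp add: signed_def)

lemma (in group) signed_eq_one_iff: "x \<in> carrier G \<Longrightarrow> signed G i x = \<one> \<longleftrightarrow> x = \<one>"
  using inv_eq_1_iff[of x] by (simp add: signed_def)

lemma signed_even: "even i \<Longrightarrow> signed G i x = x"
  by (simp add: signed_def)

lemma comm_group_is_group: "comm_group G \<Longrightarrow> group G"
  by (simp add: comm_group_def)

lemma shift_simps [simp]:
  "grp (shift n X) i = grp X (n + i)"
  "diff (shift n X) i x = signed (grp X (n + i + 1)) n (diff X (n + i) x)"
  "act (shift n X) i j = act X (n + i) j"
  by (simp_all add: shift_def)

lemma dg_module_one_closed: "dg_module A X \<Longrightarrow> \<one>\<^bsub>grp X i\<^esub> \<in> carrier (grp X i)"
  by (rule group.subgroup_self[THEN subgroup.one_closed]) (rule comm_group_is_group[OF dg_module_group])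

lemma dg_module_diff_one: "dg_module A X \<Longrightarrow> diff X i \<one>\<^bsub>grp X i\<^esub> = \<one>\<^bsub>grp X (i + 1)\<^esub>"
  by (rule group_hom.hom_one[OF dg_module_diff_group_hom])

lemma dg_module_act_one_left:
  "\<lbrakk>dg_module A X; a \<in> carrier (grp A j)\<rbrakk> \<Longrightarrow> act X i j \<one>\<^bsub>grp X i\<^esub> a = \<one>\<^bsub>grp X (i + j)\<^esub>"
  by (rule group_hom.hom_one[OF dg_module_act_group_hom])

lemma dg_module_act_one_right:
  assumes X: "dg_module A X" and x: "x \<in> carrier (grp X i)"
  shows "act X i j x \<one>\<^bsub>grp A j\<^esub> = \<one>\<^bsub>grp X (i + j)\<^esub>"
proof -
  interpret X: dg_module A X by fact
  have "(\<lambda>a. act X i j x a) \<in> hom (grp A j) (grp X (i + j))"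
    using x by (auto simp: hom_def X.act_closed X.act_add_right)
  then show ?thesis
    using comm_group_homD[OF X.A.grp_comm_group dg_module_group[OF X]] group_hom.hom_one by blast
qed

lemma dg_module_shift:
  assumes X: "dg_module A X"
  shows "dg_module A (shift n X)"
proof -
  interpret X: dg_module A X by fact
  have G: "comm_group (grp X i)" for i by (rule dg_module_group[OF X])
  have g: "group (grp X i)" for i by (rule comm_group_is_group[OF G])
  note sc = group.signed_closed[OF g]
  have dc: "diff X i x \<in> carrier (grp X k)" if "x \<in> carrier (grp X i)" "k = i + 1" for i k x
    using dg_module_diff_closed[OF X] that by simp
  have ac: "act X i j x a \<in> carrier (grp X k)"
    if "x \<in> carrier (grp X i)" "a \<in> carrier (grp A j)" "k = i + j" for i j k x a
    using X.act_closed that by simp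
  show ?thesis
  proof (intro dg_module.intro cochain_complex.intro dg_module_axioms.intro)
    show "dg_ring A" by (rule dg_module_dg_ring[OF X])
    show "comm_group (grp (shift n X) i)" for i using G by simp
    show "diff (shift n X) i \<in> hom (grp (shift n X) i) (grp (shift n X) (i + 1))" for i
    proof (rule homI)
      fix x y assume "x \<in> carrier (grp (shift n X) i)" "y \<in> carrier (grp (shift n X) i)"
      then show "diff (shift n X) i (x \<otimes>\<^bsub>grp (shift n X) i\<^esub> y) =
          diff (shift n X) i x \<otimes>\<^bsub>grp (shift n X) (i + 1)\<^esub> diff (shift n X) i y"
        by (simp add: dg_module_diff_mult[OF X] comm_group.signed_mult[OF G] dc flip: add.assoc)
    qed (simp add: sc dc flip: add.assoc)
  next
    fix i x assume x: "x \<in> carrier (grp (shift n X) i)"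
    then show "diff (shift n X) (i + 1) (diff (shift n X) i x) = \<one>\<^bsub>grp (shift n X) (i + 1 + 1)\<^esub>"
      by (simp add: group_hom.hom_signed[OF dg_module_diff_group_hom[OF X]] dc sc
          dg_module_diff_diff[OF X] group.signed_one[OF g] flip: add.assoc) (simp add: ac_simps)
    show "act (shift n X) i 0 x (unity A) = x" using x by (simp add: X.act_unity)
    fix j a assume a: "a \<in> carrier (grp A j)"
    show "act (shift n X) i j x a \<in> carrier (grp (shift n X) (i + j))"
      using x a by (simp add: ac)
    show "act (shift n X) i j (x \<otimes>\<^bsub>grp (shift n X) i\<^esub> y) a =
        act (shift n X) i j x a \<otimes>\<^bsub>grp (shift n X) (i + j)\<^esub> act (shift n X) i j y a"
      if "y \<in> carrier (grp (shift n X) i)" for y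
      using x a that by (simp add: X.act_add_left flip: add.assoc)
    show "act (shift n X) i j x (a \<otimes>\<^bsub>grp A j\<^esub> b) =
        act (shift n X) i j x a \<otimes>\<^bsub>grp (shift n X) (i + j)\<^esub> act (shift n X) i j x b"
      if "b \<in> carrier (grp A j)" for b
      using x a that by (simp add: X.act_add_right flip: add.assoc)
    show "act (shift n X) (i + j) k (act (shift n X) i j x a) b = act (shift n X) i (j + k) x (mul A j k a b)"
      if "b \<in> carrier (grp A k)" for k b
      using X.act_assoc[OF _ a that] x by (simp flip: add.assoc)
    show "diff (shift n X) (i + j) (act (shift n X) i j x a) =
        act (shift n X) (i + 1) j (diff (shift n X) i x) a \<otimes>\<^bsub>grp (shift n X) (i + j + 1)\<^esub>
        signed (grp (shift n X) (i + j + 1)) i (act (shift n X) i (j + 1) x (diff A j a))"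
    proof -
      have x': "x \<in> carrier (grp X (n + i))" using x by simp
      have da: "diff A j a \<in> carrier (grp A (j + 1))"
        using X.A.diff_hom a by (auto simp: hom_def)
      define k where "k = n + i + j + 1"
      let ?u = "act X (n + i + 1) j (diff X (n + i) x) a"
      let ?v = "act X (n + i) (j + 1) x (diff A j a)"
      have uv: "?u \<in> carrier (grp X k)" "?v \<in> carrier (grp X k)"
        by (rule ac[OF dc[OF x' refl] a] ac[OF x' da]; simp add: k_def)+
      have u: "act X (n + i + 1) j (signed (grp X (n + i + 1)) n (diff X (n + i) x)) a = signed (grp X k) n ?u"
        using group_hom.hom_signed[OF dg_module_act_group_hom[OF X a] dc[OF x' refl]]
        by (simp add: k_def ac_simps)
      have "signed (grp X k) n (diff X (n + i + j) (act X (n + i) j x a)) =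
          signed (grp X k) n (?u \<otimes>\<^bsub>grp X k\<^esub> signed (grp X k) (n + i) ?v)"
        using X.act_leibniz[OF x' a] by (simp add: k_def)
      \<comment> \<open>The two signs (-1)^n and (-1)^(n+i) multiply to (-1)^i, which is why the
        action itself can go unsigned under a shift.\<close>
      also have "\<dots> = signed (grp X k) n ?u \<otimes>\<^bsub>grp X k\<^esub> signed (grp X k) i ?v"
        using uv by (simp add: comm_group.signed_mult[OF G] sc group.signed_signed[OF g])
          (simp add: signed_def)
      finally show ?thesis
        using u by (simp add: k_def flip: add.assoc)
    qed
  qed
qed

lemma shift_Hom:
  assumes X: "dg_module A X" and Y: "dg_module A Y" and f: "f \<in> Hom (dgMod A) X Y"
  shows "(\<lambda>i. f (n + i)) \<in> Hom (dgMod A) (shift n X) (shift n Y)"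
proof -
  have "(\<lambda>i. restrict (f (n + i)) (carrier (grp (shift n X) i))) \<in> Hom (dgMod A) (shift n X) (shift n Y)"
    by (rule dgMod_HomI[OF dg_module_shift[OF X]])
      (simp_all add: dgMod_HomD(1-4)[OF f] dg_module_diff_closed[OF X]
        group_hom.hom_signed[OF dgMod_Hom_group_hom[OF X Y f]] flip: add.assoc)
  then show ?thesis using dgMod_HomD(5)[OF f] by (simp add: extensional_restrict)
qed

lemma embeds_shift:
  assumes "dgMod.embeds A X Y"
  shows "dgMod.embeds A (shift n X) (shift n Y)"
proof -
  obtain f where f: "dg_module A X" "dg_module A Y" "f \<in> Hom (dgMod A) X Y"
    "\<And>i. inj_on (f i) (carrier (grp X i))"
    using assms unfolding dgMod.embeds_def by auto
  show ?thesis
    by (rule dgMod.embedsI[OF _ _ shift_Hom[OF f(1-3)]])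
      (simp_all add: f dg_module_shift)
qed

text \<open>The signs (-1)^k and (-1)^n multiply, so the identity is an arrow. It stands in for an
  equality of records: off the carriers, where inverses are arbitrary, the two differentials need
  not agree.\<close>

lemma embeds_shift_shift:
  assumes X: "dg_module A X"
  shows "dgMod.embeds A (shift k (shift n X)) (shift (k + n) X)"
proof -
  have S: "dg_module A (shift k (shift n X))" "dg_module A (shift (k + n) X)"
    by (simp_all add: X dg_module_shift)
  have d: "diff X i x \<in> carrier (grp X j)" if "x \<in> carrier (grp X i)" "j = i + 1" for i j x
    using dg_module_diff_closed[OF X] that by simp
  have "(\<lambda>i. restrict (\<lambda>x. x) (carrier (grp (shift k (shift n X)) i)))
      \<in> Hom (dgMod A) (shift k (shift n X)) (shift (k + n) X)"
    by (rule dgMod_HomI[OF S(1)])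
      (simp_all add: d group.signed_signed[OF comm_group_is_group[OF dg_module_group[OF X]]]
        ac_simps)
  then show ?thesis using S by (intro dgMod.embedsI) (auto simp: inj_on_def)
qed

section \<open>The homogeneous parts of a dg module\<close>

definition degree_part :: "('a, 'm) dg_module \<Rightarrow> int \<Rightarrow> ('a, 'm) right_module" where
  "degree_part X m = \<lparr>carrier = carrier (grp X m), mult = mult (grp X m), one = one (grp X m),
     ract = act X m 0\<rparr>"

lemma degree_part_simps [simp]:
  "carrier (degree_part X m) = carrier (grp X m)"
  "mult (degree_part X m) = mult (grp X m)"
  "one (degree_part X m) = one (grp X m)"
  "ract (degree_part X m) = act X m 0"
  by (simp_all add: degree_part_def)

lemma degree0_ring_simps [simp]:
  "carrier (degree0_ring A) = carrier (grp A 0)"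
  "mult (degree0_ring A) = mul A 0 0"
  "one (degree0_ring A) = unity A"
  "zero (degree0_ring A) = one (grp A 0)"
  "add (degree0_ring A) = mult (grp A 0)"
  by (simp_all add: degree0_ring_def)

lemma (in dg_ring) ring_degree0_ring: "ring (degree0_ring A)"
proof -
  interpret G: comm_group "grp A 0" by (rule grp_comm_group)
  show ?thesis
  proof (rule ringI)
    show "abelian_group (degree0_ring A)"
    proof (rule abelian_groupI)
      fix x assume "x \<in> carrier (degree0_ring A)"
      then show "\<exists>y\<in>carrier (degree0_ring A). y \<oplus>\<^bsub>degree0_ring A\<^esub> x = \<zero>\<^bsub>degree0_ring A\<^esub>"
        using G.l_inv_ex[of x] by auto
    qed (simp_all add: G.m_ac)
    show "Group.monoid (degree0_ring A)"
      by (rule monoidI)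
        (use mul_closed[of _ 0 _ 0] unity_closed mul_assoc[of _ 0 _ 0 _ 0] mul_unity_left[of _ 0]
          mul_unity_right[of _ 0] in simp_all)
  qed (use mul_add_left[of _ 0 _ _ 0] mul_add_right[of _ 0 _ 0] in simp_all)
qed

lemma right_module_degree_part:
  assumes X: "dg_module A X"
  shows "right_module (degree0_ring A) (degree_part X m)"
proof -
  interpret X: dg_module A X by fact
  interpret R: ring "degree0_ring A" by (rule X.A.ring_degree0_ring)
  interpret M: comm_group "degree_part X m"
    by (rule comm_group_surj_image[OF dg_module_group[OF X, of m], where p = "\<lambda>x. x"]) simp_all
  show ?thesis
    by unfold_locales
      (use X.act_closed[of _ m _ 0] X.act_add_left[of _ m _ _ 0] X.act_add_right[of _ m _ 0]
        X.act_assoc[of _ m _ 0 _ 0] X.act_unity[of _ m] in simp_all)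
qed

lemma degree_part_Hom:
  assumes "dg_module A X" and f: "f \<in> Hom (dgMod A) X Y"
  shows "f m \<in> Hom (RMod (degree0_ring A)) (degree_part X m) (degree_part Y m)"
  using dgMod_HomD(1-2,4-5)[OF f, where i = m] dgMod_HomD(4)[OF f, where i = m and j = 0]
  by (simp add: RMod_Hom_iff hom_def)

lemma embeds_degree_part:
  assumes "dgMod.embeds A X Y"
  shows "RMod.embeds (degree0_ring A) (degree_part X m) (degree_part Y m)"
proof -
  obtain f where f: "dg_module A X" "dg_module A Y" "f \<in> Hom (dgMod A) X Y"
    "\<And>i. inj_on (f i) (carrier (grp X i))"
    using assms unfolding dgMod.embeds_def by auto
  show ?thesis
    by (rule RMod.embedsI[OF _ _ degree_part_Hom[OF f(1,3)]])
      (simp_all add: f right_module_degree_part)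
qed

text \<open>Taking the part in degree m is an exact functor, because exactness of dg modules is a
  condition in each degree separately.\<close>

lemma exact_at_degree_part:
  assumes X: "dg_module A X" and Y: "dg_module A Y" and e: "dgMod.exact_at A X Y f Q q"
  shows "RMod.exact_at (degree0_ring A) (degree_part X m) (degree_part Y m) (f m) (degree_part Q m) (q m)"
  using e degree_part_Hom[OF Y, of q Q m]
  by (simp add: dgMod.exact_at_def RMod.exact_at_def right_module_degree_part)


section \<open>The dg modules \<open>D(M)\<close>\<close>

text \<open>For \<open>c = False\<close> the part in degree \<open>-1\<close> is dropped; this is a dg module exactly if
  \<open>d(A\<^sup>-\<^sup>1)\<close> annihilates \<open>M\<close>.\<close>

definition D_part :: "bool \<Rightarrow> 'a dg_ring \<Rightarrow> ('a, 'm) right_module \<Rightarrow> ('a, 'm) dg_module" where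
  "D_part c A M = (D A M)\<lparr>grp := \<lambda>i.
     \<lparr>carrier = (if i = 0 \<or> c \<and> i = -1 then carrier M else {\<one>\<^bsub>M\<^esub>}),
      mult = (\<lambda>x y. x \<otimes>\<^bsub>M\<^esub> y), one = \<one>\<^bsub>M\<^esub>\<rparr>\<rparr>"

text \<open>The disjunct \<open>c\<close> makes the condition void for the full D, so that all
  lemmas on \<open>D_part\<close> treat D and its top degree together.\<close>

definition D_admissible :: "bool \<Rightarrow> 'a dg_ring \<Rightarrow> ('a, 'm) right_module \<Rightarrow> bool" where
  "D_admissible c A M \<longleftrightarrow>
     c \<or> (\<forall>x \<in> carrier M. \<forall>a \<in> carrier (grp A (-1)). ract M x (diff A (-1) a) = \<one>\<^bsub>M\<^esub>)"

lemma D_part_True: "D_part True A M = D A M"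
  by (simp add: D_part_def D_def disj_commute)

lemma D_admissible_True [simp]: "D_admissible True A M"
  by (simp add: D_admissible_def)

lemma D_part_simps [simp]:
  "carrier (grp (D_part c A M) i) = (if i = 0 \<or> c \<and> i = -1 then carrier M else {\<one>\<^bsub>M\<^esub>})"
  "x \<otimes>\<^bsub>grp (D_part c A M) i\<^esub> y = x \<otimes>\<^bsub>M\<^esub> y"
  "\<one>\<^bsub>grp (D_part c A M) i\<^esub> = \<one>\<^bsub>M\<^esub>"
  "diff (D_part c A M) i x = (if i = -1 then x else \<one>\<^bsub>M\<^esub>)"
  "act (D_part c A M) i j x a = (if j = 0 then ract M x a
     else if j = -1 \<and> i = 0 then ract M x (diff A (-1) a) else \<one>\<^bsub>M\<^esub>)"
  by (simp_all add: D_part_def D_def)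

lemma comm_group_D_part:
  assumes "comm_group M"
  shows "comm_group (grp (D_part c A M) i)"
proof -
  interpret M: comm_group M by fact
  show ?thesis
    by (rule comm_groupI) (auto simp: M.m_ac split: if_splits intro: M.l_inv_ex)
qed

text \<open>\<open>signed\<close> refers to the inverse of the group in degree i. Inverses there are
  also inverses in M, so by uniqueness all signs can be computed in M.\<close>

lemma signed_D_part:
  assumes M: "comm_group M" and x: "x \<in> carrier (grp (D_part c A M) i)"
  shows "signed (grp (D_part c A M) i) n x = signed M n x"
proof -
  interpret M: comm_group M by fact
  interpret G: comm_group "grp (D_part c A M) i" by (rule comm_group_D_part[OF M])
  have xM: "x \<in> carrier M" using x by (simp split: if_splits)
  have "inv\<^bsub>grp (D_part c A M) i\<^esub> x = inv\<^bsub>M\<^esub> x"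
    using G.l_inv[OF x] G.inv_closed[OF x] M.inv_equality[of "inv\<^bsub>grp (D_part c A M) i\<^esub> x" x] xM
    by (simp split: if_splits)
  then show ?thesis by (simp add: signed_def)
qed

section \<open>The functor M |-> \<open>D_part c A M\<close> over a non-positive dg ring\<close>

locale nonpositive_dg_ring = dg_ring A for A :: "'a dg_ring" +
  assumes non_positive: "non_positive_dg A"
begin

abbreviation R0 :: "'a ring" where "R0 \<equiv> degree0_ring A"

lemma positive_degree: "\<lbrakk>a \<in> carrier (grp A j); j > 0\<rbrakk> \<Longrightarrow> a = \<one>\<^bsub>grp A j\<^esub>"
  using non_positive by (auto simp: non_positive_dg_def)

lemma diff_closed: "a \<in> carrier (grp A j) \<Longrightarrow> diff A j a \<in> carrier (grp A (j + 1))"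
  using diff_hom by (auto simp: hom_def)

lemma diff_group_hom: "group_hom (grp A j) (grp A (j + 1)) (diff A j)"
  using comm_group_homD[OF grp_comm_group grp_comm_group diff_hom] .

lemma one_closed: "\<one>\<^bsub>grp A j\<^esub> \<in> carrier (grp A j)"
  using grp_comm_group[of j] by (simp add: comm_group_def comm_monoid_def monoid.one_closed)

lemma mul_one_left:
  assumes "b \<in> carrier (grp A j)"
  shows "mul A i j \<one>\<^bsub>grp A i\<^esub> b = \<one>\<^bsub>grp A (i + j)\<^esub>"
proof -
  have "(\<lambda>a. mul A i j a b) \<in> hom (grp A i) (grp A (i + j))"
    using assms by (auto simp: hom_def mul_closed mul_add_left)
  then show ?thesis
    using comm_group_homD[OF grp_comm_group grp_comm_group] group_hom.hom_one by blast
qed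

lemma mul_one_right:
  assumes "a \<in> carrier (grp A i)"
  shows "mul A i j a \<one>\<^bsub>grp A j\<^esub> = \<one>\<^bsub>grp A (i + j)\<^esub>"
proof -
  have "(\<lambda>b. mul A i j a b) \<in> hom (grp A j) (grp A (i + j))"
    using assms by (auto simp: hom_def mul_closed mul_add_right)
  then show ?thesis
    using comm_group_homD[OF grp_comm_group grp_comm_group] group_hom.hom_one by blast
qed

text \<open>Only A^0 and A^{-1} act nontrivially, so each axiom reduces to a few degrees.
  Admissibility enters through closure (\<open>actc\<close>): for \<open>c = False\<close> the
  product x d(a) would lie in the missing degree -1 and therefore has to vanish.\<close>

lemma dg_module_D_part:
  assumes M: "right_module R0 M" and c: "D_admissible c A M"
  shows "dg_module A (D_part c A M)"
proof -
  interpret M: right_module R0 M by fact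
  let ?X = "D_part c A M"
  note rc = M.ract_closed[simplified]
  have one_r: "ract M \<one>\<^bsub>M\<^esub> a = \<one>\<^bsub>M\<^esub>" if "a \<in> carrier (grp A 0)" for a
    using M.ract_add_left[of "\<one>\<^bsub>M\<^esub>" "\<one>\<^bsub>M\<^esub>" a] rc[of "\<one>\<^bsub>M\<^esub>" a] that by simp
  have r_one: "ract M x \<one>\<^bsub>grp A 0\<^esub> = \<one>\<^bsub>M\<^esub>" if "x \<in> carrier M" for x
    using M.ract_add_right[of x "\<one>\<^bsub>grp A 0\<^esub>" "\<one>\<^bsub>grp A 0\<^esub>"] rc[of x "\<one>\<^bsub>grp A 0\<^esub>"] that
      one_closed[of 0] comm_group_is_group[OF grp_comm_group[of 0]]
    by (simp add: group.is_monoid monoid.l_one)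
  have d1: "diff A (-1) a \<in> carrier (grp A 0)" if "a \<in> carrier (grp A (-1))" for a
    using diff_closed[OF that] by simp
  have dhom: "diff A (-1) (a \<otimes>\<^bsub>grp A (-1)\<^esub> b) = diff A (-1) a \<otimes>\<^bsub>grp A 0\<^esub> diff A (-1) b"
    if "a \<in> carrier (grp A (-1))" "b \<in> carrier (grp A (-1))" for a b
    using diff_hom[of "-1"] that by (auto simp: hom_def)
  have done1: "diff A j \<one>\<^bsub>grp A j\<^esub> = \<one>\<^bsub>grp A (j + 1)\<^esub>" for j
    by (rule group_hom.hom_one[OF diff_group_hom])
  have ann: "ract M x (diff A (-1) a) = \<one>\<^bsub>M\<^esub>" if "\<not> c" "x \<in> carrier M" "a \<in> carrier (grp A (-1))" for x a
    using c that by (auto simp: D_admissible_def)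
  have sub: "x \<in> carrier M" if "x \<in> carrier (grp ?X i)" for x i
    using that by (simp split: if_splits)
  have act1: "act ?X i j \<one>\<^bsub>M\<^esub> a = \<one>\<^bsub>M\<^esub>" if "a \<in> carrier (grp A j)" for i j a
    using that by (auto simp: one_r d1)
  have act2: "act ?X i j x a = \<one>\<^bsub>M\<^esub>" if x: "x \<in> carrier (grp ?X i)" and a: "a = \<one>\<^bsub>grp A j\<^esub>" for i j x a
    using sub[OF x] done1[of "-1"] by (auto simp: a r_one)
  have act3: "act ?X i j x a = \<one>\<^bsub>M\<^esub>" if "x \<in> carrier (grp ?X i)" "a \<in> carrier (grp A j)" "j > 0" for i j x a
    using act2[OF that(1) positive_degree[OF that(2,3)]] .
  have actc: "act ?X i j x a \<in> carrier (grp ?X (i + j))"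
    if "x \<in> carrier (grp ?X i)" "a \<in> carrier (grp A j)" for i j x a
    using that by (auto simp: rc one_r d1 ann split: if_splits)
  show ?thesis
  proof (intro dg_module.intro cochain_complex.intro dg_module_axioms.intro)
    show "dg_ring A" by unfold_locales
    show "comm_group (grp ?X i)" for i by (rule comm_group_D_part[OF M.comm_group_axioms])
    show "diff ?X i \<in> hom (grp ?X i) (grp ?X (i + 1))" for i
      by (auto simp: hom_def split: if_splits)
  next
    fix i x assume x: "x \<in> carrier (grp ?X i)"
    note xM = sub[OF x]
    show "diff ?X (i + 1) (diff ?X i x) = \<one>\<^bsub>grp ?X (i + 1 + 1)\<^esub>" by simp
    show "act ?X i 0 x (unity A) = x" using M.ract_one[OF xM] by simp
    fix j a assume a: "a \<in> carrier (grp A j)"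
    show "act ?X i j x a \<in> carrier (grp ?X (i + j))" by (rule actc[OF x a])
    show "act ?X i j (x \<otimes>\<^bsub>grp ?X i\<^esub> y) a = act ?X i j x a \<otimes>\<^bsub>grp ?X (i + j)\<^esub> act ?X i j y a"
      if "y \<in> carrier (grp ?X i)" for y
      using xM sub[OF that] a by (auto simp: M.ract_add_left d1)
    show "act ?X i j x (a \<otimes>\<^bsub>grp A j\<^esub> b) = act ?X i j x a \<otimes>\<^bsub>grp ?X (i + j)\<^esub> act ?X i j x b"
      if "b \<in> carrier (grp A j)" for b
      using xM a that M.ract_add_right[of x] by (auto simp: d1 dhom)
    show "act ?X (i + j) k (act ?X i j x a) b = act ?X i (j + k) x (mul A j k a b)"
      if b: "b \<in> carrier (grp A k)" for k b
    proof -
      consider "j > 0" | "k > 0" | "j \<le> 0" "k \<le> 0" "x = \<one>\<^bsub>M\<^esub>" | "j \<le> 0" "k \<le> 0" "i = 0"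
        | "j \<le> 0" "k \<le> 0" "i = -1"
        using x by (fastforce split: if_splits)
      then show ?thesis
      proof cases
        case 1
        then show ?thesis
          using act3[OF x a] act1[OF b] act2[OF x, of _ "j + k"] positive_degree[OF a] mul_one_left[OF b]
          by (simp del: D_part_simps)
      next
        case 2
        then show ?thesis
          using act3[OF actc[OF x a] b] act2[OF x, of _ "j + k"] positive_degree[OF b] mul_one_right[OF a]
          by (simp del: D_part_simps)
      next
        case 3
        then show ?thesis using act1 a b mul_closed by (simp del: D_part_simps)
      next
        case 4
        \<comment> \<open>Since A^1 = 0, d kills A^0 and one Leibniz term drops out. This and its
          mirror image below are the bilinearity of d : A^{-1} -> A^0.\<close>
        have "diff A (-1) (mul A 0 (-1) a b) = mul A 0 0 a (diff A (-1) b)"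
          if "a \<in> carrier (grp A 0)" "b \<in> carrier (grp A (-1))"
        proof -
          have "diff A 0 a = \<one>\<^bsub>grp A 1\<^esub>" using positive_degree[OF diff_closed[OF that(1)]] by simp
          moreover have "mul A 0 0 a (diff A (-1) b) \<in> carrier (grp A 0)"
            using mul_closed[of a 0 "diff A (-1) b" 0] d1 that by simp
          ultimately show ?thesis
            using mul_leibniz[OF that] mul_one_left[OF that(2), of 1] comm_group_is_group[OF grp_comm_group[of 0]]
            by (simp add: signed_even group.is_monoid monoid.l_one)
        qed
        moreover have "diff A (-1) (mul A (-1) 0 a b) = mul A 0 0 (diff A (-1) a) b"
          if "a \<in> carrier (grp A (-1))" "b \<in> carrier (grp A 0)"
        proof -
          have "diff A 0 b = \<one>\<^bsub>grp A 1\<^esub>" using positive_degree[OF diff_closed[OF that(2)]] by simp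
          moreover have "mul A 0 0 (diff A (-1) a) b \<in> carrier (grp A 0)"
            using mul_closed[of "diff A (-1) a" 0 b 0] d1 that by simp
          ultimately show ?thesis
            using mul_leibniz[OF that] mul_one_right[OF that(1), of 1] comm_group_is_group[OF grp_comm_group[of 0]]
            by (simp add: group.signed_one group.is_monoid monoid.r_one)
        qed
        ultimately show ?thesis
          using 4 a b xM M.ract_assoc[of x] d1
          by (auto simp: one_r rc)
      next
        case 5
        then show ?thesis
          using a b xM M.ract_assoc[of x] by (auto simp: one_r)
      qed
    qed
    show "diff ?X (i + j) (act ?X i j x a) =
        act ?X (i + 1) j (diff ?X i x) a \<otimes>\<^bsub>grp ?X (i + j + 1)\<^esub>
        signed (grp ?X (i + j + 1)) i (act ?X i (j + 1) x (diff A j a))"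
    proof -
      let ?u = "act ?X i (j + 1) x (diff A j a)"
      note da = diff_closed[OF a]
      have uc: "?u \<in> carrier (grp ?X (i + j + 1))" using actc[OF x da] by (simp only: add.assoc)
      note s = signed_D_part[OF M.comm_group_axioms uc]
      have dx: "diff ?X i x \<in> carrier (grp ?X (i + 1))" using x by (auto split: if_splits)
      \<comment> \<open>The cases with content have j < 0. For j = -1 and i = 0 both sides are x
        d(a); for i = j = -1 the two terms on the right are both x d(a) up to sign and cancel
        through (-1)^i; for j = -2 the last term contains d(d(a)) = 0.\<close>
      consider "j > 0" | "j = 0" | "x = \<one>\<^bsub>M\<^esub>" | "j = -1" "i = 0" | "j = -1" "i = -1" | "j = -2" | "j < -2"
        using x by (fastforce split: if_splits)
      then show ?thesis
      proof cases
        case 1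
        then show ?thesis
          unfolding s using act3[OF x a] act3[OF dx a] act3[OF x da] by (simp add: M.signed_one del: D_part_simps(5))
      next
        case 2
        then have "?u = \<one>\<^bsub>M\<^esub>" using act3[OF x da] by simp
        then show ?thesis
          unfolding s using 2 a xM by (simp add: M.signed_one one_r rc del: D_part_simps(5)) (simp add: one_r rc)
      next
        case 3
        have "diff ?X i x = \<one>\<^bsub>M\<^esub>" using 3 by simp
        then show ?thesis
          unfolding s using 3 act1 a da by (simp add: M.signed_one del: D_part_simps(5))
      next
        case 4
        then show ?thesis unfolding s using a xM d1 by (simp add: signed_even rc one_r)
      next
        case 5
        then show ?thesis unfolding s using a xM d1 by (simp add: signed_def rc)
      next
        case 6
        have "diff A (-1) (diff A (-2) a) = \<one>\<^bsub>grp A 0\<^esub>" using diff_diff[of a "-2"] a 6 by simp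
        then show ?thesis unfolding s using 6 a xM by (simp add: M.signed_one r_one)
      next
        case 7
        then show ?thesis unfolding s by (simp add: M.signed_one)
      qed
    qed
  qed
qed

lemma D_part_Hom:
  assumes M: "right_module R0 M" "D_admissible c A M" and N: "right_module R0 N" "D_admissible c A N"
    and f: "f \<in> Hom (RMod R0) M N"
  shows "(\<lambda>i. restrict f (carrier (grp (D_part c A M) i))) \<in> Hom (dgMod A) (D_part c A M) (D_part c A N)"
proof -
  interpret f: group_hom M N f
    by (rule comm_group_homD) (use M N right_module_comm_group RMod_HomD(5)[OF f] in auto)
  have d1: "diff A (-1) a \<in> carrier (grp A 0)" if "a \<in> carrier (grp A (-1))" for a
    using diff_closed[OF that] by simp
  show ?thesis
    by (rule dgMod_HomI[OF dg_module_D_part[OF M]])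
      (use RMod_HomD(3)[OF f] d1 in \<open>auto split: if_splits\<close>)
qed

text \<open>Admissibility passes to submodules: f(x d(a)) = f(x) d(a) = 0, and \<open>f\<close> is
  injective.\<close>

lemma embeds_D_part:
  assumes "RMod.embeds R0 M N" and "D_admissible c A N"
  shows "D_admissible c A M" and "dgMod.embeds A (D_part c A M) (D_part c A N)"
proof -
  obtain f where f: "right_module R0 M" "right_module R0 N" "f \<in> Hom (RMod R0) M N" "inj_on f (carrier M)"
    using assms(1) unfolding RMod.embeds_def by auto
  interpret M: right_module R0 M by (rule f(1))
  interpret f: group_hom M N f
    by (rule comm_group_homD) (use f(1,2) right_module_comm_group RMod_HomD(5)[OF f(3)] in auto)
  show adm: "D_admissible c A M"
    unfolding D_admissible_def
  proof (intro disjCI ballI)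
    fix x a assume nc: "\<not> (\<forall>x\<in>carrier M. \<forall>a\<in>carrier (grp A (- 1)). ract M x (diff A (- 1) a) = \<one>\<^bsub>M\<^esub>)"
    show c
    proof (rule ccontr)
      assume "\<not> c"
      have "ract M x (diff A (-1) a) = \<one>\<^bsub>M\<^esub>" if "x \<in> carrier M" "a \<in> carrier (grp A (-1))" for x a
      proof -
        have da: "diff A (-1) a \<in> carrier (grp A 0)" using diff_closed[OF that(2)] by simp
        have "f (ract M x (diff A (-1) a)) = \<one>\<^bsub>N\<^esub>"
          using RMod_HomD(3)[OF f(3), of x] da that assms(2) \<open>\<not> c\<close> by (simp add: D_admissible_def)
        then show ?thesis
          using f(4) M.ract_closed[of x] that da by (metis degree0_ring_simps(1) f.hom_one inj_onD M.one_closed)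
      qed
      then show False using nc by blast
    qed
  qed
  show "dgMod.embeds A (D_part c A M) (D_part c A N)"
  proof (rule dgMod.embedsI[OF _ _ D_part_Hom[OF f(1) adm f(2) assms(2) f(3)]])
    show "inj_on (restrict f (carrier (grp (D_part c A M) i))) (carrier (grp (D_part c A M) i))" for i
      using f(4) by (auto simp: inj_on_def)
  qed (simp_all add: dg_module_D_part f assms(2) adm)
qed

end


section \<open>Exactness of D, and monoform objects and atoms under D and under the top
  degree\<close>

context nonpositive_dg_ring
begin

text \<open>In each degree the sequence is either the given one or consists of zero groups.
  Admissibility descends to Q because every element of Q comes from H.\<close>

lemma exact_at_D_part:
  assumes L: "right_module R0 L" "D_admissible c A L" and H: "right_module R0 H" "D_admissible c A H"
    and l: "l \<in> Hom (RMod R0) L H" and e: "RMod.exact_at R0 L H l Q q"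
  shows "D_admissible c A Q"
    and "dgMod.exact_at A (D_part c A L) (D_part c A H)
      (\<lambda>i. restrict l (carrier (grp (D_part c A L) i))) (D_part c A Q)
      (\<lambda>i. restrict q (carrier (grp (D_part c A H) i)))"
proof -
  have Q: "right_module R0 Q" "q \<in> Hom (RMod R0) H Q" "q ` carrier H = carrier Q"
    "{y \<in> carrier H. q y = \<one>\<^bsub>Q\<^esub>} = l ` carrier L"
    using e by (auto simp: RMod.exact_at_def)
  have qh: "group_hom H Q q"
    by (rule comm_group_homD[OF right_module_comm_group[OF H(1)] right_module_comm_group[OF Q(1)]
        RMod_HomD(5)[OF Q(2)]])
  have lh: "group_hom L H l"
    by (rule comm_group_homD[OF right_module_comm_group[OF L(1)] right_module_comm_group[OF H(1)]
        RMod_HomD(5)[OF l]])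
  show adm: "D_admissible c A Q"
  proof (cases c)
    case False
    have "ract Q x (diff A (-1) a) = \<one>\<^bsub>Q\<^esub>" if x: "x \<in> carrier Q" and a: "a \<in> carrier (grp A (-1))" for x a
    proof -
      obtain y where y: "y \<in> carrier H" "x = q y" using Q(3) x by blast
      have "diff A (-1) a \<in> carrier (grp A 0)" using diff_closed[OF a] by simp
      then have "ract Q x (diff A (-1) a) = q (ract H y (diff A (-1) a))"
        using RMod_HomD(3)[OF Q(2)] y by simp
      then show ?thesis using H(2) False y a group_hom.hom_one[OF qh] by (simp add: D_admissible_def)
    qed
    then show ?thesis by (simp add: D_admissible_def)
  qed simp
  have "dg_module A (D_part c A Q)" by (rule dg_module_D_part[OF Q(1) adm])
  moreover have "(\<lambda>i. restrict q (carrier (grp (D_part c A H) i)))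
      \<in> Hom (dgMod A) (D_part c A H) (D_part c A Q)"
    by (rule D_part_Hom[OF H Q(1) adm Q(2)])
  moreover have "restrict q (carrier (grp (D_part c A H) i)) ` carrier (grp (D_part c A H) i) =
      carrier (grp (D_part c A Q) i)" for i
    using Q(3) group_hom.hom_one[OF qh] by auto
  moreover have "{y \<in> carrier (grp (D_part c A H) i).
      restrict q (carrier (grp (D_part c A H) i)) y = \<one>\<^bsub>grp (D_part c A Q) i\<^esub>} =
      restrict l (carrier (grp (D_part c A L) i)) ` carrier (grp (D_part c A L) i)" for i
    using Q(4) group_hom.hom_one[OF lh] group_hom.hom_one[OF qh] by auto
  ultimately show "dgMod.exact_at A (D_part c A L) (D_part c A H)
      (\<lambda>i. restrict l (carrier (grp (D_part c A L) i))) (D_part c A Q)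
      (\<lambda>i. restrict q (carrier (grp (D_part c A H) i)))"
    unfolding dgMod.exact_at_def by simp
qed

lemma exact_at_shift:
  assumes Y: "dg_module A Y" and e: "dgMod.exact_at A X Y f Q q"
  shows "dgMod.exact_at A (shift n X) (shift n Y) (\<lambda>i. f (n + i)) (shift n Q) (\<lambda>i. q (n + i))"
  using e shift_Hom[OF Y, of Q q n] by (simp add: dgMod.exact_at_def dg_module_shift)

lemma trivial_shift_D_part:
  "dgMod.trivial (shift n (D_part c A M)) \<longleftrightarrow> RMod.trivial M"
proof
  assume "dgMod.trivial (shift n (D_part c A M))"
  then have "carrier (grp (shift n (D_part c A M)) (-n)) = {\<one>\<^bsub>grp (shift n (D_part c A M)) (-n)\<^esub>}"
    unfolding dgMod.trivial_def by blast
  then show "RMod.trivial M" by (simp add: RMod_trivial_iff)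
qed (simp add: dgMod.trivial_def RMod_trivial_iff)

text \<open>The exact functor M |-> \<open>shift n (D_part c A M)\<close> preserves embeddings and
  reflects triviality, so it would carry a violation of monoformness in H to one in the dg module.
  Keeping \<open>c\<close> general covers the top degree alone as well as D.\<close>

lemma monoform_of_D_part:
  assumes H: "right_module R0 H" "D_admissible c A H"
    and m: "monoform (dgMod A) (shift n (D_part c A H))"
  shows "monoform (RMod R0) H"
  unfolding RMod.monoform_iff
proof (intro conjI allI impI)
  show "H \<in> Obj (RMod R0)" using H by simp
  show "\<not> RMod.trivial H"
    using dgMod.monoform_nontrivial[OF m] by (simp add: trivial_shift_D_part)
  fix L l Q q N
  assume a: "L \<in> Obj (RMod R0) \<and> l \<in> Hom (RMod R0) L H \<and> (\<forall>i::unit. inj_on l (carrier L)) \<and>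
    \<not> RMod.trivial L \<and> RMod.exact_at R0 L H l Q q \<and> RMod.embeds R0 N H \<and> RMod.embeds R0 N Q"
  then have L: "right_module R0 L" "l \<in> Hom (RMod R0) L H" "inj_on l (carrier L)"
    and e: "RMod.exact_at R0 L H l Q q" and N: "RMod.embeds R0 N H" "RMod.embeds R0 N Q" by auto
  have "RMod.embeds R0 L H" by (rule RMod.embedsI) (use L H in auto)
  then have cL: "D_admissible c A L" using embeds_D_part(1) H(2) by blast
  have cQ: "D_admissible c A Q" by (rule exact_at_D_part(1)[OF L(1) cL H L(2) e])
  let ?E = "\<lambda>M. shift n (D_part c A M)"
  let ?l = "\<lambda>i. restrict l (carrier (grp (D_part c A L) (n + i)))"
  let ?q = "\<lambda>i. restrict q (carrier (grp (D_part c A H) (n + i)))"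
  have dL: "dg_module A (D_part c A L)" and dH: "dg_module A (D_part c A H)"
    by (simp_all add: dg_module_D_part L(1) cL H)
  have "?l \<in> Hom (dgMod A) (?E L) (?E H)"
    by (rule shift_Hom[OF dL dH D_part_Hom[OF L(1) cL H L(2)]])
  moreover have "inj_on (?l i) (carrier (grp (?E L) i))" for i
    using L(3) by (auto simp: inj_on_def)
  moreover have "dgMod.exact_at A (?E L) (?E H) ?l (?E Q) ?q"
    by (rule exact_at_shift[OF dH exact_at_D_part(2)[OF L(1) cL H L(2) e]])
  moreover have "dgMod.embeds A (?E N) (?E H)" "dgMod.embeds A (?E N) (?E Q)"
    using embeds_shift embeds_D_part(2) N H(2) cQ by blast+
  moreover have "?E L \<in> Obj (dgMod A)" using dL by (simp add: dg_module_shift)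
  moreover have "\<not> dgMod.trivial (?E L)" using a by (simp add: trivial_shift_D_part)
  ultimately have "dgMod.trivial (?E N)"
    using m unfolding dgMod.monoform_iff by blast
  then show "RMod.trivial N" by (simp add: trivial_shift_D_part)
qed

text \<open>Degree n + (-n) = 0 of D stores M unchanged. Having an equality and no mere isomorphism,
  facts about the part in degree -n can be read directly as facts about M.\<close>

lemma degree_part_shift_D: "degree_part (shift n (D A M)) (-n) = M"
  by (rule right_module.equality) (simp_all add: fun_eq_iff flip: D_part_True)

lemma dg_module_shift_D: "right_module R0 M \<Longrightarrow> dg_module A (shift n (D A M))"
  using dg_module_shift dg_module_D_part[of M True] by (simp add: D_part_True)

text \<open>In D(M)[n] the differential from degree -n-1 to degree -n is the identity up to sign. A
  subobject that vanishes in degree -n therefore vanishes in degree -n-1 too, and no other degree is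
  left.\<close>

lemma nontrivial_degree_part:
  assumes N: "dgMod.embeds A N (shift n (D A M))" "\<not> dgMod.trivial N" and M: "right_module R0 M"
  shows "\<not> RMod.trivial (degree_part N (-n))"
proof
  assume t: "RMod.trivial (degree_part N (-n))"
  let ?E = "shift n (D_part True A M)"
  obtain f where f: "dg_module A N" "dg_module A ?E" "f \<in> Hom (dgMod A) N ?E"
    "\<And>i. inj_on (f i) (carrier (grp N i))"
    using N(1) unfolding dgMod.embeds_def by (auto simp: D_part_True)
  have f1: "f i \<one>\<^bsub>grp N i\<^esub> = \<one>\<^bsub>M\<^esub>" for i
    using group_hom.hom_one[OF dgMod_Hom_group_hom[OF f(1-3), of i]] by simp
  have "dgMod.trivial N"
  proof (rule dgMod.trivialI)
    fix i x assume x: "x \<in> carrier (grp N i)"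
    have one: "\<one>\<^bsub>grp N i\<^esub> \<in> carrier (grp N i)" by (rule dg_module_one_closed[OF f(1)])
    have fx: "f i x \<in> carrier (grp ?E i)" using dgMod_HomD(1)[OF f(3) x] .
    consider "i = -n" | "i = -n - 1" | "i \<noteq> -n" "i \<noteq> -n - 1" by blast
    then show "x = \<one>\<^bsub>grp N i\<^esub>"
    proof cases
      case 1
      then show ?thesis using t x by (simp add: RMod_trivial_iff)
    next
      case 2
      have "diff N i x \<in> carrier (grp N (-n))" using dg_module_diff_closed[OF f(1) x] 2 by simp
      then have "diff N i x = \<one>\<^bsub>grp N (i + 1)\<^esub>" using t 2 by (simp add: RMod_trivial_iff)
      then have "diff ?E i (f i x) = \<one>\<^bsub>M\<^esub>" using dgMod_HomD(3)[OF f(3) x] f1 by metis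
      then have "signed (grp (D_part True A M) 0) n (f i x) = \<one>\<^bsub>M\<^esub>" using 2 by simp
      moreover have "f i x \<in> carrier M" using fx 2 by simp
      ultimately have "f i x = \<one>\<^bsub>M\<^esub>"
        using signed_D_part[of M "f i x" True A 0 n] right_module_comm_group[OF M]
        by (simp add: group.signed_eq_one_iff comm_group_is_group)
      then show ?thesis using f(4) x one f1 by (metis inj_onD)
    next
      case 3
      then have "n + i \<noteq> 0" "n + i \<noteq> -1" by auto
      then have "f i x = \<one>\<^bsub>M\<^esub>" using fx by simp
      then show ?thesis using f(4) x one f1 by (metis inj_onD)
    qed
  qed (use f(1) in simp)
  then show False using N(2) by blast
qed

text \<open>The part in degree -n turns L, N and the quotient into data for H. By
  \<open>nontrivial_degree_part\<close> it kills no nonzero subobject, which keeps L nonzero and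
  brings triviality back from that part to N.\<close>

lemma monoform_D:
  assumes m: "monoform (RMod R0) H"
  shows "monoform (dgMod A) (shift n (D A H))"
  unfolding dgMod.monoform_iff
proof (intro conjI allI impI)
  have H: "right_module R0 H" using RMod.monoform_Obj[OF m] by simp
  let ?E = "shift n (D A H)"
  show E: "?E \<in> Obj (dgMod A)" using dg_module_shift_D[OF H] by simp
  show "\<not> dgMod.trivial ?E"
    using RMod.monoform_nontrivial[OF m] trivial_shift_D_part[of n True H] by (simp add: D_part_True)
  fix L l Q q N
  assume a: "L \<in> Obj (dgMod A) \<and> l \<in> Hom (dgMod A) L ?E \<and> (\<forall>i. inj_on (l i) (carrier (grp L i))) \<and>
    \<not> dgMod.trivial L \<and> dgMod.exact_at A L ?E l Q q \<and> dgMod.embeds A N ?E \<and> dgMod.embeds A N Q"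
  then have L: "dg_module A L" "l \<in> Hom (dgMod A) L ?E" "\<And>i. inj_on (l i) (carrier (grp L i))" by auto
  let ?V = "\<lambda>X. degree_part X (-n)"
  have eL: "dgMod.embeds A L ?E" by (rule dgMod.embedsI) (use L E in auto)
  have "RMod.exact_at R0 (?V L) (?V ?E) (l (-n)) (?V Q) (q (-n))"
    by (rule exact_at_degree_part) (use a E in auto)
  moreover have "RMod.embeds R0 (?V N) (?V ?E)" "RMod.embeds R0 (?V N) (?V Q)"
    using a embeds_degree_part by blast+
  moreover have "l (-n) \<in> Hom (RMod R0) (?V L) (?V ?E)" by (rule degree_part_Hom[OF L(1,2)])
  moreover have "?V L \<in> Obj (RMod R0)" using right_module_degree_part[OF L(1)] by simp
  moreover have "\<not> RMod.trivial (?V L)" by (rule nontrivial_degree_part[OF eL _ H]) (use a in blast)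
  ultimately have "RMod.trivial (?V N)"
    using m L(3)[of "-n"] unfolding degree_part_shift_D RMod.monoform_iff by (metis degree_part_simps(1))
  then show "dgMod.trivial N" using nontrivial_degree_part[OF _ _ H] a by blast
qed

text \<open>The top degree of a common subobject reveals the shift: it is nonzero in degree -n,
  while D(K)[k] vanishes above degree -k. By symmetry n = k, and the part in degree -n is then a
  common subobject of H and K.\<close>

lemma atom_D_eq_iff:
  assumes H: "monoform (RMod R0) H" and K: "monoform (RMod R0) K"
  shows "atom (dgMod A) (shift n (D A H)) = atom (dgMod A) (shift k (D A K)) \<longleftrightarrow>
    n = k \<and> atom (RMod R0) H = atom (RMod R0) K"
proof
  have mH: "right_module R0 H" and mK: "right_module R0 K"
    using RMod.monoform_Obj[OF H] RMod.monoform_Obj[OF K] by auto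
  {
    assume "atom (dgMod A) (shift n (D A H)) = atom (dgMod A) (shift k (D A K))"
    then obtain N where N: "\<not> dgMod.trivial N" "dgMod.embeds A N (shift n (D A H))"
      "dgMod.embeds A N (shift k (D A K))"
      unfolding dgMod.atom_eq_iff[OF monoform_D[OF H] monoform_D[OF K]]
        dgMod.common_nonzero_subobject_iff by blast
    have top: "\<not> -j < -i" if e: "dgMod.embeds A N (shift i (D A M))" "dgMod.embeds A N (shift j (D A M'))"
      "right_module R0 M" "right_module R0 M'" for i j M M'
    proof
      assume less: "-j < -i"
      have "RMod.embeds R0 (degree_part N (-i)) (degree_part (shift j (D_part True A M')) (-i))"
        using embeds_degree_part[OF e(2)] by (simp add: D_part_True)
      moreover have "RMod.trivial (degree_part (shift j (D_part True A M')) (-i))"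
        using less by (simp add: RMod_trivial_iff)
      ultimately have "RMod.trivial (degree_part N (-i))" by (rule RMod.embeds_trivial)
      then show False using nontrivial_degree_part[OF e(1) N(1) e(3)] by blast
    qed
    have nk: "n = k" using top[OF N(2,3) mH mK] top[OF N(3,2) mK mH] by linarith
    have "RMod.embeds R0 (degree_part N (-n)) H" "RMod.embeds R0 (degree_part N (-n)) K"
      using embeds_degree_part[OF N(2), of "-n"] embeds_degree_part[OF N(3), of "-n"] nk
      by (simp_all add: degree_part_shift_D)
    then have "atom (RMod R0) H = atom (RMod R0) K"
      using RMod.atom_eqI[OF H K nontrivial_degree_part[OF N(2,1) mH]] by blast
    then show "n = k \<and> atom (RMod R0) H = atom (RMod R0) K" using nk by blast
  next
    assume "n = k \<and> atom (RMod R0) H = atom (RMod R0) K"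
    then obtain N where N: "n = k" "\<not> RMod.trivial N" "RMod.embeds R0 N H" "RMod.embeds R0 N K"
      unfolding RMod.atom_eq_iff[OF H K] RMod.common_nonzero_subobject_iff by blast
    have "\<not> dgMod.trivial (shift n (D A N))"
      using N(2) trivial_shift_D_part[of n True N] by (simp add: D_part_True)
    moreover have "dgMod.embeds A (shift n (D A N)) (shift n (D A H))"
      "dgMod.embeds A (shift n (D A N)) (shift k (D A K))"
      using embeds_shift[OF embeds_D_part(2)[OF N(3), of True]]
        embeds_shift[OF embeds_D_part(2)[OF N(4), of True]] N(1) by (simp_all add: D_part_True)
    ultimately show "atom (dgMod A) (shift n (D A H)) = atom (dgMod A) (shift k (D A K))"
      using dgMod.atom_eqI[OF monoform_D[OF H] monoform_D[OF K]] by blast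
  }
qed

text \<open>For \<open>c = False\<close> the inclusion of the top degree respects the differential,
  which is zero there, and the action of A^{-1}, because x d(a) = 0 by admissibility. This is how a
  module concentrated in one degree gets the atom of some D(M)[n].\<close>

lemma embeds_D_part_D:
  assumes M: "right_module R0 M" "D_admissible c A M"
  shows "dgMod.embeds A (D_part c A M) (D A M)"
proof -
  interpret M: right_module R0 M by (rule M(1))
  have "(\<lambda>i. restrict (\<lambda>x. x) (carrier (grp (D_part c A M) i))) \<in> Hom (dgMod A) (D_part c A M) (D_part True A M)"
    by (rule dgMod_HomI[OF dg_module_D_part[OF M]]) (auto split: if_splits)
  then show ?thesis unfolding D_part_True
    using dg_module_D_part[OF M] dg_module_D_part[OF M(1), of True]
    by (intro dgMod.embedsI) (auto simp: inj_on_def D_part_True)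
qed

end


section \<open>Every nonzero dg module contains a shift of some \<open>D(M)\<close> or its top part\<close>

definition neg_annihilated :: "'a dg_ring \<Rightarrow> ('a, 'm) dg_module \<Rightarrow> int \<Rightarrow> 'm set" where
  "neg_annihilated A X m =
     {y \<in> carrier (grp X m). \<forall>j<0. \<forall>a \<in> carrier (grp A j). act X m j y a = \<one>\<^bsub>grp X (m + j)\<^esub>}"

context nonpositive_dg_ring
begin

text \<open>Boundedness: multiply a nonzero element into the lowest degree that it reaches.\<close>

lemma neg_annihilated_nontrivial:
  assumes b: "bounded_dg A" and X: "dg_module A X" and nt: "\<not> dgMod.trivial X"
  obtains m y where "y \<in> neg_annihilated A X m" "y \<noteq> \<one>\<^bsub>grp X m\<^esub>"
proof -
  interpret X: dg_module A X by (rule X)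
  obtain p x where x: "x \<in> carrier (grp X p)" "x \<noteq> \<one>\<^bsub>grp X p\<^esub>"
    using nt dgMod.trivialI[of X A] X by auto
  obtain B where B: "\<And>n. \<bar>n\<bar> > B \<Longrightarrow> carrier (grp A n) = {\<one>\<^bsub>grp A n\<^esub>}"
    using b unfolding bounded_dg_def by blast
  \<comment> \<open>The offset \<open>k = 0\<close> qualifies through the unit, and boundedness caps
    the offsets, so a greatest one exists.\<close>
  let ?P = "\<lambda>k::nat. \<exists>a \<in> carrier (grp A (- int k)). act X p (- int k) x a \<noteq> \<one>\<^bsub>grp X (p - int k)\<^esub>"
  have P0: "?P 0" using x X.act_unity[OF x(1)] unity_closed by (auto intro!: bexI[of _ "unity A"])
  have bound: "k \<le> nat B" if "?P k" for k
  proof (rule ccontr)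
    assume "\<not> k \<le> nat B"
    then have "carrier (grp A (- int k)) = {\<one>\<^bsub>grp A (- int k)\<^esub>}" by (intro B) simp
    then show False using that dg_module_act_one_right[OF X x(1), of "- int k"] by auto
  qed
  have max: "?P (Greatest ?P)" "\<And>k. ?P k \<Longrightarrow> k \<le> Greatest ?P"
    using GreatestI_nat[of ?P, OF P0 bound] Greatest_le_nat[of ?P, OF _ bound] by blast+
  define k where "k = Greatest ?P"
  obtain a where a: "a \<in> carrier (grp A (- int k))" "act X p (- int k) x a \<noteq> \<one>\<^bsub>grp X (p - int k)\<^esub>"
    using max(1) unfolding k_def by blast
  have "act X (p - int k) j (act X p (- int k) x a) c = \<one>\<^bsub>grp X (p - int k + j)\<^esub>"
    if j: "j < 0" and c: "c \<in> carrier (grp A j)" for j c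
  proof -
    \<comment> \<open>Acting further by c gives x (a c) with a c of degree -l. As l > k, this
      product vanishes by the maximality of k.\<close>
    define l where "l = k + nat (-j)"
    have l: "- int k + j = - int l" "p - int k + j = p - int l" "l > k" using j by (auto simp: l_def)
    have "\<not> ?P l" using max(2) l(3) unfolding k_def by force
    moreover have "mul A (- int k) j a c \<in> carrier (grp A (- int l))"
      using mul_closed[OF a(1) c] l by simp
    ultimately have "act X p (- int l) x (mul A (- int k) j a c) = \<one>\<^bsub>grp X (p - int l)\<^esub>" by blast
    then show ?thesis unfolding l(2) using X.act_assoc[OF x(1) a(1) c] l(1) by simp
  qed
  then have "act X p (- int k) x a \<in> neg_annihilated A X (p - int k)"
    using X.act_closed[OF x(1) a(1)] by (simp add: neg_annihilated_def)
  then show thesis using a(2) that by blast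
qed

lemma neg_annihilated_act_closed:
  assumes X: "dg_module A X" and y: "y \<in> neg_annihilated A X m" and a: "a \<in> carrier (grp A 0)"
  shows "act X m 0 y a \<in> neg_annihilated A X m"
proof -
  interpret X: dg_module A X by (rule X)
  have y': "y \<in> carrier (grp X m)" using y by (simp add: neg_annihilated_def)
  show ?thesis
    using y X.act_closed[OF y' a] X.act_assoc[OF y' a] mul_closed[OF a]
    by (auto simp: neg_annihilated_def)
qed

lemma subgroup_neg_annihilated:
  assumes X: "dg_module A X"
  shows "subgroup (neg_annihilated A X m) (grp X m)"
proof -
  interpret G: comm_group "grp X m" by (rule dg_module_group[OF X])
  note h = dg_module_act_group_hom[OF X]
  have one: "\<one>\<^bsub>grp X i\<^esub> \<otimes>\<^bsub>grp X i\<^esub> \<one>\<^bsub>grp X i\<^esub> = \<one>\<^bsub>grp X i\<^esub>" for i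
    using dg_module_group[OF X, of i] by (simp add: comm_group_def comm_monoid_def monoid.l_one monoid.one_closed)
  show ?thesis
    by (rule G.subgroupI)
      (auto simp: neg_annihilated_def group_hom.hom_mult[OF h] group_hom.hom_inv[OF h] one
        dg_module_act_one_left[OF X] monoid.inv_one[OF group.is_monoid[OF comm_group_is_group[OF dg_module_group[OF X]]]]
        intro!: exI[of _ "\<one>\<^bsub>grp X m\<^esub>"])
qed

text \<open>The Leibniz rule for y a = 0 reads 0 = (dy) a + (-1)^m y d(a). If j < -1, then d(a)
  still has negative degree and kills y; if j = -1, moving the second term to the other side turns
  (-1)^m into (-1)^(m+1).\<close>

lemma
  assumes X: "dg_module A X" and y: "y \<in> neg_annihilated A X m"
  shows neg_annihilated_diff_act: "\<lbrakk>a \<in> carrier (grp A j); j < -1\<rbrakk>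
      \<Longrightarrow> act X (m + 1) j (diff X m y) a = \<one>\<^bsub>grp X (m + 1 + j)\<^esub>"
    and neg_annihilated_diff_act_minus_one: "a \<in> carrier (grp A (-1))
      \<Longrightarrow> act X (m + 1) (-1) (diff X m y) a = signed (grp X m) (m + 1) (act X m 0 y (diff A (-1) a))"
proof -
  interpret X: dg_module A X by (rule X)
  have y': "y \<in> carrier (grp X m)"
    and ann: "\<And>j a. \<lbrakk>j < 0; a \<in> carrier (grp A j)\<rbrakk> \<Longrightarrow> act X m j y a = \<one>\<^bsub>grp X (m + j)\<^esub>"
    using y by (auto simp: neg_annihilated_def)
  have leibniz: "\<one>\<^bsub>grp X (m + j + 1)\<^esub> = act X (m + 1) j (diff X m y) a \<otimes>\<^bsub>grp X (m + j + 1)\<^esub>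
      signed (grp X (m + j + 1)) m (act X m (j + 1) y (diff A j a))"
    if "a \<in> carrier (grp A j)" "j < 0" for a j
    using X.act_leibniz[OF y' that(1)] ann[OF that(2,1)] dg_module_diff_one[OF X] by simp
  have dy: "diff X m y \<in> carrier (grp X (m + 1))" by (rule dg_module_diff_closed[OF X y'])
  show "act X (m + 1) j (diff X m y) a = \<one>\<^bsub>grp X (m + 1 + j)\<^esub>"
    if a: "a \<in> carrier (grp A j)" and j: "j < -1"
  proof -
    interpret G: comm_group "grp X (m + j + 1)" by (rule dg_module_group[OF X])
    have "act X m (j + 1) y (diff A j a) = \<one>\<^bsub>grp X (m + (j + 1))\<^esub>"
      using ann[OF _ diff_closed[OF a]] j by simp
    then have "act X m (j + 1) y (diff A j a) = \<one>\<^bsub>grp X (m + j + 1)\<^esub>" by (simp only: add.assoc)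
    moreover have "act X (m + 1) j (diff X m y) a \<in> carrier (grp X (m + j + 1))"
      using X.act_closed[OF dy a] by (simp add: ac_simps)
    ultimately have "act X (m + 1) j (diff X m y) a = \<one>\<^bsub>grp X (m + j + 1)\<^esub>"
      using leibniz[OF a, symmetric] j by (simp add: G.signed_one)
    then show ?thesis by (simp add: ac_simps)
  qed
  show "act X (m + 1) (-1) (diff X m y) a = signed (grp X m) (m + 1) (act X m 0 y (diff A (-1) a))"
    if a: "a \<in> carrier (grp A (-1))"
  proof -
    interpret G: comm_group "grp X m" by (rule dg_module_group[OF X])
    let ?u = "act X (m + 1) (-1) (diff X m y) a" and ?v = "act X m 0 y (diff A (-1) a)"
    have u: "?u \<in> carrier (grp X m)" using X.act_closed[OF dy a] by simp
    have v: "?v \<in> carrier (grp X m)" using X.act_closed[OF y' diff_closed[OF a]] by simp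
    have "?u \<otimes>\<^bsub>grp X m\<^esub> signed (grp X m) m ?v = \<one>\<^bsub>grp X m\<^esub>" using leibniz[OF a] by simp
    then have "inv\<^bsub>grp X m\<^esub> signed (grp X m) m ?v = ?u"
      using G.inv_equality u G.signed_closed[OF v] by blast
    then show ?thesis using v by (auto simp: signed_def)
  qed
qed

text \<open>As d(a) lies in A^1 = 0, a single Leibniz term survives. So d is A^0-linear, which also
  makes the cycles stable under A^0.\<close>

lemma diff_act_degree_zero:
  assumes X: "dg_module A X" and y: "y \<in> carrier (grp X m)" and a: "a \<in> carrier (grp A 0)"
  shows "diff X m (act X m 0 y a) = act X (m + 1) 0 (diff X m y) a"
proof -
  interpret X: dg_module A X by (rule X)
  interpret G: comm_group "grp X (m + 1)" by (rule dg_module_group[OF X])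
  have "diff A 0 a = \<one>\<^bsub>grp A 1\<^esub>" using positive_degree[OF diff_closed[OF a]] by simp
  then have "act X m 1 y (diff A 0 a) = \<one>\<^bsub>grp X (m + 1)\<^esub>"
    using dg_module_act_one_right[OF X y] by simp
  moreover have "act X (m + 1) 0 (diff X m y) a \<in> carrier (grp X (m + 1))"
    using X.act_closed[OF dg_module_diff_closed[OF X y] a] by simp
  ultimately show ?thesis using X.act_leibniz[OF y a] by (simp add: G.signed_one)
qed

lemma right_module_sub:
  assumes X: "dg_module A X" and P: "subgroup P (grp X m)"
    and cl: "\<And>y a. \<lbrakk>y \<in> P; a \<in> carrier (grp A 0)\<rbrakk> \<Longrightarrow> act X m 0 y a \<in> P"
  shows "right_module R0 ((degree_part X m)\<lparr>carrier := P\<rparr>)"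
proof (rule right_module_inj_preimage[OF right_module_degree_part[OF X, of m], where f = "\<lambda>x. x"])
  show "comm_group ((degree_part X m)\<lparr>carrier := P\<rparr>)"
    by (rule comm_group_surj_image[OF comm_group.comm_group_subgroup[OF dg_module_group[OF X] P],
          where p = "\<lambda>x. x"]) simp_all
qed (use subgroup.subset[OF P] cl in \<open>auto simp: hom_def\<close>)

text \<open>P consists of cycles killed by A^j for j < 0, so P placed in degree m is a dg submodule.
  The shift by -m moves the degree 0 of \<open>D_part False\<close> to m; admissibility is the
  Leibniz identity for dy = 0.\<close>

lemma embeds_top_part:
  assumes X: "dg_module A X" and P: "subgroup P (grp X m)" "P \<subseteq> neg_annihilated A X m"
    and cl: "\<And>y a. \<lbrakk>y \<in> P; a \<in> carrier (grp A 0)\<rbrakk> \<Longrightarrow> act X m 0 y a \<in> P"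
    and d: "\<And>y. y \<in> P \<Longrightarrow> diff X m y = \<one>\<^bsub>grp X (m + 1)\<^esub>"
  defines "M \<equiv> (degree_part X m)\<lparr>carrier := P\<rparr>"
  shows "D_admissible False A M" and "dgMod.embeds A (shift (-m) (D_part False A M)) X"
proof -
  have M: "right_module R0 M" unfolding M_def by (rule right_module_sub[OF X P(1) cl])
  have [simp]: "carrier M = P" "\<one>\<^bsub>M\<^esub> = \<one>\<^bsub>grp X m\<^esub>" "mult M = mult (grp X m)" "ract M = act X m 0"
    by (simp_all add: M_def)
  have Pc: "y \<in> carrier (grp X m)"
    and Pa: "\<And>j a. \<lbrakk>j < 0; a \<in> carrier (grp A j)\<rbrakk> \<Longrightarrow> act X m j y a = \<one>\<^bsub>grp X (m + j)\<^esub>" if "y \<in> P" for y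
    using P(2) that by (auto simp: neg_annihilated_def)
  note one_c = dg_module_one_closed[OF X]
  have P1: "\<one>\<^bsub>grp X m\<^esub> \<in> P" by (rule subgroup.one_closed[OF P(1)])
  note G = comm_group_is_group[OF dg_module_group[OF X]]
  show adm: "D_admissible False A M"
  proof -
    have "act X m 0 y (diff A (-1) a) = \<one>\<^bsub>grp X m\<^esub>" if y: "y \<in> P" and a: "a \<in> carrier (grp A (-1))" for y a
    proof -
      have "act X m 0 y (diff A (-1) a) \<in> carrier (grp X m)"
        using Pc cl[OF y] diff_closed[OF a] by simp
      moreover have "\<one>\<^bsub>grp X m\<^esub> = signed (grp X m) (m + 1) (act X m 0 y (diff A (-1) a))"
        using neg_annihilated_diff_act_minus_one[OF X _ a, of y m] d[OF y] y P(2)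
          dg_module_act_one_left[OF X a, of "m + 1"] by auto
      ultimately show ?thesis using group.signed_eq_one_iff[OF G] by metis
    qed
    then show ?thesis by (simp add: D_admissible_def)
  qed
  let ?E = "shift (-m) (D_part False A M)"
  have E: "dg_module A ?E" by (rule dg_module_shift[OF dg_module_D_part[OF M adm]])
  let ?f = "\<lambda>i x. if i = m then x else \<one>\<^bsub>grp X i\<^esub>"
  have cE: "x \<in> carrier (grp ?E i) \<longleftrightarrow> (if i = m then x \<in> P else x = \<one>\<^bsub>grp X m\<^esub>)" for i x
    by auto
  have actE: "act ?E i j \<one>\<^bsub>grp X m\<^esub> a = \<one>\<^bsub>grp X m\<^esub>" if "a \<in> carrier (grp A j)" for i j a
    using dg_module_act_one_left[OF E that, of i] by simp
  have diffE: "diff ?E i x = \<one>\<^bsub>grp X m\<^esub>" if "x \<in> carrier (grp ?E i)" for i x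
  proof -
    have "diff (D_part False A M) (-m + i) x = \<one>\<^bsub>grp (D_part False A M) (-m + i + 1)\<^esub>"
      using that by (auto split: if_splits)
    then show ?thesis
      using group.signed_one[OF comm_group_is_group[OF comm_group_D_part[OF right_module_comm_group[OF M]]]]
      by (metis D_part_simps(3) \<open>\<one>\<^bsub>M\<^esub> = \<one>\<^bsub>grp X m\<^esub>\<close> shift_simps(2))
  qed
  have "(\<lambda>i. restrict (?f i) (carrier (grp ?E i))) \<in> Hom (dgMod A) ?E X"
  proof (rule dgMod_HomI[OF E])
    fix i x assume x: "x \<in> carrier (grp ?E i)"
    then show "?f i x \<in> carrier (grp X i)" using Pc one_c by (auto simp: cE)
    show "?f i (x \<otimes>\<^bsub>grp ?E i\<^esub> y) = ?f i x \<otimes>\<^bsub>grp X i\<^esub> ?f i y" if "y \<in> carrier (grp ?E i)" for y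
      using x that one_c group.is_monoid[OF G] by (simp add: monoid.l_one)
    show "?f (i + 1) (diff ?E i x) = diff X i (?f i x)"
      unfolding diffE[OF x] using x d dg_module_diff_one[OF X] by (auto simp: cE)
    show "?f (i + j) (act ?E i j x a) = act X i j (?f i x) a" if a: "a \<in> carrier (grp A j)" for j a
    proof (cases "i = m")
      case True
      then have xP: "x \<in> P" using x by (simp add: cE)
      consider "j > 0" | "j = 0" | "j < 0" by linarith
      then show ?thesis
      proof cases
        case 1
        then show ?thesis
          using positive_degree[OF a] dg_module_act_one_right[OF X Pc[OF xP], of j] True by simp
      next
        case 2
        then show ?thesis using True by simp
      next
        case 3
        then show ?thesis using Pa[OF xP 3 a] True by simp
      qed
    next
      case False
      then have "x = \<one>\<^bsub>grp X m\<^esub>" using x by (simp add: cE)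
      then show ?thesis using False actE[OF a, of i] dg_module_act_one_left[OF X a, of i] by simp
    qed
  qed
  then show "dgMod.embeds A ?E X"
    by (rule dgMod.embedsI[rotated 2]) (use E X in \<open>auto simp: cE inj_on_def\<close>)
qed

text \<open>P and d(P), in degrees m and m + 1, have to match the degrees -1 and 0 of D, which
  forces the shift by -(m + 1). The hypothesis \<open>d\<close> makes P -> d(P) bijective, so a
  single module M serves for both degrees.\<close>

lemma embeds_two_parts:
  assumes X: "dg_module A X" and P: "subgroup P (grp X m)" "P \<subseteq> neg_annihilated A X m"
    and cl: "\<And>y a. \<lbrakk>y \<in> P; a \<in> carrier (grp A 0)\<rbrakk> \<Longrightarrow> act X m 0 y a \<in> P"
    and d: "\<And>y. \<lbrakk>y \<in> P; diff X m y = \<one>\<^bsub>grp X (m + 1)\<^esub>\<rbrakk> \<Longrightarrow> y = \<one>\<^bsub>grp X m\<^esub>"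
  defines "M \<equiv> (degree_part X m)\<lparr>carrier := P\<rparr>"
  shows "dgMod.embeds A (shift (-(m + 1)) (D_part True A M)) X"
proof -
  interpret X: dg_module A X by (rule X)
  have M: "right_module R0 M" unfolding M_def by (rule right_module_sub[OF X P(1) cl])
  have [simp]: "carrier M = P" "\<one>\<^bsub>M\<^esub> = \<one>\<^bsub>grp X m\<^esub>" "mult M = mult (grp X m)" "ract M = act X m 0"
    by (simp_all add: M_def)
  have Pc: "y \<in> carrier (grp X m)"
    and Pa: "\<And>j a. \<lbrakk>j < 0; a \<in> carrier (grp A j)\<rbrakk> \<Longrightarrow> act X m j y a = \<one>\<^bsub>grp X (m + j)\<^esub>" if "y \<in> P" for y
    using P(2) that by (auto simp: neg_annihilated_def)
  note one_c = dg_module_one_closed[OF X]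
  have P1: "\<one>\<^bsub>grp X m\<^esub> \<in> P" by (rule subgroup.one_closed[OF P(1)])
  have G: "comm_group (grp X i)" for i by (rule dg_module_group[OF X])
  have g: "group (grp X i)" for i by (rule comm_group_is_group[OF G])
  note sc = group.signed_closed[OF g] and ss = group.signed_signed[OF g] and s1 = group.signed_one[OF g]
  let ?n = "-(m + 1)"
  let ?E = "shift ?n (D_part True A M)"
  have E: "dg_module A ?E" by (rule dg_module_shift[OF dg_module_D_part[OF M]]) simp
  have cE: "x \<in> carrier (grp ?E i) \<longleftrightarrow> (if i = m \<or> i = m + 1 then x \<in> P else x = \<one>\<^bsub>grp X m\<^esub>)" for i x
    by auto
  have dc: "diff X m y \<in> carrier (grp X (m + 1))" if "y \<in> P" for y
    using dg_module_diff_closed[OF X Pc[OF that]] .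
  \<comment> \<open>The shift multiplies the differential of D by (-1)^(m+1), so the plain map d
    would be off by that sign in degree m + 1. The factor put in here compensates for it, and the
    same factor makes the action of A^{-1} match.\<close>
  let ?s = "\<lambda>x. signed (grp X (m + 1)) (m + 1) (diff X m x)"
  let ?f = "\<lambda>i x. if i = m then x else if i = m + 1 then ?s x else \<one>\<^bsub>grp X i\<^esub>"
  have f1: "?f i \<one>\<^bsub>grp X m\<^esub> = \<one>\<^bsub>grp X i\<^esub>" for i
    by (simp add: dg_module_diff_one[OF X] s1)
  have actE1: "act ?E i j \<one>\<^bsub>grp X m\<^esub> a = \<one>\<^bsub>grp X m\<^esub>" if "a \<in> carrier (grp A j)" for i j a
    using dg_module_act_one_left[OF E that, of i] by simp
  have actE0: "act ?E i j x \<one>\<^bsub>grp A j\<^esub> = \<one>\<^bsub>grp X m\<^esub>" if "x \<in> carrier (grp ?E i)" for i j x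
    using dg_module_act_one_right[OF E that, of j] by simp
  have sM: "signed (grp (D_part True A M) i) k x = signed (grp X m) k x"
    if x: "x \<in> carrier (grp (D_part True A M) i)" for i k x
  proof -
    have xP: "x \<in> P" using x P1 by (auto split: if_splits)
    have "group_hom M (grp X m) (\<lambda>x. x)"
      by (rule comm_group_homD[OF right_module_comm_group[OF M] G]) (auto simp: hom_def Pc)
    then have "signed M k x = signed (grp X m) k x"
      using group_hom.hom_signed[of M "grp X m" "\<lambda>x. x" x k] xP by simp
    then show ?thesis using signed_D_part[OF right_module_comm_group[OF M] x] by simp
  qed
  have diffE: "diff ?E i x = (if i = m then signed (grp X m) ?n x else \<one>\<^bsub>grp X m\<^esub>)"
    if x: "x \<in> carrier (grp ?E i)" for i x
    using x P1 by (auto simp: sM s1)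
  have hom: "(\<lambda>i. restrict (?f i) (carrier (grp ?E i))) \<in> Hom (dgMod A) ?E X"
  proof (rule dgMod_HomI[OF E])
    fix i x assume x: "x \<in> carrier (grp ?E i)"
    then show "?f i x \<in> carrier (grp X i)" using Pc one_c dc sc by (auto simp: cE)
    show "?f i (x \<otimes>\<^bsub>grp ?E i\<^esub> y) = ?f i x \<otimes>\<^bsub>grp X i\<^esub> ?f i y" if y: "y \<in> carrier (grp ?E i)" for y
    proof -
      have "?s (x \<otimes>\<^bsub>grp X m\<^esub> y) = ?s x \<otimes>\<^bsub>grp X (m + 1)\<^esub> ?s y" if "i = m + 1"
        using x y that Pc dc by (simp add: dg_module_diff_mult[OF X] comm_group.signed_mult[OF G])
      then show ?thesis
        using one_c group.is_monoid[OF g] by (simp add: monoid.l_one)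
    qed
    show "?f (i + 1) (diff ?E i x) = diff X i (?f i x)"
    proof -
      consider "i = m" | "i = m + 1" | "i \<noteq> m" "i \<noteq> m + 1" by blast
      then show ?thesis
      proof cases
        case 1
        then have "x \<in> P" using x by simp
        then show ?thesis
          using 1 diffE[OF x] group_hom.hom_signed[OF dg_module_diff_group_hom[OF X] Pc] dc[of x]
          by (simp add: ss signed_even)
      next
        case 2
        then have "x \<in> P" using x by simp
        then show ?thesis
          using 2 diffE[OF x] group_hom.hom_signed[OF dg_module_diff_group_hom[OF X] dc]
          by (simp add: dg_module_diff_diff[OF X Pc] s1)
      next
        case 3
        then show ?thesis using diffE[OF x] f1[of "i + 1"] dg_module_diff_one[OF X] by simp
      qed
    qed
    show "?f (i + j) (act ?E i j x a) = act X i j (?f i x) a" if a: "a \<in> carrier (grp A j)" for j a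
    proof -
      consider "j > 0" | "i \<noteq> m" "i \<noteq> m + 1" | "j \<le> 0" "i = m" | "j \<le> 0" "i = m + 1" by linarith
      then show ?thesis
      proof cases
        case 1
        have "?f i x \<in> carrier (grp X i)" using x Pc one_c dc sc by (auto simp: cE)
        then show ?thesis
          using positive_degree[OF a 1] dg_module_act_one_right[OF X, of "?f i x" i j] actE0[OF x, of j]
            f1[of "i + j"] by (simp add: dg_module_diff_one[OF X] s1)
      next
        case 2
        then have "x = \<one>\<^bsub>grp X m\<^esub>" using x by (simp add: cE)
        then show ?thesis
          using actE1[OF a, of i] f1[of "i + j"] 2 dg_module_act_one_left[OF X a, of i]
          by (simp add: dg_module_diff_one[OF X] s1)
      next
        case 3
        then have xP: "x \<in> P" using x by simp
        show ?thesis
        proof (cases "j = 0")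
          case False
          then have "act ?E i j x a = \<one>\<^bsub>grp X m\<^esub>" using 3 by simp
          then show ?thesis using f1[of "i + j"] Pa[OF xP _ a] 3 False by simp
        qed (use 3 in simp)
      next
        case 4
        then have xP: "x \<in> P" using x by simp
        then have xN: "x \<in> neg_annihilated A X m" using P(2) by blast
        have r: "act X i j (?f i x) a = signed (grp X (m + 1 + j)) (m + 1) (act X (m + 1) j (diff X m x) a)"
          using 4 group_hom.hom_signed[OF dg_module_act_group_hom[OF X a] dc[OF xP]] by simp
        consider "j = 0" | "j = -1" | "j < -1" using 4 by linarith
        then show ?thesis
        proof cases
          case 1
          then show ?thesis unfolding r using 4 diff_act_degree_zero[OF X Pc[OF xP]] a by simp
        next
          case 2
          \<comment> \<open>The factor (-1)^(m+1) in \<open>?s\<close> meets the equal factor from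
            the Leibniz identity, and x d(a) is left, as in D.\<close>
          have "act X m 0 x (diff A (-1) a) \<in> carrier (grp X m)"
            using Pc cl[OF xP] diff_closed[OF a] 2 by simp
          then show ?thesis
            unfolding r using 2 4 neg_annihilated_diff_act_minus_one[OF X xN] a
            by (simp add: ss signed_even)
        next
          case 3
          then have "act ?E i j x a = \<one>\<^bsub>grp X m\<^esub>" using 4 by simp
          then show ?thesis
            unfolding r using 3 4 neg_annihilated_diff_act[OF X xN a] f1[of "i + j"] by (simp add: s1)
        qed
      qed
    qed
  qed
  have inj: "inj_on (restrict (?f i) (carrier (grp ?E i))) (carrier (grp ?E i))" for i
  proof (cases "i = m + 1")
    case True
    have "inj_on ?s P"
    proof -
      interpret h: group_hom "M" "grp X (m + 1)" ?s
        by (rule comm_group_homD[OF right_module_comm_group[OF M] G])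
          (auto simp: hom_def Pc dc sc dg_module_diff_mult[OF X] comm_group.signed_mult[OF G])
      show ?thesis
        using h.inj_on_one_iff d group.signed_eq_one_iff[OF g] dc by auto
    qed
    then show ?thesis using True by (auto simp: inj_on_def)
  qed (auto simp: inj_on_def)
  show ?thesis by (rule dgMod.embedsI[OF _ _ hom inj]) (use E X in simp_all)
qed

text \<open>The flag \<open>c\<close> hands both cases on as one statement: it is
  \<open>True\<close> if \<open>neg_annihilated\<close> has no nonzero cycle and
  \<open>False\<close> if its cycles form a nonzero module.\<close>

lemma contains_shift_D_part:
  assumes b: "bounded_dg A" and X: "dg_module A X" and nt: "\<not> dgMod.trivial X"
  obtains M c n where "right_module R0 M" "D_admissible c A M" "\<not> RMod.trivial M"
    "dgMod.embeds A (shift n (D_part c A M)) X"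
proof -
  obtain m y where y: "y \<in> neg_annihilated A X m" "y \<noteq> \<one>\<^bsub>grp X m\<^esub>"
    using neg_annihilated_nontrivial[OF assms] by blast
  let ?N = "neg_annihilated A X m"
  let ?Z = "{y \<in> ?N. diff X m y = \<one>\<^bsub>grp X (m + 1)\<^esub>}"
  have N: "subgroup ?N (grp X m)" by (rule subgroup_neg_annihilated[OF X])
  have Nc: "?N \<subseteq> carrier (grp X m)" by (rule subgroup.subset[OF N])
  have nontriv: "\<not> RMod.trivial ((degree_part X m)\<lparr>carrier := P\<rparr>)"
    if "z \<in> P" "z \<noteq> \<one>\<^bsub>grp X m\<^esub>" for P z
    using that by (auto simp: RMod_trivial_iff)
  show thesis
  proof (cases "?Z \<subseteq> {\<one>\<^bsub>grp X m\<^esub>}")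
    case True
    show thesis
    proof (rule that)
      show "right_module R0 ((degree_part X m)\<lparr>carrier := ?N\<rparr>)"
        by (rule right_module_sub[OF X N neg_annihilated_act_closed[OF X]])
      show "dgMod.embeds A (shift (-(m + 1)) (D_part True A ((degree_part X m)\<lparr>carrier := ?N\<rparr>))) X"
        by (rule embeds_two_parts[OF X N subset_refl neg_annihilated_act_closed[OF X]]) (use True in auto)
    qed (use nontriv[OF y] in auto)
  next
    case False
    then obtain z where z: "z \<in> ?Z" "z \<noteq> \<one>\<^bsub>grp X m\<^esub>" by blast
    have "?Z = ?N \<inter> kernel (grp X m) (grp X (m + 1)) (diff X m)"
      using Nc by (auto simp: kernel_def)
    then have Z: "subgroup ?Z (grp X m)"
      using group.subgroups_Inter_pair[OF comm_group_is_group[OF dg_module_group[OF X]] N group_hom.subgroup_kernel[OF dg_module_diff_group_hom[OF X]]] by simp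
    have cl: "act X m 0 y a \<in> ?Z" if y: "y \<in> ?Z" and a: "a \<in> carrier (grp A 0)" for y a
      using y a neg_annihilated_act_closed[OF X _ a] diff_act_degree_zero[OF X _ a, of y m] Nc
        dg_module_act_one_left[OF X a, of "m + 1"] by auto
    let ?M = "(degree_part X m)\<lparr>carrier := ?Z\<rparr>"
    have "D_admissible False A ?M" "dgMod.embeds A (shift (-m) (D_part False A ?M)) X"
      by (rule embeds_top_part[OF X Z _ cl]; blast)+
    then show thesis using that right_module_sub[OF X Z cl] nontriv[OF z] by blast
  qed
qed

text \<open>The dg module \<open>shift n (D_part c A M)\<close> sits both in X and in D(M)[n]. The
  first embedding makes it, and hence M, monoform; both together identify the atoms.\<close>

lemma monoform_atom_D:
  assumes b: "bounded_dg A" and m: "monoform (dgMod A) X"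
  obtains M n where "monoform (RMod R0) M" "atom (dgMod A) X = atom (dgMod A) (shift n (D A M))"
proof -
  obtain M c n where M: "right_module R0 M" "D_admissible c A M" "\<not> RMod.trivial M"
    "dgMod.embeds A (shift n (D_part c A M)) X"
    by (rule contains_shift_D_part[OF b, of X])
      (use dgMod.monoform_Obj[OF m] dgMod.monoform_nontrivial[OF m] in auto)
  have nt: "\<not> dgMod.trivial (shift n (D_part c A M))" using M(3) by (simp add: trivial_shift_D_part)
  have mM: "monoform (RMod R0) M"
    by (rule monoform_of_D_part[OF M(1,2) dgMod.monoform_embeds[OF m M(4) nt]])
  have "atom (dgMod A) X = atom (dgMod A) (shift n (D A M))"
    by (rule dgMod.atom_eqI[OF m monoform_D[OF mM] nt M(4) embeds_shift[OF embeds_D_part_D[OF M(1,2)]]])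
  then show thesis using that mM by blast
qed

text \<open>Shifting a common subobject of X and D(H)[n] gives one of X[k] and D(H)[k+n], so all
  monoform shifts of representatives have the same atom. The representative D(H)[n] itself
  guarantees that the union contains this atom.\<close>

lemma shift_atom_D:
  assumes m: "monoform (RMod R0) H"
  shows "shift_atom A k (atom (dgMod A) (shift n (D A H))) = atom (dgMod A) (shift (k + n) (D A H))"
proof -
  have H: "right_module R0 H" using RMod.monoform_Obj[OF m] by simp
  have dH: "dg_module A (D A H)" using dg_module_D_part[OF H, of True] by (simp add: D_part_True)
  let ?E = "\<lambda>n. shift n (D A H)"
  have trans: "dgMod.embeds A (shift k (?E n)) (?E (k + n))" by (rule embeds_shift_shift[OF dH])
  have nontrivial: "\<not> dgMod.trivial (shift k N)" if "\<not> dgMod.trivial N" for N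
  proof
    assume t: "dgMod.trivial (shift k N)"
    have "carrier (grp N i) = {\<one>\<^bsub>grp N i\<^esub>}" for i
      using t[unfolded dgMod.trivial_def, rule_format, of "i - k"] by simp
    then show False using that by (simp add: dgMod.trivial_def)
  qed
  have eq: "atom (dgMod A) (shift k X) = atom (dgMod A) (?E (k + n))"
    if X: "X \<in> atom (dgMod A) (?E n)" and sX: "monoform (dgMod A) (shift k X)" for X
  proof -
    obtain N where N: "\<not> dgMod.trivial N" "dgMod.embeds A N (?E n)" "dgMod.embeds A N X"
      using X unfolding dgMod.mem_atom_iff dgMod.common_nonzero_subobject_iff by blast
    show ?thesis
      by (rule dgMod.atom_eqI[OF sX monoform_D[OF m] nontrivial[OF N(1)] embeds_shift[OF N(3)]
            dgMod.embeds_trans[OF embeds_shift[OF N(2)] trans]])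
  qed
  \<comment> \<open>Each X[k] contributes either the expected atom or, if it is not monoform, the
    empty set, so the union can be computed by these two cases.\<close>
  have empty: "atom (dgMod A) X = {}" if "\<not> monoform (dgMod A) X" for X
    using that by (auto simp: dgMod.mem_atom_iff)
  have self: "?E n \<in> atom (dgMod A) (?E n)" by (rule dgMod.self_mem_atom[OF monoform_D[OF m]])
  moreover have "monoform (dgMod A) (shift k (?E n))"
    by (rule dgMod.monoform_embeds[OF monoform_D[OF m] trans])
      (rule nontrivial[OF dgMod.monoform_nontrivial[OF monoform_D[OF m]]])
  ultimately show ?thesis unfolding shift_atom_def using eq empty by blast
qed

section \<open>The bijection of spectra and the orbits of the shift action\<close>

definition atom_of :: "('a, 'm) right_module set \<times> int \<Rightarrow> ('a, 'm) dg_module set" where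
  "atom_of = (\<lambda>(\<alpha>, n). atom (dgMod A) (shift n (D A (SOME H. monoform (RMod R0) H \<and> \<alpha> = atom (RMod R0) H))))"

text \<open>The value does not depend on the representative picked by \<open>SOME\<close>:
  \<open>atom_D_eq_iff\<close> for equal shifts says that the atom of D(H)[n] depends only on the
  atom of H.\<close>

lemma atom_of_atom:
  assumes m: "monoform (RMod R0) H"
  shows "atom_of (atom (RMod R0) H, n) = atom (dgMod A) (shift n (D A H))"
proof -
  let ?K = "SOME K. monoform (RMod R0) K \<and> atom (RMod R0) H = atom (RMod R0) K"
  have K: "monoform (RMod R0) ?K \<and> atom (RMod R0) H = atom (RMod R0) ?K"
    by (rule someI[of _ H]) (simp add: m)
  then show ?thesis using atom_D_eq_iff[of ?K H n n] m by (simp add: atom_of_def)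
qed

text \<open>In the product description an integer acts by translating the second coordinate, so an
  orbit is a full fibre over \<alpha>, whatever its starting point n.\<close>

lemma orbit_atom_of:
  assumes "\<alpha> \<in> Spec (RMod R0)"
  shows "orbit integer_group (shift_atom A) (atom_of (\<alpha>, n)) = range (\<lambda>k. atom_of (\<alpha>, k))"
proof -
  obtain H where H: "monoform (RMod R0) H" "\<alpha> = atom (RMod R0) H"
    using assms by (auto simp: RMod.Spec_eq)
  have "orbit integer_group (shift_atom A) (atom_of (\<alpha>, n)) = range (\<lambda>k. atom_of (\<alpha>, k + n))"
    by (auto simp: orbit_def H(2) atom_of_atom[OF H(1)] shift_atom_D[OF H(1)])
  also have "\<dots> = range (\<lambda>k. atom_of (\<alpha>, k))"
  proof (intro equalityI subsetI)
    fix x assume "x \<in> range (\<lambda>k. atom_of (\<alpha>, k))"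
    then obtain k where "x = atom_of (\<alpha>, k)" by blast
    then show "x \<in> range (\<lambda>k. atom_of (\<alpha>, k + n))" by (intro range_eqI[of _ _ "k - n"]) simp
  qed auto
  finally show ?thesis .
qed

text \<open>Injectivity is \<open>atom_D_eq_iff\<close>; surjectivity is
  \<open>monoform_atom_D\<close>, where boundedness enters.\<close>

lemma bij_betw_atom_of:
  assumes b: "bounded_dg A"
  shows "bij_betw atom_of (Spec (RMod R0) \<times> UNIV) (Spec (dgMod A))"
  unfolding bij_betw_def
proof
  show "inj_on atom_of (Spec (RMod R0) \<times> UNIV)"
    by (rule inj_onI) (auto simp: RMod.Spec_eq atom_of_atom atom_D_eq_iff)
  show "atom_of ` (Spec (RMod R0) \<times> UNIV) = Spec (dgMod A)"
  proof (intro equalityI subsetI)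
    fix \<beta> assume "\<beta> \<in> atom_of ` (Spec (RMod R0) \<times> UNIV)"
    then show "\<beta> \<in> Spec (dgMod A)"
      by (auto simp: RMod.Spec_eq dgMod.Spec_eq atom_of_atom intro!: imageI monoform_D)
  next
    fix \<beta> assume "\<beta> \<in> Spec (dgMod A)"
    then obtain X where X: "monoform (dgMod A) X" "\<beta> = atom (dgMod A) X" by (auto simp: dgMod.Spec_eq)
    obtain M n where "monoform (RMod R0) M" "\<beta> = atom (dgMod A) (shift n (D A M))"
      using monoform_atom_D[OF b X(1)] X(2) by metis
    then have "\<beta> = atom_of (atom (RMod R0) M, n)" "atom (RMod R0) M \<in> Spec (RMod R0)"
      by (simp_all add: atom_of_atom RMod.Spec_eq)
    then show "\<beta> \<in> atom_of ` (Spec (RMod R0) \<times> UNIV)" by blast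
  qed
qed

text \<open>Under \<open>atom_of\<close> the orbits are the fibres of the projection to the first
  coordinate. Each fibre meets the slice n = 0 exactly once, so this slice parametrizes the
  orbits.\<close>

lemma bij_betw_orbits:
  assumes b: "bounded_dg A"
  shows "bij_betw (\<lambda>\<alpha>. orbit integer_group (shift_atom A) (atom_of (\<alpha>, 0))) (Spec (RMod R0)) (SpecZ A)"
  unfolding bij_betw_def
proof
  note bij = bij_betw_atom_of[OF b]
  show "inj_on (\<lambda>\<alpha>. orbit integer_group (shift_atom A) (atom_of (\<alpha>, 0))) (Spec (RMod R0))"
  proof (rule inj_onI)
    fix \<alpha> \<beta> assume ab: "\<alpha> \<in> Spec (RMod R0)" "\<beta> \<in> Spec (RMod R0)"
      "orbit integer_group (shift_atom A) (atom_of (\<alpha>, 0)) = orbit integer_group (shift_atom A) (atom_of (\<beta>, 0))"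
    then have "atom_of (\<alpha>, 0) \<in> range (\<lambda>k. atom_of (\<beta>, k))"
      using orbit_atom_of[OF ab(1), of 0] orbit_atom_of[OF ab(2), of 0] by blast
    then obtain k where "atom_of (\<alpha>, 0) = atom_of (\<beta>, k)" by blast
    then show "\<alpha> = \<beta>" using bij_betw_imp_inj_on[OF bij] ab(1,2) by (auto dest: inj_onD)
  qed
  have "SpecZ A = (\<lambda>\<beta>. orbit integer_group (shift_atom A) \<beta>) ` atom_of ` (Spec (RMod R0) \<times> UNIV)"
    unfolding SpecZ_def orbits_def bij_betw_imp_surj_on[OF bij] by blast
  also have "\<dots> = (\<lambda>\<alpha>. orbit integer_group (shift_atom A) (atom_of (\<alpha>, 0))) ` Spec (RMod R0)"
  proof (intro equalityI subsetI)
    fix x assume "x \<in> (\<lambda>\<beta>. orbit integer_group (shift_atom A) \<beta>) ` atom_of ` (Spec (RMod R0) \<times> UNIV)"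
    then obtain \<alpha> n where a: "\<alpha> \<in> Spec (RMod R0)" "x = orbit integer_group (shift_atom A) (atom_of (\<alpha>, n))"
      by auto
    \<comment> \<open>By \<open>orbit_atom_of\<close> both orbits equal the fibre over \<alpha>, so
      n may be replaced by 0.\<close>
    then have "x = orbit integer_group (shift_atom A) (atom_of (\<alpha>, 0))" by (simp add: orbit_atom_of)
    then show "x \<in> (\<lambda>\<alpha>. orbit integer_group (shift_atom A) (atom_of (\<alpha>, 0))) ` Spec (RMod R0)"
      using a(1) by blast
  qed auto
  finally show "(\<lambda>\<alpha>. orbit integer_group (shift_atom A) (atom_of (\<alpha>, 0))) ` Spec (RMod R0) = SpecZ A" ..
qed

end


theorem proposition6p14:
  fixes A :: "'a dg_ring"
  assumes "dg_ring A"
    and "bounded_dg A"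
    and "non_positive_dg A"
    and "right_dg_noetherian A"
  shows "\<exists>(\<Phi> :: ('a, 'm) right_module set \<times> int \<Rightarrow> ('a, 'm) dg_module set)
           (\<Psi> :: ('a, 'm) right_module set \<Rightarrow> ('a, 'm) dg_module set set).
      bij_betw \<Phi> (Spec (RMod (degree0_ring A)) \<times> UNIV) (Spec (dgMod A)) \<and>
      (\<forall>H n. monoform (RMod (degree0_ring A)) H \<longrightarrow>
         \<Phi> (atom (RMod (degree0_ring A)) H, n) = atom (dgMod A) (shift n (D A H))) \<and>
      bij_betw \<Psi> (Spec (RMod (degree0_ring A))) (SpecZ A) \<and>
      (\<forall>\<alpha> \<in> Spec (RMod (degree0_ring A)). \<forall>n.
         \<Psi> \<alpha> = orbit integer_group (shift_atom A) (\<Phi> (\<alpha>, n)))"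
proof -
  interpret nonpositive_dg_ring A
    using assms by (simp add: nonpositive_dg_ring_def nonpositive_dg_ring_axioms_def)
  show ?thesis
    by (intro exI[of _ atom_of] exI[of _ "\<lambda>\<alpha>. orbit integer_group (shift_atom A) (atom_of (\<alpha>, 0))"]
        conjI allI ballI impI)
      (simp_all add: bij_betw_atom_of[OF assms(2)] atom_of_atom bij_betw_orbits[OF assms(2)] orbit_atom_of)
qed

end
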